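(* Let $a \ge 0$, $\alpha \ge 0$, $\beta \ge 0$ satisfy $\alpha \le \beta$ and $a\alpha \le \beta$, and put $\gamma = 0$ if $a \ge 1$ and $\gamma = (1-a)\alpha$ if $0 \le a < 1$. Let $u_0 \in C^2(\mathbb{R})$ and $u_1 \in C^1_b(\mathbb{R})$, and suppose there are positive constants $c_1, c_2, c_3, c_4$ such that for all $x \in \mathbb{R}$ (and for both choices of sign) $$c_1 \langle x\rangle^{-\alpha} \le u_0(x) \le c_2,$$ $$|u_1(x) \pm u_0(x)^a u_0'(x)| \le c_3 \langle x\rangle^{-\beta},$$ $$\left|\frac{d}{dx}\bigl(u_1(x) \pm u_0(x)^a u_0'(x)\bigr)\right| \le c_4 \langle x\rangle^{-\gamma}.$$ Let $F \in C([0,\infty)) \cap C^1((0,\infty))$ be such that for every $K>0$ there is a positive constant $C_K$ with $|F(\theta)| \le C_K \theta^a$ and $|F'(\theta)| \le C_K \theta^{a-1}$ for all $\theta \in (0,K]$. Then there exists a number $T>0$, depending on the constants $a, \alpha, \beta, \gamma$, $c_1, c_2, c_3, c_4$ and $C_K$ ($K>0$), such that the Cauchy problem $$\partial_t^2 u = \partial_x(u^{2a}\partial_x u) + F(u)\,\partial_x u, \quad (t,x) \in (0,T]\times\mathbb{R}, \qquad u(0,x)=u_0(x),\quad \partial_t u(0,x)=u_1(x), \quad x\in\mathbb{R},$$ has a unique local solution $u \in C^2([0,T]\times\mathbb{R})$ satisfying, for all $(t,x) \in [0,T]\times\mathbb{R}$ (and for both choices of sign), $$C_1 \langle x\rangle^{-\alpha}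 \le u(t,x) \le C_2,$$ $$|(u_t \pm u^a u_x)(t,x)| \le C_3 \langle x\rangle^{-\beta},$$ $$\bigl|\partial_t\bigl((u_t \pm u^a u_x)(t,x)\bigr)\bigr| + \bigl|\partial_x\bigl((u_t \pm u^a u_x)(t,x)\bigr)\bigr| \le C_4 \langle x\rangle^{-\gamma},$$ where $C_1, C_2, C_3, C_4$ are positive constants.
   Context: $\langle x\rangle = (1+x^2)^{1/2}$. For $m\in\mathbb{N}$, $C^m_b(\mathbb{R})$ is the set of $f\in C^m(\mathbb{R})$ such that $f$ and all its derivatives up to order $m$ are bounded. Subscripts $t,x$ denote partial derivatives. *)

theory Defs
  imports "HOL-Analysis.Analysis"
begin

definition japanese_bracket :: "real \<Rightarrow> real" where
  "japanese_bracket x = sqrt (1 + x\<^sup>2)"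

text \<open>Functions of class \<open>C\<^sup>m\<close> on an \<^emph>\<open>open\<close> set \<open>S\<close> of reals. (The two-sided derivative
  \<^const>\<open>deriv\<close> is the right one only because \<open>S\<close> is open.)\<close>

definition Ck_on :: "nat \<Rightarrow> real set \<Rightarrow> (real \<Rightarrow> real) \<Rightarrow> bool" where
  "Ck_on m S f \<longleftrightarrow>
     (\<forall>k<m. ((deriv ^^ k) f) differentiable_on S) \<and>
     (\<forall>k\<le>m. continuous_on S ((deriv ^^ k) f))"

definition Ckb :: "nat \<Rightarrow> (real \<Rightarrow> real) \<Rightarrow> bool" where
  "Ckb m f \<longleftrightarrow> Ck_on m UNIV f \<and> (\<forall>k\<le>m. bounded (range ((deriv ^^ k) f)))"

text \<open>Partial derivatives of a function \<open>u t x\<close> on the closed strip \<open>{0..T} \<times> \<real>\<close>. The time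
  derivative is taken within \<open>{0..T}\<close>, i.e. it is one-sided at \<open>t = 0\<close> and \<open>t = T\<close>, and
  does not depend on the values of \<open>u\<close> outside the strip.\<close>

definition dt :: "real \<Rightarrow> (real \<Rightarrow> real \<Rightarrow> real) \<Rightarrow> real \<Rightarrow> real \<Rightarrow> real" where
  "dt T u t x = vector_derivative (\<lambda>s. u s x) (at t within {0..T})"

definition dx :: "(real \<Rightarrow> real \<Rightarrow> real) \<Rightarrow> real \<Rightarrow> real \<Rightarrow> real" where
  "dx u t x = deriv (\<lambda>y. u t y) x"

text \<open>\<open>C\<^sup>k([0,T] \<times> \<real>)\<close>: all partial derivatives (mixed ones in any order) up to order \<open>k\<close>
  exist on the closed strip and are jointly continuous there.\<close>

primrec Ck_strip :: "real \<Rightarrow> nat \<Rightarrow> (real \<Rightarrow> real \<Rightarrow> real) \<Rightarrow> bool" where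
  "Ck_strip T 0 u \<longleftrightarrow> continuous_on ({0..T} \<times> UNIV) (\<lambda>(t, x). u t x)"
| "Ck_strip T (Suc k) u \<longleftrightarrow>
     continuous_on ({0..T} \<times> UNIV) (\<lambda>(t, x). u t x) \<and>
     (\<forall>t\<in>{0..T}. \<forall>x. (\<lambda>s. u s x) differentiable (at t within {0..T}) \<and>
                      (\<lambda>y. u t y) differentiable (at x)) \<and>
     Ck_strip T k (dt T u) \<and> Ck_strip T k (dx u)"

text \<open>The conditions on \<open>u\<close> ignore its values outside the strip. All powers with real exponent
  below are used with a positive base (in particular \<open>u powr 0 = 1\<close>), because positivity of
  the unknown is part of the bounds imposed on solutions.\<close>

definition cauchy_solution ::
  "real \<Rightarrow> (real \<Rightarrow> real) \<Rightarrow> (real \<Rightarrow> real) \<Rightarrow> (real \<Rightarrow> real) \<Rightarrow> real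
     \<Rightarrow> (real \<Rightarrow> real \<Rightarrow> real) \<Rightarrow> bool" where
  "cauchy_solution a F u0 u1 T u \<longleftrightarrow>
     Ck_strip T 2 u \<and>
     (\<forall>t\<in>{0<..T}. \<forall>x.
        dt T (dt T u) t x
          = dx (\<lambda>s y. u s y powr (2 * a) * dx u s y) t x + F (u t x) * dx u t x) \<and>
     (\<forall>x. u 0 x = u0 x \<and> dt T u 0 x = u1 x)"

definition char_comb ::
  "real \<Rightarrow> real \<Rightarrow> real \<Rightarrow> (real \<Rightarrow> real \<Rightarrow> real) \<Rightarrow> real \<Rightarrow> real \<Rightarrow> real" where
  "char_comb \<sigma> a T u t x = dt T u t x + \<sigma> * (u t x powr a * dx u t x)"

definition solution_bounds ::
  "real \<Rightarrow> real \<Rightarrow> real \<Rightarrow> real \<Rightarrow> real \<Rightarrow> real \<Rightarrow> real \<Rightarrow> real \<Rightarrow> real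
     \<Rightarrow> (real \<Rightarrow> real \<Rightarrow> real) \<Rightarrow> bool" where
  "solution_bounds a \<alpha> \<beta> \<gamma> C1 C2 C3 C4 T u \<longleftrightarrow>
     (\<forall>t\<in>{0..T}. \<forall>x.
        C1 * japanese_bracket x powr (- \<alpha>) \<le> u t x \<and> u t x \<le> C2 \<and>
        (\<forall>\<sigma>\<in>{1, -1}.
           \<bar>char_comb \<sigma> a T u t x\<bar> \<le> C3 * japanese_bracket x powr (- \<beta>) \<and>
           \<bar>dt T (char_comb \<sigma> a T u) t x\<bar> + \<bar>dx (char_comb \<sigma> a T u) t x\<bar>
             \<le> C4 * japanese_bracket x powr (- \<gamma>)))"

text \<open>The hypotheses on the data and on \<open>F\<close>, with explicit constants; \<open>CK K\<close> is the constant
  belonging to the range \<open>{0<..K}\<close>.\<close>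

definition admissible_data ::
  "real \<Rightarrow> real \<Rightarrow> real \<Rightarrow> real \<Rightarrow> real \<Rightarrow> real \<Rightarrow> real \<Rightarrow> real
     \<Rightarrow> (real \<Rightarrow> real) \<Rightarrow> (real \<Rightarrow> real) \<Rightarrow> bool" where
  "admissible_data a \<alpha> \<beta> \<gamma> c1 c2 c3 c4 u0 u1 \<longleftrightarrow>
     Ck_on 2 UNIV u0 \<and> Ckb 1 u1 \<and>
     (\<forall>x. c1 * japanese_bracket x powr (- \<alpha>) \<le> u0 x \<and> u0 x \<le> c2 \<and>
        (\<forall>\<sigma>\<in>{1, -1}.
           \<bar>u1 x + \<sigma> * (u0 x powr a * deriv u0 x)\<bar> \<le> c3 * japanese_bracket x powr (- \<beta>) \<and>
           \<bar>deriv (\<lambda>y. u1 y + \<sigma> * (u0 y powr a * deriv u0 y)) x\<bar>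
             \<le> c4 * japanese_bracket x powr (- \<gamma>)))"

definition admissible_nonlinearity ::
  "real \<Rightarrow> (real \<Rightarrow> real) \<Rightarrow> (real \<Rightarrow> real) \<Rightarrow> bool" where
  "admissible_nonlinearity a CK F \<longleftrightarrow>
     continuous_on {0..} F \<and> Ck_on 1 {0<..} F \<and>
     (\<forall>K>0. \<forall>\<theta>\<in>{0<..K}. \<bar>F \<theta>\<bar> \<le> CK K * \<theta> powr a \<and> \<bar>deriv F \<theta>\<bar> \<le> CK K * \<theta> powr (a - 1))"

end

(* Put c = u^a, R = u_t + c u_x, S = u_t - c u_x. In the coordinate y with dy = u0^(-a) dx the
   functions v = ln u, R/u, S/u satisfy a diagonal first order system; the scale invariance of the
   equation makes its coefficients and the Lipschitz constants of the data bounded in terms of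
   the given constants alone, although u0 may tend to 0 at infinity. This is why one T serves all
   data. The system is solved by a contraction for the solution together with its characteristics
   in a class of Lipschitz functions, and the difference quotients of the fixed point are shown to
   be Cauchy, locally uniformly because of finite propagation speed. The relation between v_y and
   R - S persists since both sides have the same time derivative, so exp v solves the
   wave equation. The weighted bounds follow by inserting them into the integral equations along
   characteristics, where they improve themselves. Two solutions agree by a maximum principle on
   the backward cone for the differences of u, R and S. *)

theory Submission
  imports Defs
begin

section \<open>Integrals, fixed points and absorption\<close>

text \<open>The lower bound on u0 lets 1/u be unbounded, and 1/u multiplies the quadratic terms in
  the equations for R and S. The ratios R/u and S/u remove it, and the exponents are what they need:
  \<alpha> \<le> \<beta> bounds the ratios; \<gamma> is chosen so that u0^(a-1) <x>^(-\<gamma>), the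
  size of their slopes in y, is bounded; together with a \<alpha> \<le> \<beta> it makes the squared
  ratios bounded by a multiple of that same weight, so that the quadratic source is no worse than
  the slopes. In the coordinate y the speed is (u/u0)^a, which stays between fixed positive bounds
  however small u0 is. A contraction in a C^1 norm is obstructed: comparing the slopes of two
  candidates along their different characteristics would require slopes that are Lipschitz
  themselves. Difference quotients of one fixed Lipschitz solution avoid this comparison. Since ln u
  is unbounded below, the derivative arguments are local, on cones, whereas all constants that
  restrict T are global.\<close>

definition clip :: "real \<Rightarrow> real \<Rightarrow> real" where
  "clip T t = max 0 (min T t)"

text \<open>Cutting off the upper limit makes the primitive a Lipschitz function of every real t.
  The fixed point can then be sought among functions of all real times, without side conditions on
  t.\<close>

definition prim :: "real \<Rightarrow> (real \<Rightarrow> real) \<Rightarrow> real \<Rightarrow> real" where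
  "prim T f t = integral {0..clip T t} f"

lemma clip_in: "0 \<le> T \<Longrightarrow> clip T t \<in> {0..T}"
  by (auto simp: clip_def)

lemma clip_id: "t \<in> {0..T} \<Longrightarrow> clip T t = t"
  by (auto simp: clip_def)

lemma clip_lip: "\<bar>clip T t - clip T s\<bar> \<le> \<bar>t - s\<bar>"
  by (auto simp: clip_def max_def min_def)

lemma prim_0 [simp]: "0 \<le> T \<Longrightarrow> prim T f 0 = 0"
  by (simp add: prim_def clip_def)

lemma prim_diff_eq:
  assumes "continuous_on {0..T} f" "0 \<le> s" "s \<le> t" "t \<le> T"
  shows "prim T f t - prim T f s = integral {s..t} f"
proof -
  have "f integrable_on {0..t}"
    using assms by (intro integrable_continuous_real continuous_on_subset[OF assms(1)]) auto
  from Henstock_Kurzweil_Integration.integral_combine[OF assms(2,3) this]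
  show ?thesis using assms by (simp add: prim_def clip_id)
qed

lemma prim_diff_le_between:
  assumes "continuous_on {0..T} f" "0 \<le> s" "s \<le> t" "t \<le> T" "\<And>\<tau>. \<tau> \<in> {s..t} \<Longrightarrow> \<bar>f \<tau>\<bar> \<le> B"
  shows "\<bar>prim T f t - prim T f s\<bar> \<le> B * (t - s)"
proof -
  have "norm (integral {s..t} f) \<le> B * (t - s)"
    using assms by (intro integral_bound continuous_on_subset[OF assms(1)]) auto
  with prim_diff_eq[OF assms(1-4)] show ?thesis by simp
qed

lemma prim_clip: "0 \<le> T \<Longrightarrow> prim T f (clip T t) = prim T f t"
  by (simp add: prim_def clip_id[OF clip_in])

lemma prim_diff_le:
  assumes "0 \<le> T" "continuous_on {0..T} f" "\<And>\<tau>. \<tau> \<in> {0..T} \<Longrightarrow> \<bar>f \<tau>\<bar> \<le> B"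
  shows "\<bar>prim T f t - prim T f s\<bar> \<le> B * \<bar>clip T t - clip T s\<bar>"
proof -
  have le: "\<bar>prim T f t - prim T f s\<bar> \<le> B * (t - s)" if "s \<le> t" "s \<in> {0..T}" "t \<in> {0..T}" for s t
    using that assms by (intro prim_diff_le_between) auto
  show ?thesis
  proof (cases "clip T s \<le> clip T t")
    case True
    with le[OF True clip_in clip_in] assms(1) show ?thesis by (simp add: prim_clip)
  next
    case False
    then have "clip T t \<le> clip T s" by simp
    with le[OF this clip_in clip_in] assms(1) show ?thesis by (simp add: prim_clip abs_minus_commute)
  qed
qed

lemma prim_lip:
  assumes "0 \<le> T" "continuous_on {0..T} f" "\<And>\<tau>. \<tau> \<in> {0..T} \<Longrightarrow> \<bar>f \<tau>\<bar> \<le> B"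
  shows "\<bar>prim T f t - prim T f s\<bar> \<le> B * \<bar>t - s\<bar>" "\<bar>prim T f t - prim T f s\<bar> \<le> B * T"
proof -
  have B: "0 \<le> B" using assms(3)[of 0] assms(1) by auto
  have "\<bar>clip T t - clip T s\<bar> \<le> T" using assms(1) by (auto simp: clip_def)
  then show "\<bar>prim T f t - prim T f s\<bar> \<le> B * T"
    using prim_diff_le[OF assms] B by (meson mult_left_mono order_trans)
  show "\<bar>prim T f t - prim T f s\<bar> \<le> B * \<bar>t - s\<bar>"
    using prim_diff_le[OF assms] B clip_lip by (meson mult_left_mono order_trans)
qed

lemma prim_sub:
  assumes "0 \<le> T" "continuous_on {0..T} f" "continuous_on {0..T} h"
  shows "prim T f t - prim T h t = prim T (\<lambda>\<tau>. f \<tau> - h \<tau>) t"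
proof -
  have "{0..clip T t} \<subseteq> {0..T}" using clip_in[OF assms(1), of t] by auto
  then show ?thesis unfolding prim_def using assms
    by (intro integral_diff[symmetric] integrable_continuous_real) (auto intro: continuous_on_subset)
qed

lemma prim_compare:
  assumes "0 \<le> T" "continuous_on {0..T} f" "continuous_on {0..T} h"
    and "\<And>\<tau>. \<tau> \<in> {0..T} \<Longrightarrow> \<bar>f \<tau> - h \<tau>\<bar> \<le> B"
  shows "\<bar>(prim T f t - prim T f s) - (prim T h t - prim T h s)\<bar> \<le> B * T"
proof -
  have "(prim T f t - prim T f s) - (prim T h t - prim T h s)
      = prim T (\<lambda>\<tau>. f \<tau> - h \<tau>) t - prim T (\<lambda>\<tau>. f \<tau> - h \<tau>) s"
    using prim_sub[OF assms(1-3), of t] prim_sub[OF assms(1-3), of s] by linarith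
  also have "\<bar>\<dots>\<bar> \<le> B * T"
    using assms by (intro prim_lip) (auto intro: continuous_intros)
  finally show ?thesis .
qed

lemma prim_has_vector_derivative:
  assumes "continuous_on {0..T} f" "t \<in> {0..T}"
  shows "(prim T f has_vector_derivative f t) (at t within {0..T})"
proof -
  have "((\<lambda>u. integral {0..u} f) has_vector_derivative f t) (at t within {0..T})"
    using assms by (rule integral_has_vector_derivative)
  then show ?thesis
    by (rule has_vector_derivative_transform[OF assms(2), rotated])
      (simp add: prim_def clip_id)
qed

text \<open>Banach's theorem for the sup distance on a class \<open>S\<close> of real functions,
  without a metric space. Members of \<open>S\<close> may be unbounded, as ln u and the positions of
  characteristics are; only the first step \<open>\<Phi> f0 - f0\<close> has to be bounded.
  Closedness of \<open>S\<close> is needed for pointwise limits only.\<close>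

lemma contraction_fixpoint:
  fixes \<Phi> :: "('a \<Rightarrow> real) \<Rightarrow> 'a \<Rightarrow> real"
  assumes S0: "S f0" and S\<Phi>: "\<And>f. S f \<Longrightarrow> S (\<Phi> f)"
    and closed: "\<And>f F. (\<And>n. S (F n)) \<Longrightarrow> (\<And>x. (\<lambda>n. F n x) \<longlonglongrightarrow> f x) \<Longrightarrow> S f"
    and B: "\<And>x. \<bar>\<Phi> f0 x - f0 x\<bar> \<le> B"
    and contr: "\<And>f g b x. S f \<Longrightarrow> S g \<Longrightarrow> (\<And>x. \<bar>f x - g x\<bar> \<le> b) \<Longrightarrow> \<bar>\<Phi> f x - \<Phi> g x\<bar> \<le> b / 2"
  shows "\<exists>f. S f \<and> \<Phi> f = f"
proof -
  define F where "F n = (\<Phi> ^^ n) f0" for n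
  have F_Suc: "F (Suc n) = \<Phi> (F n)" for n by (simp add: F_def)
  have SF: "S (F n)" for n by (induction n) (auto simp: F_def S0 S\<Phi>)
  have d: "\<bar>F (Suc n) x - F n x\<bar> \<le> B * (1/2) ^ n" for n x
  proof (induction n arbitrary: x)
    case 0 then show ?case using B by (simp add: F_def)
  next
    case (Suc n)
    from contr[OF SF[of "Suc n"] SF[of n] Suc] show ?case by (simp add: F_Suc)
  qed
  have B0: "0 \<le> B" using B[of undefined] by linarith
  \<comment> \<open>The geometric sum is kept with its last term, which is what lets the induction
    on \<open>k\<close> close.\<close>
  have dd: "\<bar>F (n + k) x - F n x\<bar> \<le> 2 * B * (1/2) ^ n - 2 * B * (1/2) ^ (n + k)" for n k x
  proof (induction k)
    case (Suc k) with d[of "n + k" x] show ?case by (simp add: abs_le_iff)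
  qed simp
  have dd': "\<bar>F m x - F n x\<bar> \<le> 2 * B * (1/2) ^ n" if "n \<le> m" for m n x
  proof -
    have "0 \<le> 2 * B * (1/2) ^ (n + (m - n))" using B0 by simp
    then show ?thesis using dd[of n "m - n" x] that by simp
  qed
  have lim0: "(\<lambda>n. 2 * B * (1/2) ^ n) \<longlonglongrightarrow> 0"
    by (intro tendsto_mult_right_zero LIMSEQ_power_zero) auto
  have "Cauchy (\<lambda>n. F n x)" for x
  proof (rule metric_CauchyI)
    fix e :: real assume "e > 0"
    with lim0 have "\<forall>\<^sub>F n in sequentially. 2 * B * (1/2) ^ n < e / 2"
      by (intro order_tendstoD) auto
    then obtain n where n: "2 * B * (1/2) ^ n < e / 2" by (auto simp: eventually_sequentially)
    show "\<exists>M. \<forall>m\<ge>M. \<forall>k\<ge>M. dist (F m x) (F k x) < e"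
    proof (intro exI allI impI)
      fix m k assume "n \<le> m" "n \<le> k"
      from dd'[OF this(1), of x] dd'[OF this(2), of x] n show "dist (F m x) (F k x) < e"
        by (simp add: dist_real_def abs_le_iff abs_less_iff)
    qed
  qed
  then have "\<exists>l. (\<lambda>n. F n x) \<longlonglongrightarrow> l" for x
    using convergent_def real_Cauchy_convergent by blast
  then obtain f where f: "\<And>x. (\<lambda>n. F n x) \<longlonglongrightarrow> f x" by metis
  have Sf: "S f" using SF f by (rule closed)
  have near: "\<bar>f x - F n x\<bar> \<le> 2 * B * (1/2) ^ n" for n x
  proof (rule LIMSEQ_le_const2)
    show "(\<lambda>m. \<bar>F m x - F n x\<bar>) \<longlonglongrightarrow> \<bar>f x - F n x\<bar>" by (intro tendsto_intros f)
    show "\<exists>N. \<forall>m\<ge>N. \<bar>F m x - F n x\<bar> \<le> 2 * B * (1/2) ^ n" using dd' by blast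
  qed
  have "\<Phi> f x = f x" for x
  proof (rule LIMSEQ_unique)
    show "(\<lambda>n. F (Suc n) x) \<longlonglongrightarrow> f x" using f by (rule LIMSEQ_Suc)
    have le: "\<bar>F (Suc n) x - \<Phi> f x\<bar> \<le> 2 * B * (1/2) ^ n" for n
    proof -
      have "\<bar>\<Phi> f x - \<Phi> (F n) x\<bar> \<le> (2 * B * (1/2) ^ n) / 2" by (rule contr[OF Sf SF near])
      moreover have "0 \<le> 2 * B * (1/2) ^ n" using B0 by simp
      ultimately show ?thesis by (simp add: F_Suc abs_minus_commute)
    qed
    have "(\<lambda>n. F (Suc n) x - \<Phi> f x) \<longlonglongrightarrow> 0"
      by (rule Lim_null_comparison[OF _ lim0]) (use le in auto)
    then show "(\<lambda>n. F (Suc n) x) \<longlonglongrightarrow> \<Phi> f x" by (simp add: LIM_zero_iff)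
  qed
  with Sf show ?thesis by blast
qed

text \<open>Iterating \<open>B \<mapsto> B / 2 + e\<close> from any finite bound converges to its
  fixed point \<open>2 * e\<close>. This takes the place of Gronwall's inequality: on a short time
  interval the integral term is at most half of the bound assumed for the unknown.\<close>

lemma absorb:
  fixes d :: "'a \<Rightarrow> real"
  assumes e: "0 \<le> e" and B0: "\<And>x. x \<in> A \<Longrightarrow> d x \<le> B0"
    and step: "\<And>B x. 0 \<le> B \<Longrightarrow> (\<And>x. x \<in> A \<Longrightarrow> d x \<le> B) \<Longrightarrow> x \<in> A \<Longrightarrow> d x \<le> B / 2 + e"
    and x: "x \<in> A"
  shows "d x \<le> 2 * e"
proof -
  have it: "d x \<le> \<bar>B0\<bar> * (1/2) ^ n + 2 * e" if "x \<in> A" for n x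
    using that
  proof (induction n arbitrary: x)
    case 0 with B0[of x] e show ?case by (simp add: abs_if split: if_splits)
  next
    case (Suc n)
    have "d x \<le> (\<bar>B0\<bar> * (1/2) ^ n + 2 * e) / 2 + e"
      by (rule step) (use Suc e in auto)
    then show ?case by (simp add: field_simps)
  qed
  have "(\<lambda>n. \<bar>B0\<bar> * (1/2) ^ n + 2 * e) \<longlonglongrightarrow> \<bar>B0\<bar> * 0 + 2 * e"
    by (intro tendsto_intros LIMSEQ_power_zero) auto
  then have "(\<lambda>n. \<bar>B0\<bar> * (1/2) ^ n + 2 * e) \<longlonglongrightarrow> 2 * e" by simp
  then show ?thesis by (rule LIMSEQ_le_const) (use it[OF x] in blast)
qed

lemma continuous_on_if_lipschitz:
  fixes f :: "real \<Rightarrow> real"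
  assumes "\<And>x y. \<bar>f x - f y\<bar> \<le> C * \<bar>x - y\<bar>"
  shows "continuous_on A f"
proof (rule lipschitz_on_continuous_on)
  show "(max C 0)-lipschitz_on A f"
  proof (rule lipschitz_onI)
    fix x y
    have "\<bar>f x - f y\<bar> \<le> max C 0 * \<bar>x - y\<bar>"
      using assms[of x y] by (meson max.cobounded1 mult_right_mono abs_ge_zero order_trans)
    then show "dist (f x) (f y) \<le> max C 0 * dist x y" by (simp add: dist_real_def)
  qed simp
qed


section \<open>Diagonal systems: the fixed point\<close>

text \<open>Differences of states are measured in the maximum norm over the components. The square
  in the last assumption has two sources: one factor \<open>1 + M\<close> is the slope of the
  solution, the other the slope of the data that are evaluated at a displaced foot point.\<close>

locale lipschitz_system =
  fixes lam g :: "'i::finite \<Rightarrow> ('i \<Rightarrow> real) \<Rightarrow> real" and U0 :: "'i \<Rightarrow> real \<Rightarrow> real"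
    and K M \<Lambda> G T :: real
  assumes T: "0 < T" "T \<le> 1" and K: "0 \<le> K" and M: "0 \<le> M"
    and lam_le: "\<And>i W. \<bar>lam i W\<bar> \<le> \<Lambda>" and g_le: "\<And>i W. \<bar>g i W\<bar> \<le> G"
    and lam_lip: "\<And>i W V d. (\<And>j. \<bar>W j - V j\<bar> \<le> d) \<Longrightarrow> \<bar>lam i W - lam i V\<bar> \<le> K * d"
    and g_lip: "\<And>i W V d. (\<And>j. \<bar>W j - V j\<bar> \<le> d) \<Longrightarrow> \<bar>g i W - g i V\<bar> \<le> K * d"
    and U0_lip: "\<And>i x y. \<bar>U0 i x - U0 i y\<bar> \<le> M * \<bar>x - y\<bar>"
    and small: "T * K * (1 + M)\<^sup>2 \<le> 1 / 64"
begin

text \<open>Both constants are read off from \<open>next_compare\<close>: the transported data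
  contribute at most twice \<open>M\<close>, the source at most 1 in space, and the time slope gets
  the same contributions multiplied by the speed \<open>\<Lambda>\<close>, plus the size
  \<open>G\<close> of the source.\<close>

definition L :: real where "L = 2 * M + 1"
definition L' :: real where "L' = 2 * \<Lambda> * M + G + \<Lambda>"

lemma nonneg: "0 \<le> \<Lambda>" "0 \<le> G" "0 \<le> L" "0 \<le> L'"
proof -
  show "0 \<le> \<Lambda>" using lam_le[of undefined undefined] by linarith
  moreover show "0 \<le> G" using g_le[of undefined undefined] by linarith
  ultimately show "0 \<le> L" "0 \<le> L'" using M by (auto simp: L_def L'_def)
qed

lemma smalls:
  "T * K \<le> 1 / 64" "T * K * M \<le> 1 / 64" "T * K * L \<le> 1 / 32" "T * K * L * M \<le> 1 / 32"
  "T * K * (1 + L) * (1 + M) \<le> 1 / 32"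
proof -
  have TK: "0 \<le> T * K" using T K by simp
  have *: "T * K * q \<le> 1 / 64" if "q \<le> (1 + M)\<^sup>2" for q
    using mult_left_mono[OF that TK] small by linarith
  have **: "T * K * q \<le> 1 / 32" if "q \<le> 2 * (1 + M)\<^sup>2" for q
    using mult_left_mono[OF that TK] small by linarith
  have M2: "0 \<le> M\<^sup>2" by simp
  show "T * K \<le> 1 / 64" using *[of 1] M by (simp add: power2_eq_square algebra_simps)
  show "T * K * M \<le> 1 / 64" using *[of M] M M2 by (simp add: power2_eq_square algebra_simps)
  show "T * K * L \<le> 1 / 32" using **[of L] M M2 by (simp add: L_def power2_eq_square algebra_simps)
  show "T * K * L * M \<le> 1 / 32"
    using **[of "L * M"] M M2 by (simp add: L_def power2_eq_square algebra_simps)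
  show "T * K * (1 + L) * (1 + M) \<le> 1 / 32"
    using **[of "(1 + L) * (1 + M)"] M M2 by (simp add: L_def power2_eq_square algebra_simps)
qed

text \<open>The class asks only for Lipschitz bounds, which survive pointwise limits. The slope 2 of
  \<open>X\<close> in \<open>x\<close> leaves room above the slope 1 of the identity, from which the
  flow differs little on a short time interval.\<close>

definition admissible_pair ::
  "('i \<Rightarrow> real \<Rightarrow> real \<Rightarrow> real) \<Rightarrow> ('i \<Rightarrow> real \<Rightarrow> real \<Rightarrow> real \<Rightarrow> real) \<Rightarrow> bool" where
  "admissible_pair U X \<longleftrightarrow>
     (\<forall>i t t' x x'. \<bar>U i t x - U i t' x'\<bar> \<le> L * \<bar>x - x'\<bar> + L' * \<bar>t - t'\<bar>) \<and>
     (\<forall>i s s' t t' x x'. \<bar>X i s t x - X i s' t' x'\<bar>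
        \<le> 2 * \<bar>x - x'\<bar> + 2 * \<Lambda> * \<bar>t - t'\<bar> + \<Lambda> * \<bar>s - s'\<bar>)"

text \<open>\<open>U i t x\<close> is the solution and \<open>X i s t x\<close> the position at time \<open>s\<close> of the \<open>i\<close>-th characteristic
  through \<open>(t, x)\<close>; both are found together as a fixed point.\<close>

definition next_X where
  "next_X U X i s t x = x - (prim T (\<lambda>\<tau>. lam i (\<lambda>j. U j \<tau> (X i \<tau> t x))) t
     - prim T (\<lambda>\<tau>. lam i (\<lambda>j. U j \<tau> (X i \<tau> t x))) s)" for U :: "'i \<Rightarrow> real \<Rightarrow> real \<Rightarrow> real"

text \<open>The data are evaluated at the updated foot point. With the old \<open>X i 0 t x\<close>
  the map would not contract, because \<open>M\<close> times the distance of the two flows would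
  enter without a factor \<open>T\<close>.\<close>

definition next_U where
  "next_U U X i t x = U0 i (next_X U X i 0 t x)
     + prim T (\<lambda>\<tau>. g i (\<lambda>j. U j \<tau> (X i \<tau> t x))) t" for U :: "'i \<Rightarrow> real \<Rightarrow> real \<Rightarrow> real"

lemma admissible_U: "admissible_pair U X \<Longrightarrow>
    \<bar>U i t x - U i t' x'\<bar> \<le> L * \<bar>x - x'\<bar> + L' * \<bar>t - t'\<bar>"
  by (simp add: admissible_pair_def)

lemma admissible_X: "admissible_pair U X \<Longrightarrow>
    \<bar>X i s t x - X i s' t' x'\<bar> \<le> 2 * \<bar>x - x'\<bar> + 2 * \<Lambda> * \<bar>t - t'\<bar> + \<Lambda> * \<bar>s - s'\<bar>"
  unfolding admissible_pair_def by blast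

lemma coefficient_continuous:
  assumes adm: "admissible_pair U X"
  shows "continuous_on A (\<lambda>\<tau>. lam i (\<lambda>j. U j \<tau> (X k \<tau> t x)))"
    and "continuous_on A (\<lambda>\<tau>. g i (\<lambda>j. U j \<tau> (X k \<tau> t x)))"
proof -
  have *: "\<bar>U j \<tau> (X k \<tau> t x) - U j \<tau>' (X k \<tau>' t x)\<bar> \<le> (L * \<Lambda> + L') * \<bar>\<tau> - \<tau>'\<bar>" for j \<tau> \<tau>'
  proof -
    have "L * \<bar>X k \<tau> t x - X k \<tau>' t x\<bar> \<le> L * (\<Lambda> * \<bar>\<tau> - \<tau>'\<bar>)"
      using admissible_X[OF adm, of k \<tau> t x \<tau>' t x] nonneg by (intro mult_left_mono) auto
    with admissible_U[OF adm, of j \<tau> "X k \<tau> t x" \<tau>' "X k \<tau>' t x"] show ?thesis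
      by (simp add: algebra_simps)
  qed
  show "continuous_on A (\<lambda>\<tau>. lam i (\<lambda>j. U j \<tau> (X k \<tau> t x)))"
    by (rule continuous_on_if_lipschitz[where C = "K * (L * \<Lambda> + L')"])
      (use lam_lip[OF *] in \<open>simp add: mult.assoc\<close>)
  show "continuous_on A (\<lambda>\<tau>. g i (\<lambda>j. U j \<tau> (X k \<tau> t x)))"
    by (rule continuous_on_if_lipschitz[where C = "K * (L * \<Lambda> + L')"])
      (use g_lip[OF *] in \<open>simp add: mult.assoc\<close>)
qed

text \<open>One estimate serves two purposes. With equal pairs and different points it gives the
  invariance of the class; with different pairs at the same point it gives the contraction.\<close>

lemma next_compare:
  assumes adm: "admissible_pair U X" "admissible_pair V Z"
    and b: "\<And>\<tau> j. \<tau> \<in> {0..T} \<Longrightarrow> \<bar>U j \<tau> (X i \<tau> t x) - V j \<tau> (Z i \<tau> t' x')\<bar> \<le> b"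
  shows "\<bar>next_X U X i s t x - next_X V Z i s' t' x'\<bar>
      \<le> \<bar>x - x'\<bar> + \<Lambda> * \<bar>t - t'\<bar> + \<Lambda> * \<bar>s - s'\<bar> + T * K * b"
    and "\<bar>next_U U X i t x - next_U V Z i t' x'\<bar>
      \<le> M * (\<bar>x - x'\<bar> + \<Lambda> * \<bar>t - t'\<bar> + T * K * b) + G * \<bar>t - t'\<bar> + T * K * b"
proof -
  have X: "\<bar>next_X U X i s t x - next_X V Z i s' t' x'\<bar>
      \<le> \<bar>x - x'\<bar> + \<Lambda> * \<bar>t - t'\<bar> + \<Lambda> * \<bar>s - s'\<bar> + T * K * b" for s s'
  proof -
    let ?p = "prim T (\<lambda>\<tau>. lam i (\<lambda>j. U j \<tau> (X i \<tau> t x)))"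
    let ?q = "prim T (\<lambda>\<tau>. lam i (\<lambda>j. V j \<tau> (Z i \<tau> t' x')))"
    have "\<bar>(?p t - ?p s) - (?q t - ?q s)\<bar> \<le> K * b * T"
      using T b lam_lip coefficient_continuous(1)[OF adm(1)] coefficient_continuous(1)[OF adm(2)]
      by (intro prim_compare) auto
    moreover have "\<bar>?q t - ?q t'\<bar> \<le> \<Lambda> * \<bar>t - t'\<bar>" "\<bar>?q s - ?q s'\<bar> \<le> \<Lambda> * \<bar>s - s'\<bar>"
      using T lam_le coefficient_continuous(1)[OF adm(2)] by (auto intro!: prim_lip(1))
    ultimately show ?thesis by (simp add: next_X_def algebra_simps abs_le_iff abs_if split: if_splits)
  qed
  then show "\<bar>next_X U X i s t x - next_X V Z i s' t' x'\<bar>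
      \<le> \<bar>x - x'\<bar> + \<Lambda> * \<bar>t - t'\<bar> + \<Lambda> * \<bar>s - s'\<bar> + T * K * b" .
  let ?p = "prim T (\<lambda>\<tau>. g i (\<lambda>j. U j \<tau> (X i \<tau> t x)))"
  let ?q = "prim T (\<lambda>\<tau>. g i (\<lambda>j. V j \<tau> (Z i \<tau> t' x')))"
  have "\<bar>(?p t - ?p 0) - (?q t - ?q 0)\<bar> \<le> K * b * T"
    using T b g_lip coefficient_continuous(2)[OF adm(1)] coefficient_continuous(2)[OF adm(2)]
    by (intro prim_compare) auto
  then have 1: "\<bar>?p t - ?q t\<bar> \<le> T * K * b" using T by (simp add: ac_simps)
  have 2: "\<bar>?q t - ?q t'\<bar> \<le> G * \<bar>t - t'\<bar>"
    using T g_le coefficient_continuous(2)[OF adm(2)] by (auto intro!: prim_lip(1))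
  have "M * \<bar>next_X U X i 0 t x - next_X V Z i 0 t' x'\<bar>
      \<le> M * (\<bar>x - x'\<bar> + \<Lambda> * \<bar>t - t'\<bar> + T * K * b)"
    using X[of 0 0] M by (intro mult_left_mono) auto
  with U0_lip[of i "next_X U X i 0 t x" "next_X V Z i 0 t' x'"]
  have 3: "\<bar>U0 i (next_X U X i 0 t x) - U0 i (next_X V Z i 0 t' x')\<bar>
      \<le> M * (\<bar>x - x'\<bar> + \<Lambda> * \<bar>t - t'\<bar> + T * K * b)" by linarith
  from 1 2 3 show "\<bar>next_U U X i t x - next_U V Z i t' x'\<bar>
      \<le> M * (\<bar>x - x'\<bar> + \<Lambda> * \<bar>t - t'\<bar> + T * K * b) + G * \<bar>t - t'\<bar> + T * K * b"
    unfolding next_U_def by linarith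
qed

lemma admissible_next:
  assumes adm: "admissible_pair U X"
  shows "admissible_pair (next_U U X) (next_X U X)"
proof -
  have b: "\<bar>U j \<tau> (X i \<tau> t x) - U j \<tau> (X i \<tau> t' x')\<bar> \<le> L * (2 * \<bar>x - x'\<bar> + 2 * \<Lambda> * \<bar>t - t'\<bar>)"
    for i j \<tau> t t' x x'
  proof -
    have "L * \<bar>X i \<tau> t x - X i \<tau> t' x'\<bar> \<le> L * (2 * \<bar>x - x'\<bar> + 2 * \<Lambda> * \<bar>t - t'\<bar>)"
      using admissible_X[OF adm, of i \<tau> t x \<tau> t' x'] nonneg by (intro mult_left_mono) auto
    with admissible_U[OF adm, of j \<tau> "X i \<tau> t x" \<tau> "X i \<tau> t' x'"] show ?thesis by simp
  qed
  have bT: "T * K * (L * (2 * \<bar>x - x'\<bar> + 2 * \<Lambda> * \<bar>t - t'\<bar>)) \<le> (\<bar>x - x'\<bar> + \<Lambda> * \<bar>t - t'\<bar>) / 16"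
    for t t' x x' :: real
  proof -
    have "(T * K * L) * (2 * \<bar>x - x'\<bar> + 2 * \<Lambda> * \<bar>t - t'\<bar>)
        \<le> 1 / 32 * (2 * \<bar>x - x'\<bar> + 2 * \<Lambda> * \<bar>t - t'\<bar>)"
      using smalls(3) nonneg by (intro mult_right_mono) auto
    then show ?thesis by (simp add: algebra_simps)
  qed
  have "\<bar>next_U U X i t x - next_U U X i t' x'\<bar> \<le> L * \<bar>x - x'\<bar> + L' * \<bar>t - t'\<bar>" for i t t' x x'
  proof -
    note next_compare(2)[OF adm adm b, where i = i and t = t and x = x and t' = t' and x' = x']
    moreover have "M * (\<bar>x - x'\<bar> + \<Lambda> * \<bar>t - t'\<bar> + T * K * (L * (2 * \<bar>x - x'\<bar> + 2 * \<Lambda> * \<bar>t - t'\<bar>)))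
        \<le> M * (2 * (\<bar>x - x'\<bar> + \<Lambda> * \<bar>t - t'\<bar>))"
    proof (rule mult_left_mono[OF _ M])
      have aux: "p + q + z \<le> 2 * (p + q)" if "z \<le> (p + q) / 16" "0 \<le> p" "0 \<le> q" for p q z :: real
        using that by simp
      have "0 \<le> \<Lambda> * \<bar>t - t'\<bar>" using nonneg by simp
      from aux[OF bT abs_ge_zero this] show "\<bar>x - x'\<bar> + \<Lambda> * \<bar>t - t'\<bar>
          + T * K * (L * (2 * \<bar>x - x'\<bar> + 2 * \<Lambda> * \<bar>t - t'\<bar>)) \<le> 2 * (\<bar>x - x'\<bar> + \<Lambda> * \<bar>t - t'\<bar>)" .
    qed
    moreover have "0 \<le> \<Lambda> * \<bar>t - t'\<bar>" using nonneg by simp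
    moreover have "n \<le> (2 * M + 1) * p + (2 * \<Lambda> * M + G + \<Lambda>) * q"
      if "n \<le> M * (p + \<Lambda> * q + z) + G * q + z" "M * (p + \<Lambda> * q + z) \<le> M * (2 * (p + \<Lambda> * q))"
        "0 \<le> \<Lambda> * q" "z \<le> (p + \<Lambda> * q) / 16" "0 \<le> p" for n p q z
    proof -
      have "n \<le> M * (2 * (p + \<Lambda> * q)) + G * q + (p + \<Lambda> * q)" using that by simp
      then show ?thesis by (simp add: algebra_simps)
    qed
    ultimately show ?thesis using bT[of x x' t t'] abs_ge_zero unfolding L_def L'_def by blast
  qed
  moreover have "\<bar>next_X U X i s t x - next_X U X i s' t' x'\<bar>
      \<le> 2 * \<bar>x - x'\<bar> + 2 * \<Lambda> * \<bar>t - t'\<bar> + \<Lambda> * \<bar>s - s'\<bar>" for i s s' t t' x x'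
  proof -
    note next_compare(1)[OF adm adm b, where i = i and t = t and x = x and t' = t' and x' = x'
      and s = s and s' = s']
    moreover have "0 \<le> \<Lambda> * \<bar>t - t'\<bar>" using nonneg by simp
    moreover have "n \<le> 2 * p + 2 * \<Lambda> * q + r"
      if "n \<le> p + \<Lambda> * q + r + z" "0 \<le> \<Lambda> * q" "z \<le> (p + \<Lambda> * q) / 16" "0 \<le> p" for n p q r z
      using that by simp
    ultimately show ?thesis using bT[of x x' t t'] abs_ge_zero by blast
  qed
  ultimately show ?thesis unfolding admissible_pair_def by blast
qed

lemma next_contraction:
  assumes adm: "admissible_pair U X" "admissible_pair V Z"
    and b: "\<And>i t x. \<bar>U i t x - V i t x\<bar> \<le> b" "\<And>i s t x. \<bar>X i s t x - Z i s t x\<bar> \<le> b"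
  shows "\<bar>next_U U X i t x - next_U V Z i t x\<bar> \<le> b / 2"
    "\<bar>next_X U X i s t x - next_X V Z i s t x\<bar> \<le> b / 2"
proof -
  have b0: "0 \<le> b" using b(1)[of i t x] by linarith
  have c: "\<bar>U j \<tau> (X i \<tau> t x) - V j \<tau> (Z i \<tau> t x)\<bar> \<le> (1 + L) * b" for j \<tau>
  proof -
    have "L * \<bar>X i \<tau> t x - Z i \<tau> t x\<bar> \<le> L * b"
      using b nonneg by (intro mult_left_mono) auto
    with admissible_U[OF adm(1), of j \<tau> "X i \<tau> t x" \<tau> "Z i \<tau> t x"] b(1)[of j \<tau> "Z i \<tau> t x"]
    show ?thesis by (simp add: algebra_simps)
  qed
  have 1: "T * K * (1 + L) * (1 + M) * b \<le> 1 / 32 * b"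
    using smalls(5) b0 by (intro mult_right_mono)
  have 2: "0 \<le> M * (T * K * (1 + L) * b)" "0 \<le> T * K * (1 + L) * b"
    using M T K nonneg b0 by auto
  from next_compare(2)[OF adm c] have "\<bar>next_U U X i t x - next_U V Z i t x\<bar>
      \<le> T * K * (1 + L) * (1 + M) * b" by (simp add: algebra_simps)
  with 1 b0 show "\<bar>next_U U X i t x - next_U V Z i t x\<bar> \<le> b / 2" by linarith
  from next_compare(1)[OF adm c, of s s] have "\<bar>next_X U X i s t x - next_X V Z i s t x\<bar>
      \<le> T * K * (1 + L) * b" by (simp add: algebra_simps)
  also have "\<dots> \<le> T * K * (1 + L) * (1 + M) * b" using 2 by (simp add: algebra_simps)
  finally show "\<bar>next_X U X i s t x - next_X V Z i s t x\<bar> \<le> b / 2" using 1 b0 by linarith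
qed

lemma ex_fixpoint:
  "\<exists>U X. admissible_pair U X \<and> next_U U X = U \<and> next_X U X = X"
proof -
  \<comment> \<open>The pair is packed into one function so that \<open>contraction_fixpoint\<close>
    applies: the tag \<open>None\<close> marks the value of \<open>U\<close>, and
    \<open>Some s\<close> the position of the characteristic at time \<open>s\<close>.\<close>
  define dU :: "('i \<times> real option \<times> real \<times> real \<Rightarrow> real) \<Rightarrow> 'i \<Rightarrow> real \<Rightarrow> real \<Rightarrow> real"
    where "dU f i t x = f (i, None, t, x)" for f i t x
  define dX :: "('i \<times> real option \<times> real \<times> real \<Rightarrow> real) \<Rightarrow> 'i \<Rightarrow> real \<Rightarrow> real \<Rightarrow> real \<Rightarrow> real"
    where "dX f i s t x = f (i, Some s, t, x)" for f i s t x
  define \<Phi> where "\<Phi> f = (\<lambda>(i, so, t, x). case so of None \<Rightarrow> next_U (dU f) (dX f) i t x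
    | Some s \<Rightarrow> next_X (dU f) (dX f) i s t x)" for f
  define f0 :: "'i \<times> real option \<times> real \<times> real \<Rightarrow> real"
    where "f0 = (\<lambda>(i, so, t, x). case so of None \<Rightarrow> U0 i x | Some s \<Rightarrow> x)"
  define S where "S f = admissible_pair (dU f) (dX f)" for f
  have d\<Phi>: "dU (\<Phi> f) = next_U (dU f) (dX f)" "dX (\<Phi> f) = next_X (dU f) (dX f)" for f
    by (auto simp: fun_eq_iff dU_def dX_def \<Phi>_def)
  have f0: "dU f0 = (\<lambda>i t. U0 i)" "dX f0 = (\<lambda>i s t x. x)"
    by (auto simp: fun_eq_iff dU_def dX_def f0_def)
  have S0: "S f0"
  proof -
    have "M * \<bar>x - x'\<bar> \<le> L * \<bar>x - x'\<bar>" for x x' :: real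
      using M by (intro mult_right_mono) (auto simp: L_def)
    then have "\<bar>U0 i x - U0 i x'\<bar> \<le> L * \<bar>x - x'\<bar> + L' * \<bar>t - t'\<bar>" for i x x' and t t' :: real
      using U0_lip[of i x x'] nonneg mult_nonneg_nonneg[of L' "\<bar>t - t'\<bar>"]
      by (smt (verit) abs_ge_zero)
    moreover have "\<bar>x - x'\<bar> \<le> 2 * \<bar>x - x'\<bar> + 2 * \<Lambda> * \<bar>t - t'\<bar> + \<Lambda> * \<bar>s - s'\<bar>" for x x' t t' s s' :: real
    proof -
      have "0 \<le> 2 * \<Lambda> * \<bar>t - t'\<bar>" "0 \<le> \<Lambda> * \<bar>s - s'\<bar>" "0 \<le> \<bar>x - x'\<bar>"
        using nonneg by auto
      moreover have "p \<le> 2 * p + q + r" if "0 \<le> q" "0 \<le> r" "0 \<le> p" for p q r :: real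
        using that by simp
      ultimately show ?thesis by blast
    qed
    ultimately show ?thesis unfolding S_def f0 admissible_pair_def by blast
  qed
  \<comment> \<open>The iteration starts from data constant in time and characteristics at rest. The
    first step moves positions by at most \<open>\<Lambda> * T\<close> and values by at most
    \<open>M * (\<Lambda> * T) + G * T\<close>, even if the data are unbounded.\<close>
  have "\<exists>f. S f \<and> \<Phi> f = f"
  proof (rule contraction_fixpoint[of S f0 \<Phi> "\<Lambda> * T + M * (\<Lambda> * T) + G * T"])
    show "S f0" by (rule S0)
    show "S (\<Phi> f)" if "S f" for f
      using admissible_next that by (simp add: S_def d\<Phi>)
  next
    fix f F assume SF: "\<And>n. S (F n)" and lim: "\<And>x. (\<lambda>n. F n x) \<longlonglongrightarrow> f x"
    show "S f" unfolding S_def admissible_pair_def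
    proof (intro conjI allI)
      fix i t t' x x'
      show "\<bar>dU f i t x - dU f i t' x'\<bar> \<le> L * \<bar>x - x'\<bar> + L' * \<bar>t - t'\<bar>"
      proof (rule LIMSEQ_le_const2)
        show "(\<lambda>n. \<bar>dU (F n) i t x - dU (F n) i t' x'\<bar>) \<longlonglongrightarrow> \<bar>dU f i t x - dU f i t' x'\<bar>"
          unfolding dU_def by (intro tendsto_intros lim)
      qed (use admissible_U[OF SF[unfolded S_def]] in blast)
    next
      fix i s s' t t' x x'
      show "\<bar>dX f i s t x - dX f i s' t' x'\<bar> \<le> 2 * \<bar>x - x'\<bar> + 2 * \<Lambda> * \<bar>t - t'\<bar> + \<Lambda> * \<bar>s - s'\<bar>"
      proof (rule LIMSEQ_le_const2)
        show "(\<lambda>n. \<bar>dX (F n) i s t x - dX (F n) i s' t' x'\<bar>) \<longlonglongrightarrow> \<bar>dX f i s t x - dX f i s' t' x'\<bar>"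
          unfolding dX_def by (intro tendsto_intros lim)
      qed (use admissible_X[OF SF[unfolded S_def]] in blast)
    qed
  next
    fix p :: "'i \<times> real option \<times> real \<times> real"
    obtain i so t x where p: "p = (i, so, t, x)" by (cases p)
    have adm: "admissible_pair (\<lambda>i t. U0 i) (\<lambda>i s t x. x)" using S0 by (simp add: S_def f0)
    have X: "\<bar>next_X (\<lambda>i t. U0 i) (\<lambda>i s t x. x) i s t x - x\<bar> \<le> \<Lambda> * T" for s
      unfolding next_X_def using prim_lip(2)[OF _ coefficient_continuous(1)[OF adm] lam_le] T by simp
    have "\<bar>prim T (\<lambda>\<tau>. g i (\<lambda>j. U0 j x)) t - prim T (\<lambda>\<tau>. g i (\<lambda>j. U0 j x)) 0\<bar> \<le> G * T"
      using T g_le by (intro prim_lip(2)) auto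
    then have g: "\<bar>prim T (\<lambda>\<tau>. g i (\<lambda>j. U0 j x)) t\<bar> \<le> G * T" using T by simp
    have "M * \<bar>next_X (\<lambda>i t. U0 i) (\<lambda>i s t x. x) i 0 t x - x\<bar> \<le> M * (\<Lambda> * T)"
      using X[of 0] M by (intro mult_left_mono)
    with U0_lip[of i "next_X (\<lambda>i t. U0 i) (\<lambda>i s t x. x) i 0 t x" x] g
    have "\<bar>next_U (\<lambda>i t. U0 i) (\<lambda>i s t x. x) i t x - U0 i x\<bar> \<le> M * (\<Lambda> * T) + G * T"
      unfolding next_U_def by linarith
    moreover have "0 \<le> \<Lambda> * T" "0 \<le> M * (\<Lambda> * T)" "0 \<le> G * T" using nonneg T M by auto
    ultimately show "\<bar>\<Phi> f0 p - f0 p\<bar> \<le> \<Lambda> * T + M * (\<Lambda> * T) + G * T"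
      using X unfolding p \<Phi>_def f0 by (cases so) (auto simp: f0_def intro: add_increasing2)
  next
    fix f h b and p :: "'i \<times> real option \<times> real \<times> real"
    assume "S f" "S h" and b: "\<And>x. \<bar>f x - h x\<bar> \<le> b"
    obtain i so t x where p: "p = (i, so, t, x)" by (cases p)
    have "\<bar>dU f i t x - dU h i t x\<bar> \<le> b" "\<bar>dX f i s t x - dX h i s t x\<bar> \<le> b" for i s t x
      by (auto simp: dU_def dX_def b)
    from next_contraction[OF \<open>S f\<close>[unfolded S_def] \<open>S h\<close>[unfolded S_def] this]
    show "\<bar>\<Phi> f p - \<Phi> h p\<bar> \<le> b / 2" by (auto simp: p \<Phi>_def split: option.split)
  qed
  then obtain f where "S f" "\<Phi> f = f" by blast
  then show ?thesis using d\<Phi>[of f] by (metis S_def)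
qed

end


lemma prim_quotient:
  assumes "0 \<le> T" "continuous_on {0..T} f" "continuous_on {0..T} h"
  shows "prim T (\<lambda>\<tau>. (f \<tau> - h \<tau>) / c) t = (prim T f t - prim T h t) / c"
proof -
  have "prim T (\<lambda>\<tau>. (f \<tau> - h \<tau>) / c) t = prim T (\<lambda>\<tau>. f \<tau> - h \<tau>) t / c" by (simp add: prim_def)
  then show ?thesis by (simp add: prim_sub[OF assms])
qed

section \<open>Diagonal systems: differentiability\<close>

text \<open>Differentiability is stated as a uniform Cauchy property of difference quotients, the
  form in which \<open>Dq_halving\<close> consumes it; no derivative has to be named. Uniformity is
  demanded only for bounded \<open>x\<close> and for states within
  \<open>T * (M * \<Lambda> + G)\<close> of the data, a distance the solution does not exceed by
  \<open>U_dist\<close>.\<close>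

locale smooth_system = lipschitz_system +
  assumes U0_C1: "\<And>N e. 0 < e \<Longrightarrow> \<exists>\<delta>>0. \<forall>i x h k. \<bar>x\<bar> \<le> N \<longrightarrow> 0 < \<bar>h\<bar> \<longrightarrow> \<bar>h\<bar> \<le> \<delta> \<longrightarrow> 0 < \<bar>k\<bar> \<longrightarrow> \<bar>k\<bar> \<le> \<delta> \<longrightarrow>
      \<bar>(U0 i (x + h) - U0 i x) / h - (U0 i (x + k) - U0 i x) / k\<bar> \<le> e"
    and lam_C1: "\<And>N Q e. 0 < e \<Longrightarrow> \<exists>\<delta>>0. \<forall>i x W E h k. \<bar>x\<bar> \<le> N \<longrightarrow>
      (\<forall>j. \<bar>W j - U0 j x\<bar> \<le> T * (M * \<Lambda> + G)) \<longrightarrow> (\<forall>j. \<bar>E j\<bar> \<le> Q) \<longrightarrow>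
      0 < \<bar>h\<bar> \<longrightarrow> \<bar>h\<bar> \<le> \<delta> \<longrightarrow> 0 < \<bar>k\<bar> \<longrightarrow> \<bar>k\<bar> \<le> \<delta> \<longrightarrow>
      \<bar>(lam i (\<lambda>j. W j + h * E j) - lam i W) / h - (lam i (\<lambda>j. W j + k * E j) - lam i W) / k\<bar> \<le> e"
    and g_C1: "\<And>N Q e. 0 < e \<Longrightarrow> \<exists>\<delta>>0. \<forall>i x W E h k. \<bar>x\<bar> \<le> N \<longrightarrow>
      (\<forall>j. \<bar>W j - U0 j x\<bar> \<le> T * (M * \<Lambda> + G)) \<longrightarrow> (\<forall>j. \<bar>E j\<bar> \<le> Q) \<longrightarrow>
      0 < \<bar>h\<bar> \<longrightarrow> \<bar>h\<bar> \<le> \<delta> \<longrightarrow> 0 < \<bar>k\<bar> \<longrightarrow> \<bar>k\<bar> \<le> \<delta> \<longrightarrow>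
      \<bar>(g i (\<lambda>j. W j + h * E j) - g i W) / h - (g i (\<lambda>j. W j + k * E j) - g i W) / k\<bar> \<le> e"

locale characteristic_flow = smooth_system lam g U0 K M \<Lambda> G T
  for lam g :: "'i::finite \<Rightarrow> ('i \<Rightarrow> real) \<Rightarrow> real" and U0 K M \<Lambda> G T +
  fixes U :: "'i \<Rightarrow> real \<Rightarrow> real \<Rightarrow> real" and X :: "'i \<Rightarrow> real \<Rightarrow> real \<Rightarrow> real \<Rightarrow> real"
  assumes adm: "admissible_pair U X" and U_fix: "next_U U X = U" and X_fix: "next_X U X = X"
begin

abbreviation lam_along :: "'i \<Rightarrow> real \<Rightarrow> real \<Rightarrow> real \<Rightarrow> real" where
  "lam_along i t x \<equiv> (\<lambda>\<tau>. lam i (\<lambda>j. U j \<tau> (X i \<tau> t x)))"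

abbreviation g_along :: "'i \<Rightarrow> real \<Rightarrow> real \<Rightarrow> real \<Rightarrow> real" where
  "g_along i t x \<equiv> (\<lambda>\<tau>. g i (\<lambda>j. U j \<tau> (X i \<tau> t x)))"

lemmas along_continuous = coefficient_continuous[OF adm]

lemma X_eq: "X i s t x = x - (prim T (lam_along i t x) t - prim T (lam_along i t x) s)"
proof -
  have "next_X U X i s t x = X i s t x" by (simp only: X_fix)
  then show ?thesis unfolding next_X_def by (rule sym)
qed

lemma U_eq: "U i t x = U0 i (X i 0 t x) + prim T (g_along i t x) t"
proof -
  have "next_U U X i t x = U i t x" by (simp only: U_fix)
  then show ?thesis unfolding next_U_def X_fix by (rule sym)
qed

lemma X_self: "X i t t x = x"
  using X_eq[of i t t x] by simp

lemma X_dist: "\<bar>X i s t x - x\<bar> \<le> \<Lambda> * \<bar>t - s\<bar>" "\<bar>X i s t x - x\<bar> \<le> \<Lambda> * T"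
proof -
  let ?p = "prim T (lam_along i t x)"
  have "\<bar>?p t - ?p s\<bar> \<le> \<Lambda> * \<bar>t - s\<bar>" "\<bar>?p t - ?p s\<bar> \<le> \<Lambda> * T"
    using T by (intro prim_lip along_continuous lam_le; simp)+
  moreover have "\<bar>X i s t x - x\<bar> = \<bar>?p t - ?p s\<bar>" using X_eq[of i s t x] by linarith
  ultimately show "\<bar>X i s t x - x\<bar> \<le> \<Lambda> * \<bar>t - s\<bar>" "\<bar>X i s t x - x\<bar> \<le> \<Lambda> * T" by auto
qed

lemma U_dist: "\<bar>U i t x - U0 i x\<bar> \<le> T * (M * \<Lambda> + G)"
proof -
  have "\<bar>prim T (g_along i t x) t - prim T (g_along i t x) 0\<bar> \<le> G * T"
    using prim_lip(2)[OF less_imp_le[OF T(1)] along_continuous(2) g_le, of i i t x t 0] T by auto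
  moreover have "M * \<bar>X i 0 t x - x\<bar> \<le> M * (\<Lambda> * T)"
    using X_dist(2) M by (intro mult_left_mono) auto
  ultimately show ?thesis using U0_lip[of i "X i 0 t x" x] U_eq[of i t x] T
    by (simp add: algebra_simps abs_le_iff)
qed

text \<open>Both sides are at \<open>X i r t x\<close> at time \<open>r\<close> and solve the same
  integral equation in \<open>s\<close>. Their distance is therefore at most
  \<open>T * K * L\<close> times its own supremum, and \<open>absorb\<close> with error 0 makes it
  vanish.\<close>

lemma X_flow: "X i s r (X i r t x) = X i s t x"
proof -
  let ?z = "X i r t x"
  have "\<bar>X i s r ?z - X i s t x\<bar> \<le> 2 * 0"
  proof (rule absorb[where d = "\<lambda>s. \<bar>X i s r ?z - X i s t x\<bar>" and A = UNIV and ?B0.0 = "2 * (\<Lambda> * T) + \<Lambda> * T"])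
    show "\<bar>X i s r ?z - X i s t x\<bar> \<le> 2 * (\<Lambda> * T) + \<Lambda> * T" for s
      using X_dist(2)[of i s r ?z] X_dist(2)[of i s t x] X_dist(2)[of i r t x] by linarith
  next
    fix B s assume B: "0 \<le> B" "\<And>s. s \<in> UNIV \<Longrightarrow> \<bar>X i s r ?z - X i s t x\<bar> \<le> B"
    have b: "\<bar>U j \<tau> (X i \<tau> r ?z) - U j \<tau> (X i \<tau> t x)\<bar> \<le> L * B" for j \<tau>
    proof -
      have "L * \<bar>X i \<tau> r ?z - X i \<tau> t x\<bar> \<le> L * B"
        using B nonneg by (intro mult_left_mono) auto
      with admissible_U[OF adm, of j \<tau> "X i \<tau> r ?z" \<tau> "X i \<tau> t x"] show ?thesis by simp
    qed
    let ?p = "prim T (lam_along i r ?z)" and ?q = "prim T (lam_along i t x)"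
    have "\<bar>(?p r - ?p s) - (?q r - ?q s)\<bar> \<le> K * (L * B) * T"
      using T along_continuous(1) lam_lip[OF b] by (intro prim_compare) auto
    moreover have "X i s r ?z - X i s t x = - ((?p r - ?p s) - (?q r - ?q s))"
      using X_eq[of i s r ?z] X_eq[of i s t x] X_eq[of i r t x] by linarith
    moreover have "T * K * L * B \<le> 1 / 32 * B" using smalls(3) B by (intro mult_right_mono) auto
    moreover have "K * (L * B) * T = T * K * L * B" by simp
    ultimately show "\<bar>X i s r ?z - X i s t x\<bar> \<le> B / 2 + 0" using B(1) by linarith
  qed auto
  then show ?thesis by simp
qed

lemma U_along: "U i s (X i s t x) = U0 i (X i 0 t x) + prim T (g_along i t x) s"
  using U_eq[of i s "X i s t x"] by (simp add: X_flow)

text \<open>Backward characteristics do not leave this set (\<open>cone_X\<close>), so estimates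
  that are uniform only for bounded \<open>x\<close> can be integrated along them.\<close>

definition cone :: "real \<Rightarrow> (real \<times> real) set" where
  "cone N = {(t, x). 0 \<le> t \<and> t \<le> T \<and> \<bar>x\<bar> \<le> N + \<Lambda> * (T - t)}"

lemma cone_X:
  assumes "(t, x) \<in> cone N" "0 \<le> \<tau>" "\<tau> \<le> t"
  shows "(\<tau>, X i \<tau> t x) \<in> cone N"
  using X_dist(1)[of i \<tau> t x] assms by (auto simp: cone_def algebra_simps abs_le_iff)

lemma cone_bound: "(t, x) \<in> cone N \<Longrightarrow> \<bar>x\<bar> \<le> N + \<Lambda> * T"
  using mult_nonneg_nonneg[OF nonneg(1), of t] by (auto simp: cone_def algebra_simps)

definition Dq :: "real \<Rightarrow> 'i \<Rightarrow> real \<Rightarrow> real \<Rightarrow> real" where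
  "Dq h i t x = (U i t (x + h) - U i t x) / h"

definition Zq :: "real \<Rightarrow> 'i \<Rightarrow> real \<Rightarrow> real \<Rightarrow> real \<Rightarrow> real" where
  "Zq h i s t x = (X i s t (x + h) - X i s t x) / h"

definition Eq :: "real \<Rightarrow> 'i \<Rightarrow> real \<Rightarrow> real \<Rightarrow> real \<Rightarrow> 'i \<Rightarrow> real" where
  "Eq h i \<tau> t x j = (U j \<tau> (X i \<tau> t (x + h)) - U j \<tau> (X i \<tau> t x)) / h"

lemma Dq_le: "\<bar>Dq h i t x\<bar> \<le> L"
  using admissible_U[OF adm, of i t "x + h" t x] nonneg
  by (cases "h = 0") (auto simp: Dq_def abs_divide pos_divide_le_eq)

lemma Zq_le: "\<bar>Zq h i s t x\<bar> \<le> 2"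
  using admissible_X[OF adm, of i s t "x + h" s t x]
  by (cases "h = 0") (auto simp: Zq_def abs_divide pos_divide_le_eq)

lemma X_shift: "h \<noteq> 0 \<Longrightarrow> X i s t (x + h) = X i s t x + h * Zq h i s t x"
  by (simp add: Zq_def)

text \<open>A discrete chain rule: shifting the end point by \<open>h\<close> shifts the
  characteristic at time \<open>\<tau>\<close> by \<open>h * Zq h i \<tau> t x\<close>, and the
  quotient along the curve becomes a quotient of \<open>U\<close> with this rescaled
  increment.\<close>

lemma Eq_eq:
  assumes "h \<noteq> 0" "Zq h i \<tau> t x \<noteq> 0"
  shows "Eq h i \<tau> t x j = Zq h i \<tau> t x * Dq (h * Zq h i \<tau> t x) j \<tau> (X i \<tau> t x)"
  using assms by (simp add: Eq_def Dq_def X_shift[OF assms(1), of i \<tau> t x])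

lemma Eq_le: "\<bar>Eq h i \<tau> t x j\<bar> \<le> 2 * L"
proof (cases "h = 0")
  case True then show ?thesis using nonneg by (simp add: Eq_def)
next
  case False
  have "L * \<bar>X i \<tau> t (x + h) - X i \<tau> t x\<bar> \<le> L * (2 * \<bar>h\<bar>)"
    using admissible_X[OF adm, of i \<tau> t "x + h" \<tau> t x] nonneg by (intro mult_left_mono) auto
  with admissible_U[OF adm, of j \<tau> "X i \<tau> t (x + h)" \<tau> "X i \<tau> t x"] False
  show ?thesis by (simp add: Eq_def abs_divide pos_divide_le_eq algebra_simps)
qed

text \<open>Neighbouring characteristics do not meet, since their separation changes by at most
  \<open>\<bar>h\<bar> / 16\<close> during the whole time. The discrete chain rule divides by this
  separation.\<close>

lemma Zq_nonzero:
  assumes "h \<noteq> 0"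
  shows "Zq h i s t x \<noteq> 0"
proof -
  let ?p = "prim T (lam_along i t (x + h))" and ?q = "prim T (lam_along i t x)"
  have b: "\<bar>U j \<tau> (X i \<tau> t (x + h)) - U j \<tau> (X i \<tau> t x)\<bar> \<le> L * (2 * \<bar>h\<bar>)" for j \<tau>
  proof -
    have "L * \<bar>X i \<tau> t (x + h) - X i \<tau> t x\<bar> \<le> L * (2 * \<bar>h\<bar>)"
      using admissible_X[OF adm, of i \<tau> t "x + h" \<tau> t x] nonneg by (intro mult_left_mono) auto
    with admissible_U[OF adm, of j \<tau> "X i \<tau> t (x + h)" \<tau> "X i \<tau> t x"] show ?thesis by simp
  qed
  have "\<bar>(?p t - ?p s) - (?q t - ?q s)\<bar> \<le> K * (L * (2 * \<bar>h\<bar>)) * T"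
    using T along_continuous(1) lam_lip[OF b] by (intro prim_compare) auto
  moreover have "T * K * L * (2 * \<bar>h\<bar>) \<le> 1 / 32 * (2 * \<bar>h\<bar>)"
    using smalls(3) by (intro mult_right_mono) auto
  ultimately have "\<bar>(?p t - ?p s) - (?q t - ?q s)\<bar> \<le> \<bar>h\<bar> / 16" by (simp add: algebra_simps)
  moreover have "X i s t (x + h) - X i s t x = h - ((?p t - ?p s) - (?q t - ?q s))"
    using X_eq[of i s t "x + h"] X_eq[of i s t x] by linarith
  ultimately have "X i s t (x + h) - X i s t x \<noteq> 0" using assms by auto
  then show ?thesis using assms by (simp add: Zq_def)
qed

lemma Zq_eq:
  assumes "h \<noteq> 0"
  shows "Zq h i s t x = 1 - (prim T (\<lambda>\<tau>. (lam_along i t (x + h) \<tau> - lam_along i t x \<tau>) / h) t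
    - prim T (\<lambda>\<tau>. (lam_along i t (x + h) \<tau> - lam_along i t x \<tau>) / h) s)"
  using assms T unfolding Zq_def X_eq[of i s t "x + h"] X_eq[of i s t x]
  by (subst (1 2) prim_quotient) (auto intro: along_continuous simp: field_simps)

lemma Dq_eq:
  assumes "h \<noteq> 0"
  shows "Dq h i t x = (U0 i (X i 0 t (x + h)) - U0 i (X i 0 t x)) / h
    + prim T (\<lambda>\<tau>. (g_along i t (x + h) \<tau> - g_along i t x \<tau>) / h) t"
  using assms T unfolding Dq_def U_eq[of i t "x + h"] U_eq[of i t x]
  by (subst prim_quotient) (auto intro: along_continuous simp: field_simps)

text \<open>Passing from (h, E) to (k, E') in two moves: changing the step in the fixed direction
  \<open>E\<close> costs \<open>e\<close> by uniform differentiability, and changing the direction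
  at the fixed step \<open>k\<close> costs \<open>K * b\<close> by the Lipschitz bound.\<close>

lemma quotient_compare:
  assumes f_lip: "\<And>W V d. (\<And>j. \<bar>W j - V j\<bar> \<le> d) \<Longrightarrow> \<bar>f W - f V :: real\<bar> \<le> K * d"
    and d: "\<bar>(f (\<lambda>j. W j + h * E j) - f W) / h - (f (\<lambda>j. W j + k * E j) - f W) / k\<bar> \<le> e"
    and b: "\<And>j. \<bar>E j - E' j\<bar> \<le> b" and k: "k \<noteq> 0"
  shows "\<bar>(f (\<lambda>j. W j + h * E j) - f W) / h - (f (\<lambda>j. W j + k * E' j) - f W) / k\<bar> \<le> K * b + e"
proof -
  have "\<bar>f (\<lambda>j. W j + k * E j) - f (\<lambda>j. W j + k * E' j)\<bar> \<le> K * (\<bar>k\<bar> * b)"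
  proof (rule f_lip)
    fix j
    have "\<bar>k\<bar> * \<bar>E j - E' j\<bar> \<le> \<bar>k\<bar> * b" using b by (intro mult_left_mono) auto
    then show "\<bar>W j + k * E j - (W j + k * E' j)\<bar> \<le> \<bar>k\<bar> * b"
      by (simp add: abs_mult[symmetric] right_diff_distrib)
  qed
  then have "\<bar>(f (\<lambda>j. W j + k * E j) - f (\<lambda>j. W j + k * E' j)) / k\<bar> \<le> K * b"
    using k by (simp add: abs_divide pos_divide_le_eq algebra_simps)
  moreover have "(f (\<lambda>j. W j + k * E j) - f (\<lambda>j. W j + k * E' j)) / k
      = (f (\<lambda>j. W j + k * E j) - f W) / k - (f (\<lambda>j. W j + k * E' j) - f W) / k"
    by (simp add: diff_divide_distrib)
  ultimately show ?thesis using d by linarith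
qed

end


lemma abs_mult_diff_le: "\<bar>a * p - b * q :: real\<bar> \<le> \<bar>a\<bar> * \<bar>p - q\<bar> + \<bar>a - b\<bar> * \<bar>q\<bar>"
proof -
  have "a * p - b * q = a * (p - q) + (a - b) * q" by (simp add: algebra_simps)
  also have "\<bar>\<dots>\<bar> \<le> \<bar>a\<bar> * \<bar>p - q\<bar> + \<bar>a - b\<bar> * \<bar>q\<bar>"
    unfolding abs_mult[symmetric] by (rule abs_triangle_ineq)
  finally show ?thesis .
qed

context characteristic_flow begin

text \<open>Along a characteristic the difference quotients of the solution solve integral equations
  whose coefficients are themselves difference quotients, so the oscillation of \<open>Dq h\<close> as \<open>h \<rightarrow> 0\<close>
  is at most half of itself for small \<open>T\<close>. Hence the \<open>Dq h\<close> converge, and no equation for the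
  derivative has to be solved.\<close>

lemma Dq_halving:
  assumes B: "0 \<le> B" and \<eta>: "0 < \<eta>" and e: "0 < e"
    and D: "\<And>i t x h k. (t, x) \<in> cone N \<Longrightarrow> 0 < \<bar>h\<bar> \<Longrightarrow> \<bar>h\<bar> \<le> \<eta> \<Longrightarrow> 0 < \<bar>k\<bar> \<Longrightarrow> \<bar>k\<bar> \<le> \<eta> \<Longrightarrow>
      \<bar>Dq h i t x - Dq k i t x\<bar> \<le> B"
  shows "\<exists>\<eta>'>0. \<forall>i t x h k. (t, x) \<in> cone N \<longrightarrow> 0 < \<bar>h\<bar> \<longrightarrow> \<bar>h\<bar> \<le> \<eta>' \<longrightarrow> 0 < \<bar>k\<bar> \<longrightarrow> \<bar>k\<bar> \<le> \<eta>' \<longrightarrow>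
      \<bar>Dq h i t x - Dq k i t x\<bar> \<le> B / 2 + e"
proof -
  \<comment> \<open>The accuracy asked of the data and of the coefficients; the errors collected at
    the end add up to at most \<open>c * (4 + 2 * M)\<close>.\<close>
  define c where "c = e / (4 + 2 * M)"
  have c: "0 < c" "c * (4 + 2 * M) = e" using e M by (auto simp: c_def)
  obtain \<delta>0 where \<delta>0: "0 < \<delta>0" "\<forall>i x h k. \<bar>x\<bar> \<le> N + \<Lambda> * T \<longrightarrow> 0 < \<bar>h\<bar> \<longrightarrow> \<bar>h\<bar> \<le> \<delta>0 \<longrightarrow> 0 < \<bar>k\<bar> \<longrightarrow> \<bar>k\<bar> \<le> \<delta>0 \<longrightarrow>
      \<bar>(U0 i (x + h) - U0 i x) / h - (U0 i (x + k) - U0 i x) / k\<bar> \<le> c"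
    using U0_C1[OF c(1), of "N + \<Lambda> * T"] by blast
  obtain \<delta>1 where \<delta>1: "0 < \<delta>1" "\<forall>i x W E h k. \<bar>x\<bar> \<le> N + \<Lambda> * T \<longrightarrow>
      (\<forall>j. \<bar>W j - U0 j x\<bar> \<le> T * (M * \<Lambda> + G)) \<longrightarrow> (\<forall>j. \<bar>E j\<bar> \<le> 2 * L) \<longrightarrow>
      0 < \<bar>h\<bar> \<longrightarrow> \<bar>h\<bar> \<le> \<delta>1 \<longrightarrow> 0 < \<bar>k\<bar> \<longrightarrow> \<bar>k\<bar> \<le> \<delta>1 \<longrightarrow>
      \<bar>(lam i (\<lambda>j. W j + h * E j) - lam i W) / h - (lam i (\<lambda>j. W j + k * E j) - lam i W) / k\<bar> \<le> c"
    using lam_C1[OF c(1), of "N + \<Lambda> * T" "2 * L"] by blast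
  obtain \<delta>2 where \<delta>2: "0 < \<delta>2" "\<forall>i x W E h k. \<bar>x\<bar> \<le> N + \<Lambda> * T \<longrightarrow>
      (\<forall>j. \<bar>W j - U0 j x\<bar> \<le> T * (M * \<Lambda> + G)) \<longrightarrow> (\<forall>j. \<bar>E j\<bar> \<le> 2 * L) \<longrightarrow>
      0 < \<bar>h\<bar> \<longrightarrow> \<bar>h\<bar> \<le> \<delta>2 \<longrightarrow> 0 < \<bar>k\<bar> \<longrightarrow> \<bar>k\<bar> \<le> \<delta>2 \<longrightarrow>
      \<bar>(g i (\<lambda>j. W j + h * E j) - g i W) / h - (g i (\<lambda>j. W j + k * E j) - g i W) / k\<bar> \<le> c"
    using g_C1[OF c(1), of "N + \<Lambda> * T" "2 * L"] by blast
  \<comment> \<open>The halves are due to \<open>\<bar>Zq\<bar> \<le> 2\<close>: increments of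
    \<open>U\<close> and of the data are rescaled by \<open>Zq\<close> and may double. In the
    quotients of the coefficients the step remains \<open>h\<close> itself, and the direction
    \<open>Eq\<close> takes up the rescaling.\<close>
  define \<eta>' where "\<eta>' = min (min (\<eta> / 2) (\<delta>0 / 2)) (min \<delta>1 \<delta>2)"
  have "0 < \<eta>'" using \<eta> \<delta>0 \<delta>1 \<delta>2 by (simp add: \<eta>'_def)
  moreover have "\<bar>Dq h i t x - Dq k i t x\<bar> \<le> B / 2 + e"
    if tx: "(t, x) \<in> cone N" and h: "0 < \<bar>h\<bar>" "\<bar>h\<bar> \<le> \<eta>'" and k: "0 < \<bar>k\<bar>" "\<bar>k\<bar> \<le> \<eta>'"
    for i t x h k
  proof -
    have hk: "h \<noteq> 0" "k \<noteq> 0" using h k by auto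
    have t: "0 \<le> t" "t \<le> T" using tx by (auto simp: cone_def)
    have scaled: "0 < \<bar>p * Zq p i \<tau> t x\<bar>" "\<bar>p * Zq p i \<tau> t x\<bar> \<le> \<eta>" "\<bar>p * Zq p i \<tau> t x\<bar> \<le> \<delta>0"
      if "0 < \<bar>p\<bar>" "\<bar>p\<bar> \<le> \<eta>'" for p \<tau>
    proof -
      have "\<bar>p * Zq p i \<tau> t x\<bar> \<le> \<bar>p\<bar> * 2"
        unfolding abs_mult using Zq_le by (intro mult_left_mono) auto
      then show "\<bar>p * Zq p i \<tau> t x\<bar> \<le> \<eta>" "\<bar>p * Zq p i \<tau> t x\<bar> \<le> \<delta>0"
        using that by (auto simp: \<eta>'_def)
      show "0 < \<bar>p * Zq p i \<tau> t x\<bar>" using Zq_nonzero that by auto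
    qed
    \<comment> \<open>By the chain rule this is a difference of products. The oscillation of
      \<open>Dq\<close>, controlled by \<open>B\<close> at the rescaled increments, is weighted with
      \<open>\<bar>Zq\<bar> \<le> 2\<close>, and that of \<open>Zq\<close> with
      \<open>\<bar>Dq\<bar> \<le> L\<close>.\<close>
    have E: "\<bar>Eq h i \<tau> t x j - Eq k i \<tau> t x j\<bar> \<le> 2 * B + L * z"
      if \<tau>: "0 \<le> \<tau>" "\<tau> \<le> t" and z: "\<bar>Zq h i \<tau> t x - Zq k i \<tau> t x\<bar> \<le> z" for \<tau> z j
    proof -
      let ?a = "Zq h i \<tau> t x" and ?b = "Zq k i \<tau> t x"
      let ?p = "Dq (h * ?a) j \<tau> (X i \<tau> t x)" and ?q = "Dq (k * ?b) j \<tau> (X i \<tau> t x)"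
      have "\<bar>?a\<bar> * \<bar>?p - ?q\<bar> \<le> 2 * B"
        by (intro mult_mono Zq_le D cone_X[OF tx \<tau>] scaled h k) auto
      moreover have "\<bar>?a - ?b\<bar> * \<bar>?q\<bar> \<le> z * L"
        by (intro mult_mono z Dq_le) (use z in auto)
      moreover note abs_mult_diff_le[of ?a ?p ?b ?q]
      moreover have "z * L = L * z" by simp
      ultimately show ?thesis
        unfolding Eq_eq[OF hk(1) Zq_nonzero[OF hk(1)]] Eq_eq[OF hk(2) Zq_nonzero[OF hk(2)]]
        by linarith
    qed
    have shift: "(\<lambda>j. U j \<tau> (X i \<tau> t (x + p))) = (\<lambda>j. U j \<tau> (X i \<tau> t x) + p * Eq p i \<tau> t x j)"
      if "p \<noteq> 0" for p \<tau> using that by (simp add: Eq_def)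
    have W: "\<bar>X i \<tau> t x\<bar> \<le> N + \<Lambda> * T" if "0 \<le> \<tau>" "\<tau> \<le> t" for \<tau>
      using cone_bound[OF cone_X[OF tx that]] .
    have ql: "\<bar>(lam_along i t (x + h) \<tau> - lam_along i t x \<tau>) / h - (lam_along i t (x + k) \<tau> - lam_along i t x \<tau>) / k\<bar>
        \<le> K * (2 * B + L * z) + c"
      if \<tau>: "0 \<le> \<tau>" "\<tau> \<le> t" and z: "\<bar>Zq h i \<tau> t x - Zq k i \<tau> t x\<bar> \<le> z" for \<tau> z
      unfolding shift[OF hk(1)] shift[OF hk(2)]
    proof (rule quotient_compare[where f = "lam i", OF lam_lip])
      show "\<bar>(lam i (\<lambda>j. U j \<tau> (X i \<tau> t x) + h * Eq h i \<tau> t x j) - lam i (\<lambda>j. U j \<tau> (X i \<tau> t x))) / h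
        - (lam i (\<lambda>j. U j \<tau> (X i \<tau> t x) + k * Eq h i \<tau> t x j) - lam i (\<lambda>j. U j \<tau> (X i \<tau> t x))) / k\<bar> \<le> c"
        by (rule \<delta>1(2)[rule_format, OF W[OF \<tau>]]; (intro U_dist Eq_le)?) (use h k in \<open>simp_all add: \<eta>'_def\<close>)
    qed (use E[OF \<tau> z] hk in auto)
    have qg: "\<bar>(g_along i t (x + h) \<tau> - g_along i t x \<tau>) / h - (g_along i t (x + k) \<tau> - g_along i t x \<tau>) / k\<bar>
        \<le> K * (2 * B + L * z) + c"
      if \<tau>: "0 \<le> \<tau>" "\<tau> \<le> t" and z: "\<bar>Zq h i \<tau> t x - Zq k i \<tau> t x\<bar> \<le> z" for \<tau> z
      unfolding shift[OF hk(1)] shift[OF hk(2)]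
    proof (rule quotient_compare[where f = "g i", OF g_lip])
      show "\<bar>(g i (\<lambda>j. U j \<tau> (X i \<tau> t x) + h * Eq h i \<tau> t x j) - g i (\<lambda>j. U j \<tau> (X i \<tau> t x))) / h
        - (g i (\<lambda>j. U j \<tau> (X i \<tau> t x) + k * Eq h i \<tau> t x j) - g i (\<lambda>j. U j \<tau> (X i \<tau> t x))) / k\<bar> \<le> c"
        by (rule \<delta>2(2)[rule_format, OF W[OF \<tau>]]; (intro U_dist Eq_le)?) (use h k in \<open>simp_all add: \<eta>'_def\<close>)
    qed (use E[OF \<tau> z] hk in auto)
    \<comment> \<open>Unlike in \<open>prim_compare\<close>, the integrands are compared only
      between \<open>s\<close> and \<open>t\<close>, because after time \<open>t\<close> the
      characteristic need not lie in the cone.\<close>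
    have le: "\<bar>(prim T p t - prim T p s) - (prim T q t - prim T q s)\<bar> \<le> T * b"
      if "continuous_on {0..T} p" "continuous_on {0..T} q" "s \<in> {0..t}"
        "\<And>\<tau>. s \<le> \<tau> \<Longrightarrow> \<tau> \<le> t \<Longrightarrow> \<bar>p \<tau> - q \<tau>\<bar> \<le> b" for p q s b
    proof -
      have T0: "0 \<le> T" using T by simp
      have "(prim T p t - prim T p s) - (prim T q t - prim T q s)
          = prim T (\<lambda>\<tau>. p \<tau> - q \<tau>) t - prim T (\<lambda>\<tau>. p \<tau> - q \<tau>) s"
        using prim_sub[OF T0 that(1,2), of t] prim_sub[OF T0 that(1,2), of s] by linarith
      also have "\<bar>\<dots>\<bar> \<le> b * (t - s)"
        using that t by (intro prim_diff_le_between) (auto intro: continuous_intros)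
      also have "\<dots> \<le> b * T"
        using that(3) that(4)[of s] t by (intro mult_left_mono) (auto intro: order_trans[OF abs_ge_zero])
      finally show ?thesis by (simp add: mult.commute)
    qed
    have cont: "continuous_on {0..T} (\<lambda>\<tau>. (lam_along i t (x + p) \<tau> - lam_along i t x \<tau>) / p)"
      "continuous_on {0..T} (\<lambda>\<tau>. (g_along i t (x + p) \<tau> - g_along i t x \<tau>) / p)" if "p \<noteq> 0" for p
      using that by (auto intro!: continuous_intros along_continuous)
    \<comment> \<open>The oscillation of \<open>Zq\<close> is bounded by
      \<open>T * (K * (2 * B + L * z) + c)\<close>. The part with \<open>z\<close> is absorbed,
      which leaves twice the rest.\<close>
    define z where "z = 2 * (2 * (T * K * B) + c)"
    have z: "\<bar>Zq h i s t x - Zq k i s t x\<bar> \<le> z" if "s \<in> {0..t}" for s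
      unfolding z_def
    proof (rule absorb[where d = "\<lambda>s. \<bar>Zq h i s t x - Zq k i s t x\<bar>" and A = "{0..t}" and ?B0.0 = 4])
      show "\<bar>Zq h i s t x - Zq k i s t x\<bar> \<le> 4" for s
        using Zq_le[of h i s t x] Zq_le[of k i s t x] by linarith
      show "0 \<le> 2 * (T * K * B) + c" using T K B c by simp
    next
      fix z s assume z: "0 \<le> z" "\<And>s. s \<in> {0..t} \<Longrightarrow> \<bar>Zq h i s t x - Zq k i s t x\<bar> \<le> z" and s: "s \<in> {0..t}"
      have "\<bar>Zq h i s t x - Zq k i s t x\<bar> \<le> T * (K * (2 * B + L * z) + c)"
      proof -
        let ?p = "\<lambda>p. prim T (\<lambda>\<tau>. (lam_along i t (x + p) \<tau> - lam_along i t x \<tau>) / p)"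
        have "\<bar>(?p h t - ?p h s) - (?p k t - ?p k s)\<bar> \<le> T * (K * (2 * B + L * z) + c)"
        proof (rule le[OF cont(1)[OF hk(1)] cont(1)[OF hk(2)] s])
          fix \<tau> assume \<tau>: "s \<le> \<tau>" "\<tau> \<le> t"
          with s have "0 \<le> \<tau>" "\<tau> \<in> {0..t}" by auto
          then show "\<bar>(lam_along i t (x + h) \<tau> - lam_along i t x \<tau>) / h
              - (lam_along i t (x + k) \<tau> - lam_along i t x \<tau>) / k\<bar> \<le> K * (2 * B + L * z) + c"
            by (intro ql \<tau> z(2))
        qed
        with Zq_eq[OF hk(1), of i s t x] Zq_eq[OF hk(2), of i s t x] show ?thesis by linarith
      qed
      also have "\<dots> = 2 * (T * K * B) + T * K * L * z + T * c" by (simp add: algebra_simps)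
      also have "\<dots> \<le> 2 * (T * K * B) + 1 / 32 * z + 1 * c"
      proof -
        have "T * K * L * z \<le> 1 / 32 * z" "T * c \<le> 1 * c"
          using mult_right_mono[OF smalls(3) z(1)] mult_right_mono[OF T(2), of c] c by auto
        then show ?thesis by linarith
      qed
      finally show "\<bar>Zq h i s t x - Zq k i s t x\<bar> \<le> z / 2 + (2 * (T * K * B) + c)" using z(1) by simp
    qed (use that in auto)
    have z0: "\<bar>Zq h i 0 t x - Zq k i 0 t x\<bar> \<le> z" using z t by simp
    let ?G = "\<lambda>p. prim T (\<lambda>\<tau>. (g_along i t (x + p) \<tau> - g_along i t x \<tau>) / p)"
    have G: "\<bar>?G h t - ?G k t\<bar> \<le> T * (K * (2 * B + L * z) + c)"
    proof -
      have "\<bar>(?G h t - ?G h 0) - (?G k t - ?G k 0)\<bar> \<le> T * (K * (2 * B + L * z) + c)"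
      proof (rule le[OF cont(2)[OF hk(1)] cont(2)[OF hk(2)]])
        fix \<tau> assume \<tau>: "0 \<le> \<tau>" "\<tau> \<le> t"
        then have "\<tau> \<in> {0..t}" by auto
        then show "\<bar>(g_along i t (x + h) \<tau> - g_along i t x \<tau>) / h
            - (g_along i t (x + k) \<tau> - g_along i t x \<tau>) / k\<bar> \<le> K * (2 * B + L * z) + c"
          by (intro qg \<tau> z)
      qed (use t in auto)
      then show ?thesis using T by simp
    qed
    let ?A = "\<lambda>p. (U0 i (X i 0 t (x + p)) - U0 i (X i 0 t x)) / p"
    let ?D = "\<lambda>p. (U0 i (X i 0 t x + p * Zq p i 0 t x) - U0 i (X i 0 t x)) / (p * Zq p i 0 t x)"
    have A_eq: "?A p = Zq p i 0 t x * ?D p" if "p \<noteq> 0" for p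
      using that Zq_nonzero[OF that, of i 0 t x] by (simp add: X_shift[OF that, of i 0 t x])
    have D_le: "\<bar>?D k\<bar> \<le> M"
      using U0_lip[of i "X i 0 t x + k * Zq k i 0 t x" "X i 0 t x"] scaled(1)[OF k] M
      by (simp add: abs_divide pos_divide_le_eq)
    have A: "\<bar>?A h - ?A k\<bar> \<le> 2 * c + z * M"
    proof -
      have "\<bar>Zq h i 0 t x\<bar> * \<bar>?D h - ?D k\<bar> \<le> 2 * c"
        by (intro mult_mono Zq_le \<delta>0(2)[rule_format] scaled h k W) (use t in auto)
      moreover have "\<bar>Zq h i 0 t x - Zq k i 0 t x\<bar> * \<bar>?D k\<bar> \<le> z * M"
        by (intro mult_mono z0 D_le) (use z0 in auto)
      moreover note abs_mult_diff_le[of "Zq h i 0 t x" "?D h" "Zq k i 0 t x" "?D k"]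
      ultimately show ?thesis unfolding A_eq[OF hk(1)] A_eq[OF hk(2)] by linarith
    qed
    have "\<bar>Dq h i t x - Dq k i t x\<bar> \<le> 2 * c + z * M + T * (K * (2 * B + L * z) + c)"
      using A G Dq_eq[OF hk(1), of i t x] Dq_eq[OF hk(2), of i t x] by linarith
    also have "\<dots> \<le> B / 2 + c * (4 + 2 * M)"
    proof -
      have z0: "0 \<le> z" using T K B c by (simp add: z_def)
      \<comment> \<open>The multiples of \<open>B\<close> are 4 T K M, 2 T K and, through the
        occurrence of \<open>z\<close> in the source term, 4 (T K) (T K L). By \<open>smalls\<close>
        their sum is well below one half.\<close>
      note mult_right_mono[OF smalls(1) B] mult_right_mono[OF smalls(2) B]
        mult_right_mono[OF smalls(3) z0] mult_right_mono[OF T(2) less_imp_le[OF c(1)]]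
      moreover have "z * M + T * (K * (2 * B + L * z) + c)
          = 4 * (T * K * M * B) + 2 * (c * M) + 2 * (T * K * B) + T * K * L * z + T * c"
        unfolding z_def by (simp add: algebra_simps)
      moreover have "z = 4 * (T * K * B) + 2 * c" "c * (4 + 2 * M) = 4 * c + 2 * (c * M)"
        by (simp_all add: z_def algebra_simps)
      ultimately show ?thesis using B c(1) by linarith
    qed
    finally show ?thesis using c(2) by simp
  qed
  ultimately show ?thesis by blast
qed

end


lemma mvt_between:
  fixes f :: "real \<Rightarrow> real"
  assumes "\<And>x. (f has_real_derivative f' x) (at x)"
  shows "\<exists>z. \<bar>z - x\<bar> \<le> \<bar>y - x\<bar> \<and> f y - f x = f' z * (y - x)"
proof -
  consider "x < y" | "y < x" | "x = y" by linarith
  then show ?thesis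
  proof cases
    case 1
    from MVT2[OF this assms] obtain z where "x < z" "z < y" "f y - f x = (y - x) * f' z" by blast
    then show ?thesis by (intro exI[of _ z]) (auto simp: mult.commute)
  next
    case 2
    from MVT2[OF this assms] obtain z where "y < z" "z < x" "f x - f y = (x - y) * f' z" by blast
    then show ?thesis by (intro exI[of _ z]) (auto simp: algebra_simps)
  qed auto
qed

lemma continuous_on_if_lipschitz2:
  fixes f :: "real \<Rightarrow> real \<Rightarrow> real"
  assumes f: "\<And>t x t' x'. \<bar>f t x - f t' x'\<bar> \<le> A * \<bar>x - x'\<bar> + B * \<bar>t - t'\<bar>" and "0 \<le> A" "0 \<le> B"
  shows "continuous_on S (\<lambda>(t, x). f t x)"
proof (rule lipschitz_on_continuous_on)
  show "(A + B)-lipschitz_on S (\<lambda>(t, x). f t x)"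
  proof (rule lipschitz_onI)
    fix p q :: "real \<times> real"
    have "A * \<bar>snd p - snd q\<bar> \<le> A * dist p q" "B * \<bar>fst p - fst q\<bar> \<le> B * dist p q"
      using dist_snd_le[of p q] dist_fst_le[of p q] assms by (auto intro!: mult_left_mono simp: dist_real_def)
    with f[of "fst p" "snd p" "fst q" "snd q"]
    show "dist (case p of (t, x) \<Rightarrow> f t x) (case q of (t, x) \<Rightarrow> f t x) \<le> (A + B) * dist p q"
      by (simp add: dist_real_def case_prod_beta algebra_simps)
  qed (use assms in simp)
qed

lemma continuous_on_strip_local:
  fixes f :: "real \<Rightarrow> real \<Rightarrow> real"
  assumes "\<And>N. continuous_on ({0..T} \<times> {-N..N}) (\<lambda>(t, x). f t x)"
  shows "continuous_on ({0..T} \<times> UNIV) (\<lambda>(t, x). f t x)"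
  unfolding continuous_on_eq_continuous_within
proof
  fix p :: "real \<times> real" assume p: "p \<in> {0..T} \<times> UNIV"
  define N where "N = \<bar>snd p\<bar> + 1"
  define O' where "O' = (UNIV :: real set) \<times> {-N<..<N}"
  have "open O'" unfolding O'_def by (intro open_Times) auto
  have pO: "p \<in> O'" by (cases p) (auto simp: O'_def N_def)
  have eq: "at p within ({0..T} \<times> UNIV) = at p within ({0..T} \<times> {-N..N})"
    by (rule at_within_nhd[OF pO \<open>open O'\<close>]) (auto simp: O'_def)
  have "p \<in> {0..T} \<times> {-N..N}" using p pO by (cases p) (auto simp: O'_def)
  with assms[of N] show "continuous (at p within {0..T} \<times> UNIV) (\<lambda>(t, x). f t x)"
    unfolding eq continuous_on_eq_continuous_within by blast
qed

section \<open>Convergence of the difference quotients and the classical derivatives of the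
  solution\<close>

context characteristic_flow begin

text \<open>The admissible increment shrinks with every use of \<open>Dq_halving\<close>, so the
  halving cannot be carried to the limit at a fixed \<open>\<eta>\<close>, as \<open>absorb\<close>
  would do. A given accuracy needs only finitely many halvings of the initial bound
  \<open>2 * L\<close>; the error \<open>e / 4\<close> per step keeps the remainder
  \<open>e / 2\<close> invariant.\<close>

lemma Dq_cauchy:
  assumes e: "0 < e"
  shows "\<exists>\<eta>>0. \<forall>i t x h k. (t, x) \<in> cone N \<longrightarrow> 0 < \<bar>h\<bar> \<longrightarrow> \<bar>h\<bar> \<le> \<eta> \<longrightarrow> 0 < \<bar>k\<bar> \<longrightarrow> \<bar>k\<bar> \<le> \<eta> \<longrightarrow>
      \<bar>Dq h i t x - Dq k i t x\<bar> \<le> e"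
proof -
  let ?P = "\<lambda>B. \<exists>\<eta>>0. \<forall>i t x h k. (t, x) \<in> cone N \<longrightarrow> 0 < \<bar>h\<bar> \<longrightarrow> \<bar>h\<bar> \<le> \<eta> \<longrightarrow> 0 < \<bar>k\<bar> \<longrightarrow> \<bar>k\<bar> \<le> \<eta> \<longrightarrow>
      \<bar>Dq h i t x - Dq k i t x\<bar> \<le> B"
  have P: "?P (2 * L * (1/2) ^ n + e / 2)" for n
  proof (induction n)
    case 0
    have "\<bar>Dq h i t x - Dq k i t x\<bar> \<le> 2 * L * (1/2) ^ 0 + e / 2" for h k i t x
      using Dq_le[of h i t x] Dq_le[of k i t x] e by simp
    then show ?case by (intro exI[of _ 1]) auto
  next
    case (Suc n)
    then obtain \<eta> where \<eta>: "0 < \<eta>" "\<forall>i t x h k. (t, x) \<in> cone N \<longrightarrow> 0 < \<bar>h\<bar> \<longrightarrow> \<bar>h\<bar> \<le> \<eta> \<longrightarrow> 0 < \<bar>k\<bar> \<longrightarrow> \<bar>k\<bar> \<le> \<eta> \<longrightarrow>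
      \<bar>Dq h i t x - Dq k i t x\<bar> \<le> 2 * L * (1/2) ^ n + e / 2" by blast
    have B: "0 \<le> 2 * L * (1/2) ^ n + e / 2" using nonneg e by simp
    have e4: "0 < e / 4" using e by simp
    have "(2 * L * (1/2) ^ n + e / 2) / 2 + e / 4 = 2 * L * (1/2) ^ Suc n + e / 2" by (simp add: field_simps)
    with Dq_halving[OF B \<eta>(1) e4 \<eta>(2)[rule_format]] show ?case by simp
  qed
  have "(\<lambda>n. 2 * L * (1/2) ^ n) \<longlonglongrightarrow> 2 * L * 0"
    by (intro tendsto_intros LIMSEQ_power_zero) auto
  then have "\<forall>\<^sub>F n in sequentially. 2 * L * (1/2) ^ n < e / 2"
    using e by (intro order_tendstoD(2)) auto
  then obtain n where n: "2 * L * (1/2) ^ n < e / 2" by (auto simp: eventually_sequentially)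
  from P[of n] obtain \<eta> where \<eta>: "0 < \<eta>" "\<forall>i t x h k. (t, x) \<in> cone N \<longrightarrow> 0 < \<bar>h\<bar> \<longrightarrow> \<bar>h\<bar> \<le> \<eta> \<longrightarrow> 0 < \<bar>k\<bar> \<longrightarrow> \<bar>k\<bar> \<le> \<eta> \<longrightarrow>
      \<bar>Dq h i t x - Dq k i t x\<bar> \<le> 2 * L * (1/2) ^ n + e / 2" by blast
  have "\<bar>Dq h i t x - Dq k i t x\<bar> \<le> e"
    if "(t, x) \<in> cone N" "0 < \<bar>h\<bar>" "\<bar>h\<bar> \<le> \<eta>" "0 < \<bar>k\<bar>" "\<bar>k\<bar> \<le> \<eta>" for i t x h k
    using \<eta>(2)[rule_format, OF that, of i] n by linarith
  with \<eta>(1) show ?thesis by blast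
qed

definition dxU :: "'i \<Rightarrow> real \<Rightarrow> real \<Rightarrow> real" where
  "dxU i t x = lim (\<lambda>n. Dq (1 / real (Suc n)) i t x)"

text \<open>The limit was defined along one sequence of increments, and the Cauchy property
  transfers it to all small \<open>h\<close>, uniformly on the cone. Differentiability in
  \<open>x\<close>, the bound on the derivative and its joint continuity all come from this
  uniformity.\<close>

lemma Dq_near:
  assumes e: "0 < e"
  shows "\<exists>\<eta>>0. \<forall>i t x h. (t, x) \<in> cone N \<longrightarrow> 0 < \<bar>h\<bar> \<longrightarrow> \<bar>h\<bar> \<le> \<eta> \<longrightarrow> \<bar>Dq h i t x - dxU i t x\<bar> \<le> e"
proof -
  have small: "\<exists>m. \<forall>n\<ge>m. 0 < \<bar>1 / real (Suc n)\<bar> \<and> \<bar>1 / real (Suc n)\<bar> \<le> \<eta>" if "0 < \<eta>" for \<eta>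
  proof -
    have "\<forall>\<^sub>F n in sequentially. 1 / real (Suc n) < \<eta>"
      using LIMSEQ_Suc[OF lim_1_over_n] that by (rule order_tendstoD(2))
    then show ?thesis by (auto simp: eventually_sequentially intro: less_imp_le)
  qed
  have lim: "(\<lambda>n. Dq (1 / real (Suc n)) i t x) \<longlonglongrightarrow> dxU i t x" if tx: "(t, x) \<in> cone N" for i t x
  proof -
    have "Cauchy (\<lambda>n. Dq (1 / real (Suc n)) i t x)"
    proof (rule metric_CauchyI)
      fix e :: real assume "0 < e"
      then have "0 < e / 2" by simp
      from Dq_cauchy[OF this, of N] obtain \<eta> where \<eta>: "0 < \<eta>" "\<forall>i t x h k. (t, x) \<in> cone N \<longrightarrow> 0 < \<bar>h\<bar> \<longrightarrow> \<bar>h\<bar> \<le> \<eta> \<longrightarrow> 0 < \<bar>k\<bar> \<longrightarrow> \<bar>k\<bar> \<le> \<eta> \<longrightarrow>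
        \<bar>Dq h i t x - Dq k i t x\<bar> \<le> e / 2" by blast
      from small[OF \<eta>(1)] obtain m where m: "\<And>n. m \<le> n \<Longrightarrow> 0 < \<bar>1 / real (Suc n)\<bar>"
        "\<And>n. m \<le> n \<Longrightarrow> \<bar>1 / real (Suc n)\<bar> \<le> \<eta>" by blast
      have "dist (Dq (1 / real (Suc n)) i t x) (Dq (1 / real (Suc n')) i t x) < e" if "m \<le> n" "m \<le> n'" for n n'
        using \<eta>(2)[rule_format, OF tx m(1,2)[OF that(1)] m(1,2)[OF that(2)], of i] \<open>0 < e\<close>
        unfolding dist_real_def by linarith
      then show "\<exists>m. \<forall>n\<ge>m. \<forall>n'\<ge>m. dist (Dq (1 / real (Suc n)) i t x) (Dq (1 / real (Suc n')) i t x) < e"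
        by blast
    qed
    then have "convergent (\<lambda>n. Dq (1 / real (Suc n)) i t x)" by (rule real_Cauchy_convergent)
    then show ?thesis unfolding dxU_def by (simp add: convergent_LIMSEQ_iff)
  qed
  from Dq_cauchy[OF e, of N] obtain \<eta> where \<eta>: "0 < \<eta>" "\<forall>i t x h k. (t, x) \<in> cone N \<longrightarrow> 0 < \<bar>h\<bar> \<longrightarrow> \<bar>h\<bar> \<le> \<eta> \<longrightarrow> 0 < \<bar>k\<bar> \<longrightarrow> \<bar>k\<bar> \<le> \<eta> \<longrightarrow>
    \<bar>Dq h i t x - Dq k i t x\<bar> \<le> e" by blast
  from small[OF \<eta>(1)] obtain m where m: "\<And>n. m \<le> n \<Longrightarrow> 0 < \<bar>1 / real (Suc n)\<bar>"
    "\<And>n. m \<le> n \<Longrightarrow> \<bar>1 / real (Suc n)\<bar> \<le> \<eta>" by blast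
  have "\<bar>Dq h i t x - dxU i t x\<bar> \<le> e" if tx: "(t, x) \<in> cone N" "0 < \<bar>h\<bar>" "\<bar>h\<bar> \<le> \<eta>" for i t x h
  proof (rule LIMSEQ_le_const2)
    show "(\<lambda>n. \<bar>Dq h i t x - Dq (1 / real (Suc n)) i t x\<bar>) \<longlonglongrightarrow> \<bar>Dq h i t x - dxU i t x\<bar>"
      by (intro tendsto_intros lim tx)
    show "\<exists>N. \<forall>n\<ge>N. \<bar>Dq h i t x - Dq (1 / real (Suc n)) i t x\<bar> \<le> e"
      using \<eta>(2)[rule_format, OF tx m] by blast
  qed
  with \<eta>(1) show ?thesis by blast
qed

lemma in_cone: "t \<in> {0..T} \<Longrightarrow> \<bar>x\<bar> \<le> N \<Longrightarrow> (t, x) \<in> cone N"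
  using mult_nonneg_nonneg[OF nonneg(1), of "T - t"] by (auto simp: cone_def)

lemma U_has_dx:
  assumes t: "t \<in> {0..T}"
  shows "((\<lambda>x. U i t x) has_real_derivative dxU i t x) (at x)"
  unfolding DERIV_def
proof (rule LIM_I)
  fix r :: real assume "0 < r"
  then have "0 < r / 2" by simp
  from Dq_near[OF this, of "\<bar>x\<bar>"] obtain \<eta> where \<eta>: "0 < \<eta>"
    "\<forall>i t y h. (t, y) \<in> cone \<bar>x\<bar> \<longrightarrow> 0 < \<bar>h\<bar> \<longrightarrow> \<bar>h\<bar> \<le> \<eta> \<longrightarrow> \<bar>Dq h i t y - dxU i t y\<bar> \<le> r / 2" by blast
  have "\<bar>Dq h i t x - dxU i t x\<bar> < r" if "h \<noteq> 0" "\<bar>h\<bar> < \<eta>" for h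
    using \<eta>(2)[rule_format, OF in_cone[OF t order_refl], of h i] that \<open>0 < r\<close> by auto
  then show "\<exists>s>0. \<forall>h. h \<noteq> 0 \<and> norm (h - 0) < s \<longrightarrow> norm ((U i t (x + h) - U i t x) / h - dxU i t x) < r"
    using \<eta>(1) by (intro exI[of _ \<eta>]) (auto simp: Dq_def)
qed

lemma dxU_le:
  assumes t: "t \<in> {0..T}"
  shows "\<bar>dxU i t x\<bar> \<le> L"
proof (rule field_le_epsilon)
  fix e :: real assume "0 < e"
  from Dq_near[OF this, of "\<bar>x\<bar>"] obtain \<eta> where \<eta>: "0 < \<eta>"
    "\<forall>i t y h. (t, y) \<in> cone \<bar>x\<bar> \<longrightarrow> 0 < \<bar>h\<bar> \<longrightarrow> \<bar>h\<bar> \<le> \<eta> \<longrightarrow> \<bar>Dq h i t y - dxU i t y\<bar> \<le> e" by blast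
  have "\<bar>Dq \<eta> i t x - dxU i t x\<bar> \<le> e"
    by (rule \<eta>(2)[rule_format, OF in_cone[OF t order_refl]]) (use \<eta>(1) in auto)
  with Dq_le[of \<eta> i t x] show "\<bar>dxU i t x\<bar> \<le> L + e" by linarith
qed

lemma U_continuous: "continuous_on S (\<lambda>(t, x). U i t x)"
  by (rule continuous_on_if_lipschitz2[OF admissible_U[OF adm] nonneg(3,4)])

lemma dxU_continuous: "continuous_on ({0..T} \<times> UNIV) (\<lambda>(t, x). dxU i t x)"
proof (rule continuous_on_strip_local)
  fix N :: real
  let ?S = "{0..T} \<times> {-N..N}"
  let ?F = "\<lambda>n p. Dq (1 / real (Suc n)) i (fst p) (snd p)"
  have "continuous_on ?S (\<lambda>p. dxU i (fst p) (snd p))"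
  proof (rule uniform_limit_theorem[where F = sequentially and f = ?F])
    have "continuous_on ?S (\<lambda>p. U i (fst p) (snd p + c))" for c
      using continuous_on_compose2[OF U_continuous[of UNIV i], of ?S "\<lambda>p. (fst p, snd p + c)"]
      by (simp add: continuous_intros)
    from this this[of 0] have "continuous_on ?S (?F n)" for n
      unfolding Dq_def by (intro continuous_intros) auto
    then show "\<forall>\<^sub>F n in sequentially. continuous_on ?S (?F n)" by simp
    show "uniform_limit ?S ?F (\<lambda>p. dxU i (fst p) (snd p)) sequentially"
    proof (rule uniform_limitI)
      fix e :: real assume "0 < e"
      then have "0 < e / 2" by simp
      from Dq_near[OF this, of N] obtain \<eta> where \<eta>: "0 < \<eta>"
        "\<forall>i t x h. (t, x) \<in> cone N \<longrightarrow> 0 < \<bar>h\<bar> \<longrightarrow> \<bar>h\<bar> \<le> \<eta> \<longrightarrow> \<bar>Dq h i t x - dxU i t x\<bar> \<le> e / 2" by blast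
      have "\<forall>\<^sub>F n in sequentially. 1 / real (Suc n) < \<eta>"
        using LIMSEQ_Suc[OF lim_1_over_n] \<eta>(1) by (rule order_tendstoD(2))
      then show "\<forall>\<^sub>F n in sequentially. \<forall>p\<in>?S. dist (?F n p) (dxU i (fst p) (snd p)) < e"
      proof eventually_elim
        case (elim n)
        show ?case
        proof
          fix p assume p: "p \<in> ?S"
          have "\<bar>?F n p - dxU i (fst p) (snd p)\<bar> \<le> e / 2"
            by (rule \<eta>(2)[rule_format, OF in_cone]) (use p elim in auto)
          with \<open>0 < e\<close> show "dist (?F n p) (dxU i (fst p) (snd p)) < e" by (simp add: dist_real_def)
        qed
      qed
    qed
  qed simp
  then show "continuous_on ?S (\<lambda>(t, x). dxU i t x)" by (simp add: case_prod_beta)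
qed

text \<open>Known are the derivative of \<open>U\<close> along the characteristic through (t, x),
  from the integral equation, and the slope in \<open>x\<close>. By the mean value theorem the
  values on the curve and on the vertical line differ by \<open>dxU\<close> at an intermediate point
  times the displacement, and joint continuity of \<open>dxU\<close> gives the limit.\<close>

lemma U_has_dt:
  assumes t: "t \<in> {0..T}"
  shows "((\<lambda>s. U i s x) has_real_derivative g i (\<lambda>j. U j t x) - lam i (\<lambda>j. U j t x) * dxU i t x)
    (at t within {0..T})"
proof -
  define \<xi> where "\<xi> s = X i s t x" for s
  have \<xi>t: "\<xi> t = x" by (simp add: \<xi>_def X_self)
  have d\<xi>: "(\<xi> has_real_derivative lam i (\<lambda>j. U j t x)) (at t within {0..T})"
  proof -
    have "(prim T (lam_along i t x) has_real_derivative lam_along i t x t) (at t within {0..T})"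
      using prim_has_vector_derivative[OF along_continuous(1) t]
      by (simp add: has_real_derivative_iff_has_vector_derivative)
    from DERIV_diff[OF DERIV_const[of "x"] DERIV_diff[OF DERIV_const this]]
    have "((\<lambda>s. x - (prim T (lam_along i t x) t - prim T (lam_along i t x) s))
        has_real_derivative lam i (\<lambda>j. U j t x)) (at t within {0..T})"
      by (simp add: X_self)
    moreover have "\<xi> = (\<lambda>s. x - (prim T (lam_along i t x) t - prim T (lam_along i t x) s))"
      unfolding \<xi>_def by (rule ext) (rule X_eq)
    ultimately show ?thesis by (simp only:)
  qed
  have dA: "((\<lambda>s. U i s (\<xi> s)) has_real_derivative g i (\<lambda>j. U j t x)) (at t within {0..T})"
  proof -
    have "(prim T (g_along i t x) has_real_derivative g_along i t x t) (at t within {0..T})"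
      using prim_has_vector_derivative[OF along_continuous(2) t]
      by (simp add: has_real_derivative_iff_has_vector_derivative)
    from DERIV_add[OF DERIV_const[of "U0 i (X i 0 t x)"] this]
    show ?thesis unfolding \<xi>_def U_along by (simp add: X_self)
  qed
  have "\<forall>s. \<exists>z. s \<in> {0..T} \<longrightarrow> \<bar>z - x\<bar> \<le> \<bar>\<xi> s - x\<bar> \<and> U i s (\<xi> s) - U i s x = dxU i s z * (\<xi> s - x)"
    using mvt_between[OF U_has_dx] by blast
  then obtain z where z: "\<And>s. s \<in> {0..T} \<Longrightarrow> \<bar>z s - x\<bar> \<le> \<bar>\<xi> s - x\<bar>"
    "\<And>s. s \<in> {0..T} \<Longrightarrow> U i s (\<xi> s) - U i s x = dxU i s (z s) * (\<xi> s - x)" by metis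
  have \<xi>_lim: "(\<xi> \<longlongrightarrow> x) (at t within {0..T})"
    using DERIV_continuous[OF d\<xi>] by (simp add: continuous_within \<xi>t)
  have z_lim: "(z \<longlongrightarrow> x) (at t within {0..T})"
  proof (rule Lim_transform2[OF tendsto_const])
    have "((\<lambda>s. \<bar>\<xi> s - x\<bar>) \<longlongrightarrow> \<bar>x - x\<bar>) (at t within {0..T})" by (intro tendsto_intros \<xi>_lim)
    then have lim: "((\<lambda>s. \<bar>\<xi> s - x\<bar>) \<longlongrightarrow> 0) (at t within {0..T})" by simp
    show "((\<lambda>s. x - z s) \<longlongrightarrow> 0) (at t within {0..T})"
      by (rule Lim_null_comparison[OF _ lim])
        (use z(1) in \<open>auto simp: eventually_at_filter abs_minus_commute intro!: always_eventually\<close>)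
  qed
  have q_lim: "((\<lambda>s. dxU i s (z s)) \<longlongrightarrow> dxU i t x) (at t within {0..T})"
  proof -
    have "((\<lambda>s. (s, z s)) \<longlongrightarrow> (t, x)) (at t within {0..T})" by (intro tendsto_intros z_lim)
    moreover have "\<forall>\<^sub>F s in at t within {0..T}. (s, z s) \<in> {0..T} \<times> UNIV"
      by (auto simp: eventually_at_filter)
    ultimately have "((\<lambda>s. (\<lambda>(t, x). dxU i t x) (s, z s)) \<longlongrightarrow> (\<lambda>(t, x). dxU i t x) (t, x)) (at t within {0..T})"
      using t by (intro continuous_on_tendsto_compose[OF dxU_continuous]) auto
    then show ?thesis by simp
  qed
  have "((\<lambda>s. (U i s (\<xi> s) - U i t (\<xi> t)) / (s - t) - dxU i s (z s) * ((\<xi> s - \<xi> t) / (s - t)))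
      \<longlongrightarrow> g i (\<lambda>j. U j t x) - dxU i t x * lam i (\<lambda>j. U j t x)) (at t within {0..T})"
    using dA d\<xi> unfolding has_field_derivative_iff by (intro tendsto_intros q_lim)
  then have "((\<lambda>s. (U i s x - U i t x) / (s - t))
      \<longlongrightarrow> g i (\<lambda>j. U j t x) - dxU i t x * lam i (\<lambda>j. U j t x)) (at t within {0..T})"
  proof (rule Lim_transform_eventually)
    show "\<forall>\<^sub>F s in at t within {0..T}. (U i s (\<xi> s) - U i t (\<xi> t)) / (s - t)
        - dxU i s (z s) * ((\<xi> s - \<xi> t) / (s - t)) = (U i s x - U i t x) / (s - t)"
      unfolding eventually_at_filter
    proof (intro always_eventually allI impI)
      fix s assume "s \<in> {0..T}"
      from z(2)[OF this] have "U i s x - U i t x = (U i s (\<xi> s) - U i t x) - dxU i s (z s) * (\<xi> s - x)"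
        by linarith
      then show "(U i s (\<xi> s) - U i t (\<xi> t)) / (s - t) - dxU i s (z s) * ((\<xi> s - \<xi> t) / (s - t))
          = (U i s x - U i t x) / (s - t)"
        by (simp add: \<xi>t diff_divide_distrib add_divide_distrib right_diff_distrib)
    qed
  qed
  then show ?thesis unfolding has_field_derivative_iff by (simp add: mult.commute)
qed

lemma U_initial: "U i 0 x = U0 i x"
  using U_eq[of i 0 x] T by (simp add: X_self)


text \<open>A bound that improves itself on every cone holds: on a cone some finite bound exists by
  compactness.\<close>

lemma cone_absorb:
  fixes f :: "'i \<Rightarrow> real \<Rightarrow> real \<Rightarrow> real" and \<omega> :: "real \<Rightarrow> real"
  assumes f: "\<And>i. i \<in> J \<Longrightarrow> continuous_on ({0..T} \<times> UNIV) (\<lambda>(t, x). f i t x)"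
    and \<omega>: "continuous_on UNIV \<omega>" "\<And>x. 0 < \<omega> x" and A: "0 \<le> A"
    and step: "\<And>N m i t x. 0 \<le> m \<Longrightarrow> (\<And>i t x. i \<in> J \<Longrightarrow> (t, x) \<in> cone N \<Longrightarrow> \<bar>f i t x\<bar> \<le> m * \<omega> x) \<Longrightarrow>
      i \<in> J \<Longrightarrow> (t, x) \<in> cone N \<Longrightarrow> \<bar>f i t x\<bar> \<le> (m / 2 + A) * \<omega> x"
    and i: "i \<in> J" and t: "t \<in> {0..T}"
  shows "\<bar>f i t x\<bar> \<le> 2 * A * \<omega> x"
proof -
  define N where "N = \<bar>x\<bar>"
  define S where "S = {(i, t, x). i \<in> J \<and> (t, x) \<in> cone N}"
  define d where "d = (\<lambda>(i, t, x). \<bar>f i t x\<bar> / \<omega> x)"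
  have "\<exists>B. \<forall>(t, x)\<in>cone N. i \<in> J \<longrightarrow> \<bar>f i t x\<bar> / \<omega> x \<le> B" for i
  proof (cases "i \<in> J")
    case True
    let ?C = "{0..T} \<times> {-(N + \<Lambda> * T)..N + \<Lambda> * T}"
    let ?q = "\<lambda>p. \<bar>f i (fst p) (snd p)\<bar> / \<omega> (snd p)"
    have 1: "continuous_on ?C (\<lambda>p. f i (fst p) (snd p))"
      by (rule continuous_on_subset[of "{0..T} \<times> UNIV"]) (use f[OF True] in \<open>auto simp: case_prod_beta\<close>)
    have 2: "continuous_on ?C (\<lambda>p. \<omega> (snd p))"
      by (rule continuous_on_compose2[OF \<omega>(1)]) (auto intro!: continuous_intros)
    have "\<omega> y \<noteq> 0" for y using \<omega>(2)[of y] by (metis less_irrefl)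
    with 1 2 have "continuous_on ?C ?q" by (intro continuous_intros) auto
    then have "compact (?q ` ?C)" by (intro compact_continuous_image compact_Times) auto
    then have "bounded (?q ` ?C)" by (rule compact_imp_bounded)
    then obtain B where "\<forall>y\<in>?q ` ?C. norm y \<le> B" unfolding bounded_iff by blast
    then have B: "norm (?q p) \<le> B" if "p \<in> ?C" for p using that by blast
    have "\<bar>f i t x\<bar> / \<omega> x \<le> B" if "(t, x) \<in> cone N" for t x
    proof -
      have "(t, x) \<in> ?C" using cone_bound[OF that] that by (auto simp: cone_def abs_le_iff)
      from B[OF this] \<omega>(2)[of x] show ?thesis by simp
    qed
    then show ?thesis by blast
  qed auto
  then obtain B where B: "\<And>i t x. (t, x) \<in> cone N \<Longrightarrow> i \<in> J \<Longrightarrow> \<bar>f i t x\<bar> / \<omega> x \<le> B i"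
    by (metis (mono_tags, lifting) case_prodD)
  have "d (i, t, x) \<le> 2 * A"
  proof (rule absorb[where d = d and A = S])
    show "0 \<le> A" by (rule A)
    show "d p \<le> (\<Sum>i\<in>UNIV. \<bar>B i\<bar>)" if "p \<in> S" for p
    proof -
      obtain i t x where p: "p = (i, t, x)" by (cases p)
      with that have "d p \<le> B i" using B by (auto simp: S_def d_def)
      also have "B i \<le> \<bar>B i\<bar>" by simp
      also have "\<dots> \<le> (\<Sum>i\<in>UNIV. \<bar>B i\<bar>)" by (rule member_le_sum) auto
      finally show ?thesis .
    qed
  next
    fix m p assume m: "0 \<le> m" "\<And>p. p \<in> S \<Longrightarrow> d p \<le> m" and p: "p \<in> S"
    have le: "\<bar>f i t x\<bar> \<le> m * \<omega> x" if "i \<in> J" "(t, x) \<in> cone N" for i t x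
      using m(2)[of "(i, t, x)"] that \<omega>(2)[of x] by (simp add: S_def d_def pos_divide_le_eq)
    obtain i t x where ptx: "p = (i, t, x)" by (cases p)
    with p have "\<bar>f i t x\<bar> \<le> (m / 2 + A) * \<omega> x" by (intro step[OF m(1) le]) (auto simp: S_def)
    then show "d p \<le> m / 2 + A" using \<omega>(2)[of x] by (simp add: ptx d_def pos_divide_le_eq)
  next
    show "(i, t, x) \<in> S" using i in_cone[OF t] by (simp add: S_def N_def)
  qed
  then show ?thesis using \<omega>(2)[of x] by (simp add: d_def pos_divide_le_eq)
qed

text \<open>The source of a component in \<open>J\<close> is at most linear in the components in
  \<open>J\<close>, so a bound \<open>m * \<omega>\<close> inserted into the integral equation
  returns with a small factor. Comparing weights at the two ends of a characteristic costs a factor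
  2, since it travels at most \<open>\<Lambda> * T\<close>. Components outside \<open>J\<close> may
  be unbounded.\<close>

lemma decay:
  assumes \<omega>: "continuous_on UNIV \<omega>" "\<And>x. 0 < \<omega> x" "\<And>x y. \<bar>x - y\<bar> \<le> \<Lambda> * T \<Longrightarrow> \<omega> y \<le> 2 * \<omega> x"
    and U0: "\<And>i x. i \<in> J \<Longrightarrow> \<bar>U0 i x\<bar> \<le> \<omega> x"
    and g: "\<And>i W b. i \<in> J \<Longrightarrow> (\<And>j. j \<in> J \<Longrightarrow> \<bar>W j\<bar> \<le> b) \<Longrightarrow> \<bar>g i W\<bar> \<le> K * b"
    and i: "i \<in> J" and t: "t \<in> {0..T}"
  shows "\<bar>U i t x\<bar> \<le> 4 * \<omega> x"
proof -
  have "\<bar>U i t x\<bar> \<le> 2 * 2 * \<omega> x"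
  proof (rule cone_absorb[where J = J and f = U, OF _ \<omega>(1,2) _ _ i t])
    show "continuous_on ({0..T} \<times> UNIV) (\<lambda>(t, x). U i t x)" for i by (rule U_continuous)
  next
    fix N m i t x
    assume m: "0 \<le> m" and b: "\<And>i t x. i \<in> J \<Longrightarrow> (t, x) \<in> cone N \<Longrightarrow> \<bar>U i t x\<bar> \<le> m * \<omega> x"
      and i: "i \<in> J" and tx: "(t, x) \<in> cone N"
    have t: "0 \<le> t" "t \<le> T" using tx by (auto simp: cone_def)
    have near: "\<omega> (X i \<tau> t x) \<le> 2 * \<omega> x" for \<tau>
      using X_dist(2)[of i \<tau> t x] by (intro \<omega>(3)) (simp add: abs_minus_commute)
    have "\<bar>prim T (g_along i t x) t - prim T (g_along i t x) 0\<bar> \<le> K * (m * (2 * \<omega> x)) * (t - 0)"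
    proof (rule prim_diff_le_between[OF along_continuous(2)])
      fix \<tau> assume \<tau>: "\<tau> \<in> {0..t}"
      show "\<bar>g_along i t x \<tau>\<bar> \<le> K * (m * (2 * \<omega> x))"
      proof (rule g[OF i])
        fix j assume j: "j \<in> J"
        have "\<bar>U j \<tau> (X i \<tau> t x)\<bar> \<le> m * \<omega> (X i \<tau> t x)"
          using \<tau> by (intro b j cone_X[OF tx]) auto
        also have "\<dots> \<le> m * (2 * \<omega> x)" using m near by (intro mult_left_mono)
        finally show "\<bar>U j \<tau> (X i \<tau> t x)\<bar> \<le> m * (2 * \<omega> x)" .
      qed
    qed (use t in auto)
    also have "K * (m * (2 * \<omega> x)) * (t - 0) \<le> K * (m * (2 * \<omega> x)) * T"
      using t K m \<omega>(2)[of x] by (intro mult_left_mono) auto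
    also have "\<dots> = T * K * (2 * (m * \<omega> x))" by simp
    also have "\<dots> \<le> 1 / 64 * (2 * (m * \<omega> x))"
      using smalls(1) m \<omega>(2)[of x] by (intro mult_right_mono) auto
    finally have "\<bar>prim T (g_along i t x) t\<bar> \<le> 1 / 64 * (2 * (m * \<omega> x))" using T by simp
    moreover have "0 \<le> m * \<omega> x" using m \<omega>(2)[of x] by simp
    moreover have "\<bar>U0 i (X i 0 t x)\<bar> \<le> 2 * \<omega> x" using U0[OF i] near order_trans by blast
    moreover have "(m / 2 + 2) * \<omega> x = (m * \<omega> x) / 2 + 2 * \<omega> x" by (simp add: algebra_simps)
    ultimately show "\<bar>U i t x\<bar> \<le> (m / 2 + 2) * \<omega> x" using U_eq[of i t x] by linarith
  qed simp
  then show ?thesis by simp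
qed

text \<open>In the derivative of the source, slopes of components in \<open>J\<close> enter with
  bounded coefficients, whereas slopes of the others, themselves at most \<open>\<omega>\<close>,
  enter with a coefficient of size \<open>\<omega>\<close>. Their product is bounded by
  \<open>A * \<theta>\<close>, so the weight \<open>\<theta>\<close> reproduces itself. The argument
  runs on difference quotients, as no integral equation for \<open>dxU\<close> is at hand.\<close>

lemma slope_decay:
  assumes \<theta>: "continuous_on UNIV \<theta>" "\<And>x. 0 < \<theta> x" "\<And>x y. \<bar>x - y\<bar> \<le> \<Lambda> * T \<Longrightarrow> \<theta> y \<le> 2 * \<theta> x"
    and \<omega>: "\<And>x. 0 \<le> \<omega> x" "\<And>x. \<omega> x \<le> C" "\<And>x. (\<omega> x)\<^sup>2 \<le> A * \<theta> x"
    and U_le: "\<And>j t x. j \<in> J \<Longrightarrow> t \<in> {0..T} \<Longrightarrow> \<bar>U j t x\<bar> \<le> \<omega> x"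
    and dxU_le: "\<And>j t x. j \<notin> J \<Longrightarrow> t \<in> {0..T} \<Longrightarrow> \<bar>dxU j t x\<bar> \<le> \<omega> x"
    and dxU0: "\<And>i x. i \<in> J \<Longrightarrow> \<bar>dxU i 0 x\<bar> \<le> \<theta> x"
    and g: "\<And>i W V b d r. i \<in> J \<Longrightarrow> 0 \<le> b \<Longrightarrow> (\<And>j. j \<in> J \<Longrightarrow> \<bar>W j\<bar> \<le> b) \<Longrightarrow>
      (\<And>j. j \<in> J \<Longrightarrow> \<bar>V j - W j\<bar> \<le> d) \<Longrightarrow> (\<And>j. j \<notin> J \<Longrightarrow> \<bar>V j - W j\<bar> \<le> r) \<Longrightarrow>
      \<bar>g i V - g i W\<bar> \<le> K * (d + b * r)"
    and i: "i \<in> J" and t: "t \<in> {0..T}"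
  shows "\<bar>dxU i t x\<bar> \<le> 2 * (4 + A) * \<theta> x"
proof -
  have A: "0 \<le> A"
    using order_trans[OF zero_le_power2 \<omega>(3)[of 0]] \<theta>(2)[of 0] by (simp add: zero_le_mult_iff)
  show ?thesis
  proof (rule cone_absorb[where J = J and f = dxU, OF _ \<theta>(1,2) _ _ i t])
    show "continuous_on ({0..T} \<times> UNIV) (\<lambda>(t, x). dxU i t x)" for i by (rule dxU_continuous)
    show "0 \<le> 4 + A" using A by simp
  next
    fix N m i t x
    assume m: "0 \<le> m" and b: "\<And>i t x. i \<in> J \<Longrightarrow> (t, x) \<in> cone N \<Longrightarrow> \<bar>dxU i t x\<bar> \<le> m * \<theta> x"
      and i: "i \<in> J" and tx: "(t, x) \<in> cone N"
    have t: "0 \<le> t" "t \<le> T" using tx by (auto simp: cone_def)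
    have near: "\<theta> (X i \<tau> t x) \<le> 2 * \<theta> x" for \<tau>
      using X_dist(2)[of i \<tau> t x] by (intro \<theta>(3)) (simp add: abs_minus_commute)
    have C: "0 \<le> C" using \<omega>(1,2) order_trans by blast
    have m\<theta>: "0 \<le> m * \<theta> x" using m \<theta>(2)[of x] by simp
    \<comment> \<open>Here \<open>e\<close> is the distance between slopes and difference quotients
      at a sufficiently small step. It occurs at the foot point, in the source and at the end point,
      also multiplied by \<open>\<omega> \<le> C\<close>; afterwards it tends to 0.\<close>
    have main: "\<bar>dxU i t x\<bar> \<le> (m / 2 + (4 + A)) * \<theta> x + e * (5 + 2 * C)" if e: "0 < e" for e
    proof -
      from Dq_near[OF e, of N] obtain \<eta> where \<eta>: "0 < \<eta>"
        "\<forall>i t x h. (t, x) \<in> cone N \<longrightarrow> 0 < \<bar>h\<bar> \<longrightarrow> \<bar>h\<bar> \<le> \<eta> \<longrightarrow> \<bar>Dq h i t x - dxU i t x\<bar> \<le> e" by blast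
      define h where "h = \<eta> / 2"
      have h: "0 < h" "h \<noteq> 0" using \<eta>(1) by (auto simp: h_def)
      let ?Z = "\<lambda>\<tau>. Zq h i \<tau> t x"
      have scaled: "0 < \<bar>h * ?Z \<tau>\<bar>" "\<bar>h * ?Z \<tau>\<bar> \<le> \<eta>" for \<tau>
      proof -
        have "\<bar>h * ?Z \<tau>\<bar> \<le> \<bar>h\<bar> * 2" unfolding abs_mult using Zq_le by (intro mult_left_mono) auto
        then show "\<bar>h * ?Z \<tau>\<bar> \<le> \<eta>" using h by (simp add: h_def)
        show "0 < \<bar>h * ?Z \<tau>\<bar>" using Zq_nonzero[OF h(2)] h by auto
      qed
      have E_le: "\<bar>Eq h i \<tau> t x j\<bar> \<le> 2 * (q + e)" if "\<tau> \<in> {0..t}" "\<bar>dxU j \<tau> (X i \<tau> t x)\<bar> \<le> q" for \<tau> j q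
      proof -
        have "\<bar>Dq (h * ?Z \<tau>) j \<tau> (X i \<tau> t x) - dxU j \<tau> (X i \<tau> t x)\<bar> \<le> e"
          using that(1) by (intro \<eta>(2)[rule_format] cone_X[OF tx] scaled) auto
        with that(2) have "\<bar>Dq (h * ?Z \<tau>) j \<tau> (X i \<tau> t x)\<bar> \<le> q + e" by linarith
        then show ?thesis
          unfolding Eq_eq[OF h(2) Zq_nonzero[OF h(2)]] abs_mult by (intro mult_mono Zq_le) auto
      qed
      have U_shift: "U j \<tau> (X i \<tau> t (x + h)) - U j \<tau> (X i \<tau> t x) = h * Eq h i \<tau> t x j" for j \<tau>
        using h by (simp add: Eq_def)
      have first: "\<bar>(U0 i (X i 0 t (x + h)) - U0 i (X i 0 t x)) / h\<bar> \<le> 2 * (2 * \<theta> x + e)"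
      proof -
        have "\<bar>Eq h i 0 t x i\<bar> \<le> 2 * (2 * \<theta> x + e)"
          using t order_trans[OF dxU0[OF i] near] by (intro E_le) auto
        then show ?thesis by (simp add: Eq_def U_initial)
      qed
      have q_le: "\<bar>(g_along i t (x + h) \<tau> - g_along i t x \<tau>) / h\<bar>
          \<le> K * (4 * m * \<theta> x + 4 * A * \<theta> x + 2 * e + 2 * C * e)" if \<tau>: "\<tau> \<in> {0..t}" for \<tau>
      proof -
        let ?w = "\<omega> (X i \<tau> t x)"
        have \<tau>T: "\<tau> \<in> {0..T}" using \<tau> t by auto
        have "\<bar>g_along i t (x + h) \<tau> - g_along i t x \<tau>\<bar>
            \<le> K * (h * (2 * (m * (2 * \<theta> x) + e)) + ?w * (h * (2 * (?w + e))))"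
        proof (rule g[OF i \<omega>(1)])
          show "\<bar>U j \<tau> (X i \<tau> t x)\<bar> \<le> ?w" if "j \<in> J" for j by (rule U_le[OF that \<tau>T])
        next
          fix j assume j: "j \<in> J"
          have "\<bar>dxU j \<tau> (X i \<tau> t x)\<bar> \<le> m * \<theta> (X i \<tau> t x)"
            using \<tau> by (intro b j cone_X[OF tx]) auto
          also have "\<dots> \<le> m * (2 * \<theta> x)" using m near by (intro mult_left_mono)
          finally show "\<bar>U j \<tau> (X i \<tau> t (x + h)) - U j \<tau> (X i \<tau> t x)\<bar> \<le> h * (2 * (m * (2 * \<theta> x) + e))"
            unfolding U_shift abs_mult using h \<tau> by (intro mult_mono E_le) auto
        next
          fix j assume j: "j \<notin> J"
          show "\<bar>U j \<tau> (X i \<tau> t (x + h)) - U j \<tau> (X i \<tau> t x)\<bar> \<le> h * (2 * (?w + e))"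
            unfolding U_shift abs_mult using h \<tau> dxU_le[OF j \<tau>T] by (intro mult_mono E_le) auto
        qed
        also have "\<dots> = K * h * (4 * m * \<theta> x + 2 * e + 2 * ?w\<^sup>2 + 2 * ?w * e)"
          by (simp add: algebra_simps power2_eq_square)
        also have "\<dots> \<le> K * h * (4 * m * \<theta> x + 4 * A * \<theta> x + 2 * e + 2 * C * e)"
        proof (rule mult_left_mono)
          have "A * \<theta> (X i \<tau> t x) \<le> A * (2 * \<theta> x)" using A near by (intro mult_left_mono)
          with \<omega>(3)[of "X i \<tau> t x"] have "?w\<^sup>2 \<le> 2 * A * \<theta> x" by simp
          moreover have "?w * e \<le> C * e" using \<omega>(2) e by (intro mult_right_mono) auto
          ultimately show "4 * m * \<theta> x + 2 * e + 2 * ?w\<^sup>2 + 2 * ?w * e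
              \<le> 4 * m * \<theta> x + 4 * A * \<theta> x + 2 * e + 2 * C * e" by linarith
        qed (use K h in auto)
        finally show ?thesis using h by (simp add: abs_divide pos_divide_le_eq ac_simps)
      qed
      let ?G = "prim T (\<lambda>\<tau>. (g_along i t (x + h) \<tau> - g_along i t x \<tau>) / h)"
      let ?q = "4 * m * \<theta> x + 4 * A * \<theta> x + 2 * e + 2 * C * e"
      have q0: "0 \<le> ?q" using m\<theta> A \<theta>(2)[of x] C e by (simp add: mult.assoc)
      have "\<bar>?G t - ?G 0\<bar> \<le> K * ?q * (t - 0)"
        using t h q_le by (intro prim_diff_le_between continuous_intros along_continuous) auto
      also have "\<dots> \<le> K * ?q * T" using t K q0 by (intro mult_left_mono) auto
      also have "\<dots> = T * K * ?q" by simp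
      also have "\<dots> \<le> 1 / 64 * ?q" using smalls(1) q0 by (intro mult_right_mono)
      finally have "\<bar>?G t\<bar> \<le> 1 / 64 * ?q" using T by simp
      with first Dq_eq[OF h(2), of i t x]
      have "\<bar>Dq h i t x\<bar> \<le> 2 * (2 * \<theta> x + e) + 1 / 64 * ?q" by linarith
      moreover have "\<bar>Dq h i t x - dxU i t x\<bar> \<le> e"
        using h by (intro \<eta>(2)[rule_format] tx) (auto simp: h_def)
      ultimately have "\<bar>dxU i t x\<bar> \<le> 2 * (2 * \<theta> x + e) + 1 / 64 * ?q + e" by linarith
      also have "2 * (2 * \<theta> x + e) + 1 / 64 * ?q + e \<le> (m / 2 + (4 + A)) * \<theta> x + e * (5 + 2 * C)"
      proof -
        have "0 \<le> A * \<theta> x" "0 \<le> C * e" using A \<theta>(2)[of x] C e by auto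
        with e m\<theta> show ?thesis by (simp add: algebra_simps)
      qed
      finally show ?thesis .
    qed
    show "\<bar>dxU i t x\<bar> \<le> (m / 2 + (4 + A)) * \<theta> x"
    proof (rule field_le_epsilon)
      fix e :: real assume "0 < e"
      then show "\<bar>dxU i t x\<bar> \<le> (m / 2 + (4 + A)) * \<theta> x + e"
        using main[of "e / (5 + 2 * C)"] C by simp
    qed
  qed
qed

end


section \<open>Uniformly differentiable coefficients\<close>

text \<open>The bound \<open>B\<close> and the Lipschitz constant \<open>K\<close> hold for all
  states and are carried explicitly, because the existence time is computed from them.
  Differentiability is only qualitative and only on \<open>Q\<close>, so that coefficients cut off
  outside a range qualify.\<close>

definition tame :: "('i \<Rightarrow> real) set \<Rightarrow> real \<Rightarrow> real \<Rightarrow> (('i \<Rightarrow> real) \<Rightarrow> real) \<Rightarrow> bool" where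
  "tame Q B K f \<longleftrightarrow> 0 \<le> B \<and> 0 \<le> K \<and> (\<forall>U. \<bar>f U\<bar> \<le> B) \<and>
     (\<forall>U V d. (\<forall>j. \<bar>U j - V j\<bar> \<le> d) \<longrightarrow> \<bar>f U - f V\<bar> \<le> K * d) \<and>
     (\<forall>q. \<exists>D. \<forall>e>0. \<exists>\<delta>>0. \<forall>U E h. U \<in> Q \<longrightarrow> (\<forall>j. \<bar>E j\<bar> \<le> q) \<longrightarrow> 0 < \<bar>h\<bar> \<longrightarrow> \<bar>h\<bar> \<le> \<delta> \<longrightarrow>
        \<bar>(f (\<lambda>j. U j + h * E j) - f U) / h - D U E\<bar> \<le> e)"

lemma tameI:
  assumes "0 \<le> B" "0 \<le> K" "\<And>U. \<bar>f U\<bar> \<le> B"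
    and "\<And>U V d. (\<And>j. \<bar>U j - V j\<bar> \<le> d) \<Longrightarrow> \<bar>f U - f V\<bar> \<le> K * d"
    and "\<And>q. \<exists>D. \<forall>e>0. \<exists>\<delta>>0. \<forall>U E h. U \<in> Q \<longrightarrow> (\<forall>j. \<bar>E j\<bar> \<le> q) \<longrightarrow> 0 < \<bar>h\<bar> \<longrightarrow> \<bar>h\<bar> \<le> \<delta> \<longrightarrow>
        \<bar>(f (\<lambda>j. U j + h * E j) - f U) / h - D U E\<bar> \<le> e"
  shows "tame Q B K f"
  unfolding tame_def using assms by blast

lemma tame_nonneg: "tame Q B K f \<Longrightarrow> 0 \<le> B" "tame Q B K f \<Longrightarrow> 0 \<le> K"
  by (auto simp: tame_def)

lemma tame_le: "tame Q B K f \<Longrightarrow> \<bar>f U\<bar> \<le> B"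
  by (auto simp: tame_def)

lemma tame_lip: "tame Q B K f \<Longrightarrow> (\<And>j. \<bar>U j - V j\<bar> \<le> d) \<Longrightarrow> \<bar>f U - f V\<bar> \<le> K * d"
  unfolding tame_def by blast

lemma tame_deriv: "tame Q B K f \<Longrightarrow> \<exists>D. \<forall>e>0. \<exists>\<delta>>0. \<forall>U E h. U \<in> Q \<longrightarrow> (\<forall>j. \<bar>E j\<bar> \<le> q) \<longrightarrow> 0 < \<bar>h\<bar> \<longrightarrow> \<bar>h\<bar> \<le> \<delta> \<longrightarrow>
        \<bar>(f (\<lambda>j. U j + h * E j) - f U) / h - D U E\<bar> \<le> e"
  unfolding tame_def by blast

lemma tame_mono:
  assumes "tame Q B K f" "B \<le> B'" "K \<le> K'"
  shows "tame Q B' K' f"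
proof (rule tameI)
  show "0 \<le> B'" "0 \<le> K'" using tame_nonneg[OF assms(1)] assms by auto
  show "\<bar>f U\<bar> \<le> B'" for U using tame_le[OF assms(1), of U] assms by linarith
  show "\<bar>f U - f V\<bar> \<le> K' * d" if "\<And>j. \<bar>U j - V j\<bar> \<le> d" for U V d
  proof -
    have "0 \<le> d" using that[of undefined] by linarith
    then have "K * d \<le> K' * d" using assms by (intro mult_right_mono)
    with tame_lip[OF assms(1), of U V d, OF that] show ?thesis by linarith
  qed
  show "\<exists>D. \<forall>e>0. \<exists>\<delta>>0. \<forall>U E h. U \<in> Q \<longrightarrow> (\<forall>j. \<bar>E j\<bar> \<le> q) \<longrightarrow> 0 < \<bar>h\<bar> \<longrightarrow> \<bar>h\<bar> \<le> \<delta> \<longrightarrow>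
        \<bar>(f (\<lambda>j. U j + h * E j) - f U) / h - D U E\<bar> \<le> e" for q by (rule tame_deriv[OF assms(1)])
qed

lemma tame_const: "tame Q \<bar>c\<bar> 0 (\<lambda>U. c)"
  by (rule tameI) (auto intro!: exI[of _ "\<lambda>_ _. 0"] exI[of _ "1 :: real"])

lemma tame_add:
  assumes f: "tame Q B K f" and g: "tame Q B' K' g"
  shows "tame Q (B + B') (K + K') (\<lambda>U. f U + g U)"
proof (rule tameI)
  show "0 \<le> B + B'" "0 \<le> K + K'" using tame_nonneg[OF f] tame_nonneg[OF g] by auto
  show "\<bar>f U + g U\<bar> \<le> B + B'" for U using tame_le[OF f, of U] tame_le[OF g, of U] by linarith
  show "\<bar>f U + g U - (f V + g V)\<bar> \<le> (K + K') * d" if "\<And>j. \<bar>U j - V j\<bar> \<le> d" for U V d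
    using tame_lip[OF f, of U V d, OF that] tame_lip[OF g, of U V d, OF that] unfolding distrib_right by linarith
  fix q :: real
  from tame_deriv[OF f, of q] obtain D where D: "\<forall>e>0. \<exists>\<delta>>0. \<forall>U E h. U \<in> Q \<longrightarrow> (\<forall>j. \<bar>E j\<bar> \<le> q) \<longrightarrow> 0 < \<bar>h\<bar> \<longrightarrow> \<bar>h\<bar> \<le> \<delta> \<longrightarrow>
        \<bar>(f (\<lambda>j. U j + h * E j) - f U) / h - D U E\<bar> \<le> e" by blast
  from tame_deriv[OF g, of q] obtain D' where D': "\<forall>e>0. \<exists>\<delta>>0. \<forall>U E h. U \<in> Q \<longrightarrow> (\<forall>j. \<bar>E j\<bar> \<le> q) \<longrightarrow> 0 < \<bar>h\<bar> \<longrightarrow> \<bar>h\<bar> \<le> \<delta> \<longrightarrow>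
        \<bar>(g (\<lambda>j. U j + h * E j) - g U) / h - D' U E\<bar> \<le> e" by blast
  show "\<exists>D. \<forall>e>0. \<exists>\<delta>>0. \<forall>U E h. U \<in> Q \<longrightarrow> (\<forall>j. \<bar>E j\<bar> \<le> q) \<longrightarrow> 0 < \<bar>h\<bar> \<longrightarrow> \<bar>h\<bar> \<le> \<delta> \<longrightarrow>
        \<bar>(f (\<lambda>j. U j + h * E j) + g (\<lambda>j. U j + h * E j) - (f U + g U)) / h - D U E\<bar> \<le> e"
  proof (intro exI[of _ "\<lambda>U E. D U E + D' U E"] allI impI)
    fix e :: real assume "0 < e"
    then have e2: "0 < e / 2" by simp
    from D[rule_format, OF e2] obtain \<delta> where \<delta>: "\<delta> > 0" "\<forall>U E h. U \<in> Q \<longrightarrow> (\<forall>j. \<bar>E j\<bar> \<le> q) \<longrightarrow> 0 < \<bar>h\<bar> \<longrightarrow> \<bar>h\<bar> \<le> \<delta> \<longrightarrow>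
        \<bar>(f (\<lambda>j. U j + h * E j) - f U) / h - D U E\<bar> \<le> e / 2" by blast
    from D'[rule_format, OF e2] obtain \<delta>' where \<delta>': "\<delta>' > 0" "\<forall>U E h. U \<in> Q \<longrightarrow> (\<forall>j. \<bar>E j\<bar> \<le> q) \<longrightarrow> 0 < \<bar>h\<bar> \<longrightarrow> \<bar>h\<bar> \<le> \<delta>' \<longrightarrow>
        \<bar>(g (\<lambda>j. U j + h * E j) - g U) / h - D' U E\<bar> \<le> e / 2" by blast
    have "\<bar>(f (\<lambda>j. U j + h * E j) + g (\<lambda>j. U j + h * E j) - (f U + g U)) / h - (D U E + D' U E)\<bar> \<le> e"
      if U: "U \<in> Q" "\<forall>j. \<bar>E j\<bar> \<le> q" "0 < \<bar>h\<bar>" and h: "\<bar>h\<bar> \<le> min \<delta> \<delta>'" for U E h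
    proof -
      have eq: "(f (\<lambda>j. U j + h * E j) + g (\<lambda>j. U j + h * E j) - (f U + g U)) / h
          = (f (\<lambda>j. U j + h * E j) - f U) / h + (g (\<lambda>j. U j + h * E j) - g U) / h"
        by (simp add: diff_divide_distrib add_divide_distrib)
      have "\<bar>(f (\<lambda>j. U j + h * E j) - f U) / h - D U E\<bar> \<le> e / 2"
        using \<delta>(2)[rule_format, OF U(1) U(2)[rule_format] U(3)] h by simp
      moreover have "\<bar>(g (\<lambda>j. U j + h * E j) - g U) / h - D' U E\<bar> \<le> e / 2"
        using \<delta>'(2)[rule_format, OF U(1) U(2)[rule_format] U(3)] h by simp
      ultimately show ?thesis unfolding eq by linarith
    qed
    then show "\<exists>\<delta>>0. \<forall>U E h. U \<in> Q \<longrightarrow> (\<forall>j. \<bar>E j\<bar> \<le> q) \<longrightarrow> 0 < \<bar>h\<bar> \<longrightarrow> \<bar>h\<bar> \<le> \<delta> \<longrightarrow>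
        \<bar>(f (\<lambda>j. U j + h * E j) + g (\<lambda>j. U j + h * E j) - (f U + g U)) / h - (D U E + D' U E)\<bar> \<le> e"
      using \<delta>(1) \<delta>'(1) by (intro exI[of _ "min \<delta> \<delta>'"]) simp
  qed
qed

text \<open>The product rule with its remainder: besides the two derivative errors there is the
  quotient of f times the increment of g, which is of order \<open>h\<close> by the two Lipschitz
  bounds.\<close>

lemma tame_mult:
  assumes f: "tame Q B K f" and g: "tame Q B' K' g"
  shows "tame Q (B * B') (B * K' + K * B') (\<lambda>U. f U * g U)"
proof (rule tameI)
  note nonneg = tame_nonneg[OF f] tame_nonneg[OF g]
  show "0 \<le> B * B'" "0 \<le> B * K' + K * B'" using nonneg by auto
  show "\<bar>f U * g U\<bar> \<le> B * B'" for U
    unfolding abs_mult using nonneg by (intro mult_mono tame_le[OF f] tame_le[OF g]) auto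
  show "\<bar>f U * g U - f V * g V\<bar> \<le> (B * K' + K * B') * d" if d: "\<And>j. \<bar>U j - V j\<bar> \<le> d" for U V d
  proof -
    have d0: "0 \<le> d" using d[of undefined] by linarith
    have "\<bar>f U\<bar> * \<bar>g U - g V\<bar> \<le> B * (K' * d)"
      using nonneg by (intro mult_mono tame_le[OF f] tame_lip[OF g, of U V d, OF d]) auto
    moreover have "\<bar>f U - f V\<bar> * \<bar>g V\<bar> \<le> K * d * B'"
      using nonneg d0 by (intro mult_mono tame_le[OF g] tame_lip[OF f, of U V d, OF d]) auto
    moreover have "(B * K' + K * B') * d = B * (K' * d) + K * d * B'" by (simp add: algebra_simps)
    ultimately show ?thesis using abs_mult_diff_le[of "f U" "g U" "f V" "g V"] by linarith
  qed
  fix q :: real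
  \<comment> \<open>For negative \<open>q\<close> the condition on \<open>E\<close> is void, but the
    constants below need a nonnegative number.\<close>
  define q' where "q' = \<bar>q\<bar>"
  from tame_deriv[OF f, of q] obtain D where D: "\<forall>e>0. \<exists>\<delta>>0. \<forall>U E h. U \<in> Q \<longrightarrow> (\<forall>j. \<bar>E j\<bar> \<le> q) \<longrightarrow> 0 < \<bar>h\<bar> \<longrightarrow> \<bar>h\<bar> \<le> \<delta> \<longrightarrow>
        \<bar>(f (\<lambda>j. U j + h * E j) - f U) / h - D U E\<bar> \<le> e" by blast
  from tame_deriv[OF g, of q] obtain D' where D': "\<forall>e>0. \<exists>\<delta>>0. \<forall>U E h. U \<in> Q \<longrightarrow> (\<forall>j. \<bar>E j\<bar> \<le> q) \<longrightarrow> 0 < \<bar>h\<bar> \<longrightarrow> \<bar>h\<bar> \<le> \<delta> \<longrightarrow>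
        \<bar>(g (\<lambda>j. U j + h * E j) - g U) / h - D' U E\<bar> \<le> e" by blast
  show "\<exists>D. \<forall>e>0. \<exists>\<delta>>0. \<forall>U E h. U \<in> Q \<longrightarrow> (\<forall>j. \<bar>E j\<bar> \<le> q) \<longrightarrow> 0 < \<bar>h\<bar> \<longrightarrow> \<bar>h\<bar> \<le> \<delta> \<longrightarrow>
        \<bar>(f (\<lambda>j. U j + h * E j) * g (\<lambda>j. U j + h * E j) - f U * g U) / h - D U E\<bar> \<le> e"
  proof (intro exI[of _ "\<lambda>U E. D U E * g U + f U * D' U E"] allI impI)
    fix e :: real assume e: "0 < e"
    define c where "c = e / (2 * (1 + B + B'))"
    have "0 < 1 + B + B'" using nonneg by linarith
    then have c: "0 < c" "c * (1 + B + B') = e / 2"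
      using e unfolding c_def by (auto simp: field_simps)
    \<comment> \<open>The step size at which the second-order remainder
      \<open>\<bar>h\<bar> * (K * q' * (K' * q'))\<close> drops below \<open>e / 2\<close>; the
      added 1 keeps the denominator positive.\<close>
    define k where "k = e / (2 * (1 + K * q' * (K' * q')))"
    have pos: "0 \<le> K * q' * (K' * q')" using nonneg by (simp add: q'_def)
    have half: "e / (2 * z) * z = e / 2" if "0 < z" for z using that by simp
    have z: "0 < 1 + K * q' * (K' * q')" using add_pos_nonneg[OF zero_less_one pos] .
    have k: "0 < k" "k * (1 + K * q' * (K' * q')) = e / 2"
      unfolding k_def using half[OF z] e z by simp_all
    from D[rule_format, OF c(1)] obtain \<delta> where \<delta>: "\<delta> > 0" "\<forall>U E h. U \<in> Q \<longrightarrow> (\<forall>j. \<bar>E j\<bar> \<le> q) \<longrightarrow> 0 < \<bar>h\<bar> \<longrightarrow> \<bar>h\<bar> \<le> \<delta> \<longrightarrow>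
        \<bar>(f (\<lambda>j. U j + h * E j) - f U) / h - D U E\<bar> \<le> c" by blast
    from D'[rule_format, OF c(1)] obtain \<delta>' where \<delta>': "\<delta>' > 0" "\<forall>U E h. U \<in> Q \<longrightarrow> (\<forall>j. \<bar>E j\<bar> \<le> q) \<longrightarrow> 0 < \<bar>h\<bar> \<longrightarrow> \<bar>h\<bar> \<le> \<delta>' \<longrightarrow>
        \<bar>(g (\<lambda>j. U j + h * E j) - g U) / h - D' U E\<bar> \<le> c" by blast
    have "\<bar>(f (\<lambda>j. U j + h * E j) * g (\<lambda>j. U j + h * E j) - f U * g U) / h - (D U E * g U + f U * D' U E)\<bar> \<le> e"
      if U: "U \<in> Q" "\<forall>j. \<bar>E j\<bar> \<le> q" "0 < \<bar>h\<bar>" and h: "\<bar>h\<bar> \<le> min k (min \<delta> \<delta>')" for U E h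
    proof -
      let ?f = "f (\<lambda>j. U j + h * E j)" and ?g = "g (\<lambda>j. U j + h * E j)"
      have hE: "\<bar>U j + h * E j - U j\<bar> \<le> \<bar>h\<bar> * q'" for j
      proof -
        have "\<bar>E j\<bar> \<le> q'" using U(2)[rule_format, of j] by (simp add: q'_def)
        then show ?thesis by (simp add: abs_mult mult_left_mono)
      qed
      have 1: "\<bar>(?f - f U) / h\<bar> \<le> K * q'"
        using tame_lip[OF f, of "\<lambda>j. U j + h * E j" U, OF hE] U(3) by (simp add: abs_divide pos_divide_le_eq ac_simps)
      have 2: "\<bar>?g - g U\<bar> \<le> K' * (\<bar>h\<bar> * q')" by (rule tame_lip[OF g, of "\<lambda>j. U j + h * E j" U, OF hE])
      have 3: "\<bar>(?f - f U) / h - D U E\<bar> \<le> c"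
        using \<delta>(2)[rule_format, OF U(1) U(2)[rule_format] U(3)] h by simp
      have 4: "\<bar>(?g - g U) / h - D' U E\<bar> \<le> c"
        using \<delta>'(2)[rule_format, OF U(1) U(2)[rule_format] U(3)] h by simp
      have eq: "(?f * ?g - f U * g U) / h - (D U E * g U + f U * D' U E)
          = (?f - f U) / h * (?g - g U) + ((?f - f U) / h - D U E) * g U + f U * ((?g - g U) / h - D' U E)"
        using U(3) by (simp add: field_simps)
      have "\<bar>(?f - f U) / h * (?g - g U)\<bar> \<le> K * q' * (K' * (\<bar>h\<bar> * q'))"
        unfolding abs_mult using nonneg by (intro mult_mono 1 2) (auto simp: q'_def)
      also have "\<dots> = \<bar>h\<bar> * (K * q' * (K' * q'))" by (simp add: ac_simps)
      also have "\<dots> \<le> k * (K * q' * (K' * q'))" using h pos by (intro mult_right_mono) auto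
      also have "\<dots> \<le> e / 2" using k by (simp add: algebra_simps)
      finally have a: "\<bar>(?f - f U) / h * (?g - g U)\<bar> \<le> e / 2" .
      have b: "\<bar>((?f - f U) / h - D U E) * g U\<bar> \<le> c * B'"
        unfolding abs_mult using c by (intro mult_mono 3 tame_le[OF g]) auto
      have d: "\<bar>f U * ((?g - g U) / h - D' U E)\<bar> \<le> B * c"
        unfolding abs_mult using nonneg by (intro mult_mono 4 tame_le[OF f]) auto
      have cB: "c * B' + B * c \<le> e / 2" using c by (simp add: algebra_simps)
      have "\<bar>x + y + z\<bar> \<le> e" if "\<bar>x\<bar> \<le> e / 2" "\<bar>y\<bar> \<le> c * B'" "\<bar>z\<bar> \<le> B * c" for x y z
        using that cB by linarith
      from this[OF a b d] show ?thesis unfolding eq .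
    qed
    then show "\<exists>\<delta>>0. \<forall>U E h. U \<in> Q \<longrightarrow> (\<forall>j. \<bar>E j\<bar> \<le> q) \<longrightarrow> 0 < \<bar>h\<bar> \<longrightarrow> \<bar>h\<bar> \<le> \<delta> \<longrightarrow>
        \<bar>(f (\<lambda>j. U j + h * E j) * g (\<lambda>j. U j + h * E j) - f U * g U) / h - (D U E * g U + f U * D' U E)\<bar> \<le> e"
      using \<delta>(1) \<delta>'(1) k(1) by (intro exI[of _ "min k (min \<delta> \<delta>')"]) simp
  qed
qed

lemma tame_diff:
  assumes "tame Q B K f" "tame Q B' K' g"
  shows "tame Q (B + B') (K + K') (\<lambda>U. f U - g U)"
  using tame_add[OF assms(1) tame_mult[OF tame_const[of Q "-1"] assms(2)]] by simp

text \<open>The mean value theorem reduces the error to the oscillation of \<open>\<phi>'\<close>.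
  The margin \<open>r\<close> keeps the intermediate points in the compact interval on which
  \<open>\<phi>'\<close> is uniformly continuous.\<close>

lemma uniform_difference_quotient:
  fixes \<phi> :: "real \<Rightarrow> real"
  assumes r: "0 < r" and d: "\<And>x. x \<in> {A - r..B + r} \<Longrightarrow> (\<phi> has_real_derivative \<phi>' x) (at x)"
    and c: "continuous_on {A - r..B + r} \<phi>'" and e: "0 < e"
  shows "\<exists>\<delta>>0. \<forall>x y h. x \<in> {A..B} \<longrightarrow> \<bar>y\<bar> \<le> q \<longrightarrow> 0 < \<bar>h\<bar> \<longrightarrow> \<bar>h\<bar> \<le> \<delta> \<longrightarrow>
    \<bar>(\<phi> (x + h * y) - \<phi> x) / h - \<phi>' x * y\<bar> \<le> e"
proof -
  define p where "p = \<bar>q\<bar> + 1"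
  have p: "0 < p" by (simp add: p_def add_nonneg_pos)
  have "uniformly_continuous_on {A - r..B + r} \<phi>'"
    using c by (rule compact_uniformly_continuous) simp
  moreover have "0 < e / p" using e p by simp
  ultimately obtain \<delta> where \<delta>: "0 < \<delta>" "\<And>x y. x \<in> {A - r..B + r} \<Longrightarrow> y \<in> {A - r..B + r} \<Longrightarrow> dist y x < \<delta>
      \<Longrightarrow> dist (\<phi>' y) (\<phi>' x) < e / p"
    unfolding uniformly_continuous_on_def by metis
  define \<delta>' where "\<delta>' = min (\<delta> / 2) r / p"
  have \<delta>': "0 < \<delta>'" using \<delta>(1) r p by (simp add: \<delta>'_def)
  have "\<bar>(\<phi> (x + h * y) - \<phi> x) / h - \<phi>' x * y\<bar> \<le> e"
    if x: "x \<in> {A..B}" and y: "\<bar>y\<bar> \<le> q" and h: "0 < \<bar>h\<bar>" "\<bar>h\<bar> \<le> \<delta>'" for x y h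
  proof -
    have yp: "\<bar>y\<bar> \<le> p" using y by (simp add: p_def)
    have "\<bar>h * y\<bar> \<le> \<delta>' * p" unfolding abs_mult using h yp \<delta>' by (intro mult_mono) auto
    then have hy: "\<bar>h * y\<bar> \<le> r" "\<bar>h * y\<bar> < \<delta>" using p \<delta>(1) by (auto simp: \<delta>'_def)
    have mem: "z \<in> {A - r..B + r}" if "\<bar>z - x\<bar> \<le> \<bar>h * y\<bar>" for z using that hy x by (auto simp: abs_le_iff)
    have "\<exists>z. \<bar>z - x\<bar> \<le> \<bar>h * y\<bar> \<and> \<phi> (x + h * y) - \<phi> x = \<phi>' z * (h * y)"
    proof -
      consider "0 < h * y" | "h * y < 0" | "h * y = 0" by linarith
      then show ?thesis
      proof cases
        case 1
        have "\<exists>z>x. z < x + h * y \<and> \<phi> (x + h * y) - \<phi> x = (x + h * y - x) * \<phi>' z"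
          using 1 by (intro MVT2 d mem) auto
        then obtain z where "x < z" "z < x + h * y" "\<phi> (x + h * y) - \<phi> x = (h * y) * \<phi>' z" by auto
        with 1 show ?thesis by (intro exI[of _ z]) (auto simp: mult.commute)
      next
        case 2
        have "\<exists>z>x + h * y. z < x \<and> \<phi> x - \<phi> (x + h * y) = (x - (x + h * y)) * \<phi>' z"
          using 2 by (intro MVT2 d mem) auto
        then obtain z where "x + h * y < z" "z < x" "\<phi> x - \<phi> (x + h * y) = - (h * y) * \<phi>' z" by auto
        with 2 show ?thesis by (intro exI[of _ z]) (auto simp: algebra_simps)
      next
        case 3 then show ?thesis by (intro exI[of _ x]) auto
      qed
    qed
    then obtain z where z: "\<bar>z - x\<bar> \<le> \<bar>h * y\<bar>" "\<phi> (x + h * y) - \<phi> x = \<phi>' z * (h * y)" by blast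
    have "dist (\<phi>' z) (\<phi>' x) < e / p"
      using z hy by (intro \<delta>(2) mem) (auto simp: dist_real_def)
    then have "\<bar>\<phi>' z - \<phi>' x\<bar> * \<bar>y\<bar> \<le> e / p * p"
      using yp by (intro mult_mono) (auto simp: dist_real_def)
    moreover have "(\<phi> (x + h * y) - \<phi> x) / h - \<phi>' x * y = (\<phi>' z - \<phi>' x) * y"
      using h by (simp add: z(2) algebra_simps)
    ultimately show ?thesis using p by (simp add: abs_mult)
  qed
  with \<delta>' show ?thesis by blast
qed

text \<open>Size and Lipschitz constant are global, while a derivative is required only within
  \<open>r\<close> of the range of the component on \<open>Q\<close>. Functions with clamped
  arguments meet this although they have corners farther out.\<close>

lemma tame_scalar:
  assumes "0 \<le> B" "0 \<le> K" "\<And>x. \<bar>\<phi> x\<bar> \<le> B" "\<And>x y. \<bar>\<phi> x - \<phi> y\<bar> \<le> K * \<bar>x - y\<bar>"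
    and r: "0 < r" and d: "\<And>x. x \<in> {b - r..c + r} \<Longrightarrow> (\<phi> has_real_derivative \<phi>' x) (at x)"
    and cont: "continuous_on {b - r..c + r} \<phi>'" and Q: "\<And>U. U \<in> Q \<Longrightarrow> U k \<in> {b..c}"
  shows "tame Q B K (\<lambda>U. \<phi> (U k))"
proof (rule tameI)
  show "\<bar>\<phi> (U k) - \<phi> (V k)\<bar> \<le> K * d" if "\<And>j. \<bar>U j - V j\<bar> \<le> d" for U V d
    using assms(4)[of "U k" "V k"] mult_left_mono[OF that[of k] assms(2)] by linarith
  show "\<exists>D. \<forall>e>0. \<exists>\<delta>>0. \<forall>U E h. U \<in> Q \<longrightarrow> (\<forall>j. \<bar>E j\<bar> \<le> q) \<longrightarrow> 0 < \<bar>h\<bar> \<longrightarrow> \<bar>h\<bar> \<le> \<delta> \<longrightarrow>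
        \<bar>(\<phi> (U k + h * E k) - \<phi> (U k)) / h - D U E\<bar> \<le> e" for q
  proof (intro exI[of _ "\<lambda>U E. \<phi>' (U k) * E k"] allI impI)
    fix e :: real assume "0 < e"
    from uniform_difference_quotient[OF r d cont this, of q] obtain \<delta> where \<delta>: "0 < \<delta>"
      "\<forall>x y h. x \<in> {b..c} \<longrightarrow> \<bar>y\<bar> \<le> q \<longrightarrow> 0 < \<bar>h\<bar> \<longrightarrow> \<bar>h\<bar> \<le> \<delta> \<longrightarrow>
        \<bar>(\<phi> (x + h * y) - \<phi> x) / h - \<phi>' x * y\<bar> \<le> e" by blast
    then show "\<exists>\<delta>>0. \<forall>U E h. U \<in> Q \<longrightarrow> (\<forall>j. \<bar>E j\<bar> \<le> q) \<longrightarrow> 0 < \<bar>h\<bar> \<longrightarrow> \<bar>h\<bar> \<le> \<delta> \<longrightarrow>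
        \<bar>(\<phi> (U k + h * E k) - \<phi> (U k)) / h - \<phi>' (U k) * E k\<bar> \<le> e"
      using Q by blast
  qed
qed (use assms in auto)

lemma tame_two_quotients:
  assumes "tame Q B K f" "0 < e"
  shows "\<exists>\<delta>>0. \<forall>U E h k. U \<in> Q \<longrightarrow> (\<forall>j. \<bar>E j\<bar> \<le> q) \<longrightarrow> 0 < \<bar>h\<bar> \<longrightarrow> \<bar>h\<bar> \<le> \<delta> \<longrightarrow> 0 < \<bar>k\<bar> \<longrightarrow> \<bar>k\<bar> \<le> \<delta> \<longrightarrow>
    \<bar>(f (\<lambda>j. U j + h * E j) - f U) / h - (f (\<lambda>j. U j + k * E j) - f U) / k\<bar> \<le> e"
proof -
  have e2: "0 < e / 2" using assms by simp
  from tame_deriv[OF assms(1), of q] obtain D where "\<forall>e>0. \<exists>\<delta>>0. \<forall>U E h. U \<in> Q \<longrightarrow> (\<forall>j. \<bar>E j\<bar> \<le> q) \<longrightarrow> 0 < \<bar>h\<bar> \<longrightarrow> \<bar>h\<bar> \<le> \<delta> \<longrightarrow>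
        \<bar>(f (\<lambda>j. U j + h * E j) - f U) / h - D U E\<bar> \<le> e" by blast
  from this[rule_format, OF e2] obtain \<delta> where \<delta>: "\<delta> > 0" "\<forall>U E h. U \<in> Q \<longrightarrow> (\<forall>j. \<bar>E j\<bar> \<le> q) \<longrightarrow> 0 < \<bar>h\<bar> \<longrightarrow> \<bar>h\<bar> \<le> \<delta> \<longrightarrow>
        \<bar>(f (\<lambda>j. U j + h * E j) - f U) / h - D U E\<bar> \<le> e / 2" by blast
  have "\<bar>(f (\<lambda>j. U j + h * E j) - f U) / h - (f (\<lambda>j. U j + k * E j) - f U) / k\<bar> \<le> e"
    if "U \<in> Q" "\<forall>j. \<bar>E j\<bar> \<le> q" "0 < \<bar>h\<bar>" "\<bar>h\<bar> \<le> \<delta>" "0 < \<bar>k\<bar>" "\<bar>k\<bar> \<le> \<delta>" for U E h k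
  proof -
    have "\<bar>(f (\<lambda>j. U j + h * E j) - f U) / h - D U E\<bar> \<le> e / 2"
      "\<bar>(f (\<lambda>j. U j + k * E j) - f U) / k - D U E\<bar> \<le> e / 2"
      using \<delta>(2) that by blast+
    then show ?thesis by linarith
  qed
  with \<delta>(1) show ?thesis by blast
qed


text \<open>A version of Schwarz's theorem in which \<open>fx\<close> is not assumed differentiable
  in time: write \<open>f\<close> as its initial value plus the integral of \<open>ft\<close>,
  differentiate under the integral sign, and apply the fundamental theorem of calculus.\<close>

lemma dt_dx_swap:
  fixes f :: "real \<Rightarrow> real \<Rightarrow> real"
  assumes ft: "\<And>t x. t \<in> {0..T} \<Longrightarrow> ((\<lambda>s. f s x) has_real_derivative ft t x) (at t within {0..T})"
    and fx: "\<And>t x. t \<in> {0..T} \<Longrightarrow> ((\<lambda>y. f t y) has_real_derivative fx t x) (at x)"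
    and ftx: "\<And>t x. t \<in> {0..T} \<Longrightarrow> ((\<lambda>y. ft t y) has_real_derivative ftx t x) (at x)"
    and c: "continuous_on ({0..T} \<times> UNIV) (\<lambda>(t, x). ft t x)"
      "continuous_on ({0..T} \<times> UNIV) (\<lambda>(t, x). ftx t x)"
    and t: "t \<in> {0..T}"
  shows "((\<lambda>s. fx s x) has_real_derivative ftx t x) (at t within {0..T})"
proof -
  have slice: "continuous_on {0..T} (\<lambda>s. h s y)" if "continuous_on ({0..T} \<times> UNIV) (\<lambda>(t, x). h t x)"
    for h :: "real \<Rightarrow> real \<Rightarrow> real" and y
    using continuous_on_compose2[OF that, of "{0..T}" "\<lambda>s. (s, y)"] by (simp add: continuous_intros image_subset_iff)
  have eq: "fx t x = fx 0 x + integral {0..t} (\<lambda>s. ftx s x)" if t: "t \<in> {0..T}" for t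
  proof -
    have sub: "{0..t} \<subseteq> {0..T}" "0 \<in> {0..T}" using t by auto
    have ftc: "f t y = f 0 y + integral {0..t} (\<lambda>s. ft s y)" for y
    proof -
      have "((\<lambda>s. ft s y) has_integral (f t y - f 0 y)) {0..t}"
      proof (rule fundamental_theorem_of_calculus)
        fix s assume "s \<in> {0..t}"
        then have "s \<in> {0..T}" using sub by auto
        from has_field_derivative_subset[OF ft[OF this] sub(1)]
        show "((\<lambda>s. f s y) has_vector_derivative ft s y) (at s within {0..t})"
          by (simp add: has_real_derivative_iff_has_vector_derivative)
      qed (use t in auto)
      then show ?thesis by (simp add: integral_unique)
    qed
    have "((\<lambda>y. integral (cbox 0 t) (\<lambda>s. ft s y)) has_field_derivative integral (cbox 0 t) (\<lambda>s. ftx s x)) (at x within UNIV)"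
    proof (rule leibniz_rule_field_derivative[where f = "\<lambda>y s. ft s y" and fx = "\<lambda>y s. ftx s y"])
      show "((\<lambda>y. ft s y) has_field_derivative ftx s y) (at y within UNIV)" if "s \<in> cbox 0 t" for s y
        using ftx[of s y] sub(1) that by auto
      show "(\<lambda>s. ft s y) integrable_on cbox 0 t" for y
        using continuous_on_subset[OF slice[OF c(1)] sub(1)] by (simp add: integrable_continuous_real)
      have "continuous_on (UNIV \<times> {0..t}) (\<lambda>p. (\<lambda>(t, x). ftx t x) (snd p, fst p))"
        by (rule continuous_on_compose2[OF c(2)]) (use sub(1) in \<open>auto intro!: continuous_intros\<close>)
      then show "continuous_on (UNIV \<times> cbox 0 t) (\<lambda>(y, s). ftx s y)" by (simp add: case_prod_beta)
    qed auto
    then have "((\<lambda>y. f 0 y + integral {0..t} (\<lambda>s. ft s y)) has_real_derivative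
        fx 0 x + integral {0..t} (\<lambda>s. ftx s x)) (at x)"
      using DERIV_add[OF fx[OF sub(2)]] by simp
    then have "((\<lambda>y. f t y) has_real_derivative fx 0 x + integral {0..t} (\<lambda>s. ftx s x)) (at x)"
      by (simp add: ftc[symmetric])
    from DERIV_unique[OF fx[OF t] this] show ?thesis .
  qed
  have "((\<lambda>u. integral {0..u} (\<lambda>s. ftx s x)) has_vector_derivative ftx t x) (at t within {0..T})"
    using slice[OF c(2)] t by (rule integral_has_vector_derivative)
  then have "((\<lambda>u. fx 0 x + integral {0..u} (\<lambda>s. ftx s x)) has_real_derivative ftx t x) (at t within {0..T})"
    using DERIV_add[OF DERIV_const[of "fx 0 x"], of _ "ftx t x"]
    by (simp add: has_real_derivative_iff_has_vector_derivative[symmetric])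
  then show ?thesis
    by (rule has_field_derivative_transform_within[OF _ zero_less_one t]) (rule eq[symmetric])
qed

section \<open>The diagonal system of the wave equation, with clamped coefficients\<close>

definition clamp_abs :: "real \<Rightarrow> real \<Rightarrow> real" where
  "clamp_abs m x = max (- m) (min m x)"

lemma clamp_abs_le: "0 \<le> m \<Longrightarrow> \<bar>clamp_abs m x\<bar> \<le> m"
  by (auto simp: clamp_abs_def)

lemma clamp_abs_le_abs: "0 \<le> m \<Longrightarrow> \<bar>clamp_abs m x\<bar> \<le> \<bar>x\<bar>"
  by (auto simp: clamp_abs_def)

lemma clamp_abs_lip: "\<bar>clamp_abs m x - clamp_abs m y\<bar> \<le> \<bar>x - y\<bar>"
  by (auto simp: clamp_abs_def max_def min_def)

lemma clamp_abs_id: "\<bar>x\<bar> \<le> m \<Longrightarrow> clamp_abs m x = x"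
  by (auto simp: clamp_abs_def)

lemma clamp_abs_deriv:
  assumes "(f has_real_derivative d) (at x)" "\<bar>x\<bar> < m"
  shows "((\<lambda>x. f (clamp_abs m x)) has_real_derivative d) (at x)"
  by (rule has_field_derivative_transform_within_open[OF assms(1), of "{-m<..<m}"])
    (use assms(2) in \<open>auto simp: clamp_abs_id\<close>)

text \<open>The components are \<open>ln (u / u\<^sub>0)\<close>, \<open>ln u\<close>, \<open>(u\<^sub>t + u\<^sup>a u\<^sub>x) / u\<close> and
  \<open>(u\<^sub>t - u\<^sup>a u\<^sub>x) / u\<close>, as functions of \<open>t\<close> and of the coordinate \<open>y\<close> with \<open>dy = u\<^sub>0\<^sup>-\<^sup>a dx\<close>.
  \<open>Disp\<close> and \<open>Logu\<close> differ by a function of \<open>y\<close>; keeping both makes the system autonomous with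
  bounded speeds. The clamps are inactive along the solution.\<close>

datatype wave_component = Disp | Logu | Rinv | Sinv

lemma UNIV_wave_component: "UNIV = {Disp, Logu, Rinv, Sinv}"
proof -
  have "x \<in> {Disp, Logu, Rinv, Sinv}" for x by (cases x) auto
  then show ?thesis by blast
qed

instance wave_component :: finite
  by standard (simp add: UNIV_wave_component)

text \<open>Bounds on \<open>\<psi>\<close> are required on a half line: ln u is bounded above in
  terms of the given constants, but it has no lower bound, since u may tend to 0 at
  infinity.\<close>

locale wave_system =
  fixes a b Vm P P' :: real and \<psi> \<psi>' :: "real \<Rightarrow> real"
  assumes a: "0 \<le> a" and b: "1 \<le> b" and P: "0 \<le> P" "0 \<le> P'"
    and \<psi>_le: "\<And>v. v \<le> Vm \<Longrightarrow> \<bar>\<psi> v\<bar> \<le> P"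
    and \<psi>_lip: "\<And>v w. v \<le> Vm \<Longrightarrow> w \<le> Vm \<Longrightarrow> \<bar>\<psi> v - \<psi> w\<bar> \<le> P' * \<bar>v - w\<bar>"
    and \<psi>_deriv: "\<And>v. v < Vm \<Longrightarrow> (\<psi> has_real_derivative \<psi>' v) (at v)"
    and \<psi>'_cont: "continuous_on {..<Vm} \<psi>'"
begin

definition speed :: "wave_component \<Rightarrow> (wave_component \<Rightarrow> real) \<Rightarrow> real" where
  "speed i U = (case i of Rinv \<Rightarrow> - exp (a * clamp_abs 1 (U Disp))
     | Sinv \<Rightarrow> exp (a * clamp_abs 1 (U Disp)) | _ \<Rightarrow> 0)"

text \<open>The terms have separate origins: the one with \<open>a / 2\<close> comes from
  differentiating the variable speed u^a, the one with \<open>p\<close> from F(u) u_x, and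
  \<open>- r * s\<close> from dividing R or S by u.\<close>

definition source :: "wave_component \<Rightarrow> (wave_component \<Rightarrow> real) \<Rightarrow> real" where
  "source i U = (let r = clamp_abs b (U Rinv); s = clamp_abs b (U Sinv); p = \<psi> (min Vm (U Logu)) in
     case i of Rinv \<Rightarrow> a / 2 * ((r - s) * r) + p * (r - s) - r * s
     | Sinv \<Rightarrow> a / 2 * ((s - r) * s) + p * (r - s) - r * s
     | _ \<Rightarrow> 1 / 2 * (r + s))"

text \<open>A sum that dominates the Lipschitz constant of every coefficient:
  \<open>a * exp a\<close> belongs to the speeds, \<open>1\<close> to the mean of r and s, and
  \<open>2 * P'\<close> to \<open>source_diff\<close>, where r - s is measured by the decaying bound
  and not by the clamp \<open>b\<close>.\<close>

definition lip :: real where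
  "lip = a * exp a + 2 * a * b + 2 * P + 2 * P' * b + 2 * b + 2 * P' + 1"

definition bnd :: real where
  "bnd = a * b\<^sup>2 + 2 * P * b + b\<^sup>2 + b"

lemma lip_parts: "0 \<le> a * exp a" "0 \<le> a * b" "0 \<le> P' * b" "0 \<le> P * b" "0 \<le> a * b\<^sup>2" "0 \<le> b\<^sup>2"
  using a b P by auto

lemma lip_nonneg: "0 \<le> lip"
  using lip_parts P b by (simp add: lip_def)

text \<open>States at distance at least 1/2 from every clamp, hence away from the corners. The lower
  bound \<open>c\<close> provides the compactness needed for uniform differentiability; it does not
  influence the bounds and Lipschitz constants, so it does not influence the time either.\<close>

definition core_states :: "real \<Rightarrow> (wave_component \<Rightarrow> real) set" where
  "core_states c = {U. \<bar>U Disp\<bar> \<le> 1/2 \<and> c \<le> U Logu \<and> U Logu \<le> Vm - 1/2 \<and>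
     \<bar>U Rinv\<bar> \<le> b - 1/2 \<and> \<bar>U Sinv\<bar> \<le> b - 1/2}"


lemma tame_clamp:
  assumes "k = Rinv \<or> k = Sinv"
  shows "tame (core_states c) b 1 (\<lambda>U. clamp_abs b (U k))"
proof (rule tame_scalar[where r = "1/4" and b = "- (b - 1/2)" and c = "b - 1/2" and \<phi>' = "\<lambda>_. 1"])
  show "(clamp_abs b has_real_derivative 1) (at x)" if "x \<in> {- (b - 1/2) - 1/4..b - 1/2 + 1/4}" for x
    using clamp_abs_deriv[OF DERIV_ident, of x b] that by (auto simp: abs_less_iff)
  show "U k \<in> {- (b - 1/2)..b - 1/2}" if "U \<in> core_states c" for U
    using that assms by (auto simp: core_states_def abs_le_iff)
qed (use b in \<open>auto simp: clamp_abs_le intro: order_trans[OF clamp_abs_lip]\<close>)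

lemma exp_clamp_lip: "\<bar>exp (a * clamp_abs 1 x) - exp (a * clamp_abs 1 y)\<bar> \<le> a * exp a * \<bar>x - y\<bar>"
proof -
  have le: "\<bar>exp p - exp q\<bar> \<le> exp a * \<bar>p - q\<bar>" if "p \<le> a" "q \<le> a" for p q :: real
  proof -
    have "exp s - exp r \<le> exp a * (s - r)" if "r \<le> s" "s \<le> a" for r s :: real
    proof (cases "r = s")
      case False
      with that have "r < s" by simp
      from MVT2[OF this, of exp exp] obtain z where z: "r < z" "z < s" "exp s - exp r = (s - r) * exp z"
        by (auto intro: DERIV_exp)
      have "(s - r) * exp z \<le> (s - r) * exp a" using z that by (intro mult_left_mono) auto
      with z show ?thesis by (simp add: mult.commute)
    qed simp
    from this[of p q] this[of q p] that show ?thesis by (cases "p \<le> q") auto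
  qed
  have cl: "a * clamp_abs 1 x \<le> a" for x
  proof -
    have "a * clamp_abs 1 x \<le> a * 1" using a by (intro mult_left_mono) (auto simp: clamp_abs_def)
    then show ?thesis by simp
  qed
  have "\<bar>a * clamp_abs 1 x - a * clamp_abs 1 y\<bar> \<le> a * \<bar>x - y\<bar>"
    using a clamp_abs_lip[of 1 x y] by (simp add: right_diff_distrib[symmetric] abs_mult mult_left_mono)
  then have "exp a * \<bar>a * clamp_abs 1 x - a * clamp_abs 1 y\<bar> \<le> exp a * (a * \<bar>x - y\<bar>)"
    by (intro mult_left_mono) auto
  moreover have "exp a * (a * \<bar>x - y\<bar>) = a * exp a * \<bar>x - y\<bar>" by simp
  ultimately show ?thesis using le[OF cl cl, of x y] by linarith
qed

lemma tame_exp_clamp: "tame (core_states c) (exp a) (a * exp a) (\<lambda>U. exp (a * clamp_abs 1 (U Disp)))"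
proof (rule tame_scalar[where r = "1/4" and b = "- 1/2" and c = "1/2" and \<phi>' = "\<lambda>x. exp (a * x) * a"])
  show "\<bar>exp (a * clamp_abs 1 x)\<bar> \<le> exp a" for x
  proof -
    have "a * clamp_abs 1 x \<le> a * 1" using a by (intro mult_left_mono) (auto simp: clamp_abs_def)
    then show ?thesis by simp
  qed
  show "((\<lambda>x. exp (a * clamp_abs 1 x)) has_real_derivative exp (a * x) * a) (at x)"
    if "x \<in> {- 1/2 - 1/4..1/2 + 1/4}" for x
    by (rule clamp_abs_deriv[where f = "\<lambda>x. exp (a * x)"])
      (use that in \<open>auto intro!: derivative_eq_intros\<close>)
qed (use lip_parts exp_clamp_lip in \<open>auto simp: core_states_def abs_le_iff intro!: continuous_intros\<close>)

lemma tame_\<psi>: "tame (core_states c) P P' (\<lambda>U. \<psi> (min Vm (U Logu)))"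
proof (rule tame_scalar[where r = "1/4" and b = c and c = "Vm - 1/2" and \<phi>' = \<psi>'])
  show "\<bar>\<psi> (min Vm x) - \<psi> (min Vm y)\<bar> \<le> P' * \<bar>x - y\<bar>" for x y
  proof -
    have "\<bar>min Vm x - min Vm y\<bar> \<le> \<bar>x - y\<bar>" by (auto simp: min_def)
    then have "P' * \<bar>min Vm x - min Vm y\<bar> \<le> P' * \<bar>x - y\<bar>" using P by (intro mult_left_mono)
    with \<psi>_lip[of "min Vm x" "min Vm y"] show ?thesis by simp
  qed
  show "((\<lambda>x. \<psi> (min Vm x)) has_real_derivative \<psi>' x) (at x)" if "x \<in> {c - 1/4..Vm - 1/2 + 1/4}" for x
    by (rule has_field_derivative_transform_within_open[OF \<psi>_deriv, of _ "{..<Vm}"])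
      (use that in auto)
  show "continuous_on {c - 1/4..Vm - 1/2 + 1/4} \<psi>'"
    by (rule continuous_on_subset[OF \<psi>'_cont]) auto
qed (use P \<psi>_le in \<open>auto simp: core_states_def\<close>)

lemma tame_zero: "tame Q 0 0 (\<lambda>U. 0)"
  using tame_const[of Q 0] by simp

lemma tame_speed: "tame (core_states c) (exp a) lip (speed i)"
proof -
  have le: "a * exp a \<le> lip" using lip_parts P b by (simp add: lip_def)
  have "tame (core_states c) (exp a) lip (\<lambda>U. exp (a * clamp_abs 1 (U Disp)))"
    by (rule tame_mono[OF tame_exp_clamp]) (use le in auto)
  moreover from tame_diff[OF tame_zero this]
  have "tame (core_states c) (exp a) lip (\<lambda>U. - exp (a * clamp_abs 1 (U Disp)))" by simp
  moreover have "tame (core_states c) (exp a) lip (\<lambda>U. 0)"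
    by (rule tame_mono[OF tame_zero]) (use lip_nonneg in auto)
  ultimately show ?thesis by (cases i) (simp_all add: speed_def[abs_def])
qed

lemma tame_source: "tame (core_states c) bnd lip (source i)"
proof -
  let ?r = "\<lambda>U. clamp_abs b (U Rinv)" and ?s = "\<lambda>U. clamp_abs b (U Sinv)" and ?p = "\<lambda>U. \<psi> (min Vm (U Logu))"
  have r: "tame (core_states c) b 1 ?r" and s: "tame (core_states c) b 1 ?s" by (auto intro: tame_clamp)
  note rs = tame_diff[OF r s] and sr = tame_diff[OF s r]
  note p = tame_mult[OF tame_\<psi> rs] and m = tame_mult[OF r s]
  note R = tame_diff[OF tame_add[OF tame_mult[OF tame_const[of _ "a / 2"] tame_mult[OF rs r]] p] m]
  note S = tame_diff[OF tame_add[OF tame_mult[OF tame_const[of _ "a / 2"] tame_mult[OF sr s]] p] m]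
  note V = tame_mult[OF tame_const[of _ "1 / 2"] tame_add[OF r s]]
  show ?thesis
  proof (cases i)
    case Rinv
    show ?thesis unfolding Rinv source_def[abs_def] Let_def wave_component.case
      by (rule tame_mono[OF R]) (use a b P lip_parts in \<open>auto simp: lip_def bnd_def power2_eq_square algebra_simps\<close>)
  next
    case Sinv
    show ?thesis unfolding Sinv source_def[abs_def] Let_def wave_component.case
      by (rule tame_mono[OF S]) (use a b P lip_parts in \<open>auto simp: lip_def bnd_def power2_eq_square algebra_simps\<close>)
  next
    case Disp
    show ?thesis unfolding Disp source_def[abs_def] Let_def wave_component.case
      by (rule tame_mono[OF V]) (use a b P lip_parts in \<open>auto simp: lip_def bnd_def power2_eq_square algebra_simps\<close>)
  next
    case Logu
    show ?thesis unfolding Logu source_def[abs_def] Let_def wave_component.case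
      by (rule tame_mono[OF V]) (use a b P lip_parts in \<open>auto simp: lip_def bnd_def power2_eq_square algebra_simps\<close>)
  qed
qed


text \<open>Each term contains a factor r or s, which clamping does not enlarge; any remaining
  factor is bounded by \<open>b\<close> or \<open>P\<close>.\<close>

lemma source_homogeneous:
  assumes i: "i \<in> {Rinv, Sinv}" and c: "\<And>j. j \<in> {Rinv, Sinv} \<Longrightarrow> \<bar>U j\<bar> \<le> c"
  shows "\<bar>source i U\<bar> \<le> lip * c"
proof -
  have b0: "0 \<le> b" using b by simp
  define r where "r = clamp_abs b (U Rinv)"
  define s where "s = clamp_abs b (U Sinv)"
  define p where "p = \<psi> (min Vm (U Logu))"
  have rs: "\<bar>r\<bar> \<le> c" "\<bar>s\<bar> \<le> c" "\<bar>r\<bar> \<le> b" "\<bar>s\<bar> \<le> b" "\<bar>p\<bar> \<le> P"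
    using order_trans[OF clamp_abs_le_abs[OF b0] c[of Rinv]] order_trans[OF clamp_abs_le_abs[OF b0] c[of Sinv]]
      clamp_abs_le[OF b0] \<psi>_le unfolding r_def s_def p_def by simp_all
  have c0: "0 \<le> c" using rs(1) by linarith
  have q: "\<bar>(x - y) * x\<bar> \<le> 2 * c * b" if "\<bar>x\<bar> \<le> c" "\<bar>y\<bar> \<le> c" "\<bar>x\<bar> \<le> b" for x y
    unfolding abs_mult using that b0 by (intro mult_mono) auto
  have q1: "\<bar>a / 2 * ((x - y) * x)\<bar> \<le> a / 2 * (2 * c * b)" if "\<bar>x\<bar> \<le> c" "\<bar>y\<bar> \<le> c" "\<bar>x\<bar> \<le> b" for x y
    unfolding abs_mult[of "a / 2"] using mult_left_mono[OF q[OF that], of "a / 2"] a by simp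
  have q2: "\<bar>p * (r - s)\<bar> \<le> P * (2 * c)"
    unfolding abs_mult using rs P by (intro mult_mono) auto
  have q3: "\<bar>r * s\<bar> \<le> c * b"
    unfolding abs_mult using rs c0 by (intro mult_mono) auto
  have tot: "a / 2 * (2 * c * b) + P * (2 * c) + c * b \<le> lip * c"
  proof -
    have "0 \<le> a * exp a * c" "0 \<le> a * b * c" "0 \<le> P' * b * c" "0 \<le> b * c" "0 \<le> P' * c" "0 \<le> P * c"
      using lip_parts c0 b0 P by auto
    then show ?thesis using c0 by (simp add: lip_def algebra_simps)
  qed
  have tri: "\<bar>x + y - z\<bar> \<le> lip * c"
    if "\<bar>x\<bar> \<le> a / 2 * (2 * c * b)" "\<bar>y\<bar> \<le> P * (2 * c)" "\<bar>z\<bar> \<le> c * b" for x y z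
    using that tot by linarith
  from i show ?thesis
    using tri[OF q1[OF rs(1,2,3)] q2 q3] tri[OF q1[OF rs(2,1,4)] q2 q3]
    by (auto simp: source_def Let_def r_def s_def p_def)
qed

text \<open>Outside the pair r, s the source depends only on \<open>Logu\<close>, through
  \<open>\<psi>\<close>, and there \<open>\<psi>\<close> is multiplied by r - s. This is why a
  change \<open>e\<close> of the other components enters only with the factor
  \<open>c\<close>.\<close>

lemma source_diff:
  assumes i: "i \<in> {Rinv, Sinv}" and c: "0 \<le> c" "\<And>j. j \<in> {Rinv, Sinv} \<Longrightarrow> \<bar>W j\<bar> \<le> c"
    and d: "\<And>j. j \<in> {Rinv, Sinv} \<Longrightarrow> \<bar>V j - W j\<bar> \<le> d" and e: "\<And>j. j \<notin> {Rinv, Sinv} \<Longrightarrow> \<bar>V j - W j\<bar> \<le> e"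
  shows "\<bar>source i V - source i W\<bar> \<le> lip * (d + c * e)"
proof -
  have b0: "0 \<le> b" using b by simp
  define r where "r = clamp_abs b (W Rinv)"
  define s where "s = clamp_abs b (W Sinv)"
  define p where "p = \<psi> (min Vm (W Logu))"
  define r' where "r' = clamp_abs b (V Rinv)"
  define s' where "s' = clamp_abs b (V Sinv)"
  define p' where "p' = \<psi> (min Vm (V Logu))"
  have bd: "\<bar>r\<bar> \<le> c" "\<bar>s\<bar> \<le> c" "\<bar>r\<bar> \<le> b" "\<bar>s\<bar> \<le> b" "\<bar>r'\<bar> \<le> b" "\<bar>s'\<bar> \<le> b" "\<bar>p'\<bar> \<le> P"
    "\<bar>r' - r\<bar> \<le> d" "\<bar>s' - s\<bar> \<le> d"
    using order_trans[OF clamp_abs_le_abs[OF b0] c(2)[of Rinv]] order_trans[OF clamp_abs_le_abs[OF b0] c(2)[of Sinv]]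
      order_trans[OF clamp_abs_lip d[of Rinv]] order_trans[OF clamp_abs_lip d[of Sinv]] clamp_abs_le[OF b0] \<psi>_le
    unfolding r_def s_def r'_def s'_def p'_def by simp_all
  have d0: "0 \<le> d" using bd(8) by linarith
  have e0: "0 \<le> e" using e[of Logu] by auto
  have pe: "\<bar>p' - p\<bar> \<le> P' * e"
  proof -
    have "\<bar>min Vm (V Logu) - min Vm (W Logu)\<bar> \<le> e" using e[of Logu] by (auto simp: min_def)
    then have "P' * \<bar>min Vm (V Logu) - min Vm (W Logu)\<bar> \<le> P' * e" using P by (intro mult_left_mono)
    with \<psi>_lip[of "min Vm (V Logu)" "min Vm (W Logu)"] show ?thesis unfolding p_def p'_def by simp
  qed
  have q: "\<bar>(x' - y') * x' - (x - y) * x\<bar> \<le> 4 * b * d"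
    if "\<bar>x' - x\<bar> \<le> d" "\<bar>y' - y\<bar> \<le> d" "\<bar>x\<bar> \<le> b" "\<bar>x'\<bar> \<le> b" "\<bar>y'\<bar> \<le> b" for x y x' y'
  proof -
    have "\<bar>x' - y'\<bar> * \<bar>x' - x\<bar> \<le> (2 * b) * d" using that b0 by (intro mult_mono) auto
    moreover have "\<bar>(x' - y') - (x - y)\<bar> * \<bar>x\<bar> \<le> (2 * d) * b" using that d0 by (intro mult_mono) auto
    ultimately show ?thesis using abs_mult_diff_le[of "x' - y'" x' "x - y" x] by (simp add: algebra_simps)
  qed
  have q1: "\<bar>a / 2 * ((x' - y') * x') - a / 2 * ((x - y) * x)\<bar> \<le> a / 2 * (4 * b * d)"
    if "\<bar>x' - x\<bar> \<le> d" "\<bar>y' - y\<bar> \<le> d" "\<bar>x\<bar> \<le> b" "\<bar>x'\<bar> \<le> b" "\<bar>y'\<bar> \<le> b" for x y x' y'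
    unfolding right_diff_distrib[of "a / 2", symmetric] abs_mult[of "a / 2"]
    using mult_left_mono[OF q[OF that], of "a / 2"] a by simp
  have q2: "\<bar>p' * (r' - s') - p * (r - s)\<bar> \<le> P * (2 * d) + P' * e * (2 * c)"
  proof -
    have "\<bar>(r' - s') - (r - s)\<bar> \<le> 2 * d" "\<bar>r - s\<bar> \<le> 2 * c" using bd(1,2,8,9) by linarith+
    then have "\<bar>p'\<bar> * \<bar>(r' - s') - (r - s)\<bar> \<le> P * (2 * d)" "\<bar>p' - p\<bar> * \<bar>r - s\<bar> \<le> P' * e * (2 * c)"
      using bd(7) pe P e0 by (auto intro!: mult_mono)
    then show ?thesis using abs_mult_diff_le[of p' "r' - s'" p "r - s"] by linarith
  qed
  have q3: "\<bar>r' * s' - r * s\<bar> \<le> b * d + d * b"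
  proof -
    have "\<bar>r'\<bar> * \<bar>s' - s\<bar> \<le> b * d" "\<bar>r' - r\<bar> * \<bar>s\<bar> \<le> d * b" using bd b0 d0 by (auto intro!: mult_mono)
    then show ?thesis using abs_mult_diff_le[of r' s' r s] by linarith
  qed
  have tot: "a / 2 * (4 * b * d) + (P * (2 * d) + P' * e * (2 * c)) + (b * d + d * b) \<le> lip * (d + c * e)"
  proof -
    have ce: "0 \<le> c * e" using c e0 by simp
    have "0 \<le> a * exp a * d" "0 \<le> P' * b * d" "0 \<le> P' * d"
      "0 \<le> a * exp a * (c * e)" "0 \<le> a * b * (c * e)" "0 \<le> P' * b * (c * e)" "0 \<le> b * (c * e)" "0 \<le> P * (c * e)"
      using lip_parts d0 b0 P ce by (auto simp: mult_nonneg_nonneg)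
    then show ?thesis using d0 ce by (simp add: lip_def algebra_simps)
  qed
  have tri: "\<bar>(x' + y' - z') - (x + y - z)\<bar> \<le> lip * (d + c * e)"
    if "\<bar>x' - x\<bar> \<le> a / 2 * (4 * b * d)" "\<bar>y' - y\<bar> \<le> P * (2 * d) + P' * e * (2 * c)" "\<bar>z' - z\<bar> \<le> b * d + d * b"
    for x y z x' y' z' using that tot by linarith
  from i show ?thesis
    using tri[OF q1[OF bd(8,9,3,5,6)] q2 q3] tri[OF q1[OF bd(9,8,4,6,5)] q2 q3]
    by (auto simp: source_def Let_def r_def s_def p_def r'_def s'_def p'_def)
qed

end


text \<open>The data keep distance 1 from the clamps, and the last smallness condition on
  \<open>T\<close> says that no component moves by more than 1/2; the solution thus stays in
  \<open>core_states\<close> and the clamps have no effect on it. \<open>compat0\<close> is the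
  relation between v_y and the ratios at time 0, when the speed is 1.\<close>

locale wave_data = wave_system a b Vm P P' \<psi> \<psi>'
  for a b Vm P P' :: real and \<psi> \<psi>' :: "real \<Rightarrow> real" +
  fixes U0 U0' :: "wave_component \<Rightarrow> real \<Rightarrow> real" and M T :: real
  assumes U0_deriv: "\<And>i x. (U0 i has_real_derivative U0' i x) (at x)"
    and U0'_cont: "\<And>i. continuous_on UNIV (U0' i)"
    and U0'_le: "\<And>i x. \<bar>U0' i x\<bar> \<le> M"
    and U0_Disp: "\<And>x. U0 Disp x = 0" and U0_Logu: "\<And>x. U0 Logu x \<le> Vm - 1"
    and U0_inv: "\<And>x. \<bar>U0 Rinv x\<bar> \<le> b - 1" "\<And>x. \<bar>U0 Sinv x\<bar> \<le> b - 1"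
    and compat0: "\<And>x. U0' Logu x = (U0 Rinv x - U0 Sinv x) / 2"
    and T_pos: "0 < T" "T \<le> 1" and T_small: "T * lip * (1 + M)\<^sup>2 \<le> 1 / 64" "T * (M * exp a + bnd) \<le> 1 / 2"
begin

lemma M_nonneg: "0 \<le> M"
  using U0'_le[of Disp 0] by linarith

lemma U0_lipschitz: "\<bar>U0 i x - U0 i y\<bar> \<le> M * \<bar>x - y\<bar>"
proof -
  from mvt_between[OF U0_deriv] obtain z where "U0 i x - U0 i y = U0' i z * (x - y)" by blast
  then show ?thesis using U0'_le[of i z] by (simp add: abs_mult mult_right_mono)
qed

lemma near_data_core:
  assumes x: "\<bar>x\<bar> \<le> N" and W: "\<And>j. \<bar>W j - U0 j x\<bar> \<le> T * (M * exp a + bnd)"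
  shows "W \<in> core_states (U0 Logu 0 - M * N - 1/2)"
proof -
  have W': "\<bar>W j - U0 j x\<bar> \<le> 1/2" for j using W[of j] T_small(2) by linarith
  have "M * \<bar>x\<bar> \<le> M * N" using x M_nonneg by (intro mult_left_mono)
  with U0_lipschitz[of Logu x 0] have "U0 Logu 0 - M * N \<le> U0 Logu x" by simp
  with W'[of Disp] W'[of Logu] W'[of Rinv] W'[of Sinv] U0_Disp[of x] U0_Logu[of x] U0_inv[of x]
  show ?thesis unfolding core_states_def mem_Collect_eq by (intro conjI) linarith+
qed

lemma uniform_over_components:
  assumes "\<And>i :: wave_component. \<exists>\<delta>>0. \<forall>p::'p. \<forall>h k :: real. Q p \<longrightarrow> 0 < \<bar>h\<bar> \<longrightarrow> \<bar>h\<bar> \<le> \<delta> \<longrightarrow> 0 < \<bar>k\<bar> \<longrightarrow> \<bar>k\<bar> \<le> \<delta> \<longrightarrow> R i p h k"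
  shows "\<exists>\<delta>>0. \<forall>i p h k. Q p \<longrightarrow> 0 < \<bar>h\<bar> \<longrightarrow> \<bar>h\<bar> \<le> \<delta> \<longrightarrow> 0 < \<bar>k\<bar> \<longrightarrow> \<bar>k\<bar> \<le> \<delta> \<longrightarrow> R i p h k"
proof -
  from assms obtain \<delta> where \<delta>: "\<And>i. 0 < \<delta> i"
    "\<And>i p h k. Q p \<Longrightarrow> 0 < \<bar>h\<bar> \<Longrightarrow> \<bar>h\<bar> \<le> \<delta> i \<Longrightarrow> 0 < \<bar>k\<bar> \<Longrightarrow> \<bar>k\<bar> \<le> \<delta> i \<Longrightarrow> R i p h k" by metis
  have "0 < Min (range \<delta>)" using \<delta>(1) by simp
  moreover have "Min (range \<delta>) \<le> \<delta> i" for i by simp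
  ultimately show ?thesis using \<delta>(2) order_trans by (intro exI[of _ "Min (range \<delta>)"]) blast
qed

sublocale smooth_system speed source U0 lip M "exp a" bnd T
proof
  show "0 < T" "T \<le> 1" by (fact T_pos)+
  show "0 \<le> lip" by (rule lip_nonneg)
  show "0 \<le> M" by (rule M_nonneg)
  show "\<bar>speed i W\<bar> \<le> exp a" for i W by (rule tame_le[OF tame_speed])
  show "\<bar>source i W\<bar> \<le> bnd" for i W by (rule tame_le[OF tame_source])
  show "\<bar>speed i W - speed i V\<bar> \<le> lip * d" if "\<And>j. \<bar>W j - V j\<bar> \<le> d" for i W V d
    by (rule tame_lip[OF tame_speed that])
  show "\<bar>source i W - source i V\<bar> \<le> lip * d" if "\<And>j. \<bar>W j - V j\<bar> \<le> d" for i W V d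
    by (rule tame_lip[OF tame_source that])
  show "\<bar>U0 i x - U0 i y\<bar> \<le> M * \<bar>x - y\<bar>" for i x y by (rule U0_lipschitz)
  show "T * lip * (1 + M)\<^sup>2 \<le> 1 / 64" by (rule T_small)
next
  fix N e :: real assume e: "0 < e"
  have "\<exists>\<delta>>0. \<forall>i x h k. \<bar>x\<bar> \<le> N \<longrightarrow> 0 < \<bar>h\<bar> \<longrightarrow> \<bar>h\<bar> \<le> \<delta> \<longrightarrow> 0 < \<bar>k\<bar> \<longrightarrow> \<bar>k\<bar> \<le> \<delta> \<longrightarrow>
      \<bar>(U0 i (x + h) - U0 i x) / h - (U0 i (x + k) - U0 i x) / k\<bar> \<le> e"
  proof (rule uniform_over_components)
    fix i
    have "\<exists>\<delta>>0. \<forall>x y h. x \<in> {-N..N} \<longrightarrow> \<bar>y\<bar> \<le> 1 \<longrightarrow> 0 < \<bar>h\<bar> \<longrightarrow> \<bar>h\<bar> \<le> \<delta> \<longrightarrow>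
        \<bar>(U0 i (x + h * y) - U0 i x) / h - U0' i x * y\<bar> \<le> e / 2"
      by (rule uniform_difference_quotient[where r = 1])
        (use e in \<open>auto intro: U0_deriv continuous_on_subset[OF U0'_cont]\<close>)
    then obtain \<delta> where \<delta>: "0 < \<delta>" "\<forall>x y h. x \<in> {-N..N} \<longrightarrow> \<bar>y\<bar> \<le> 1 \<longrightarrow> 0 < \<bar>h\<bar> \<longrightarrow> \<bar>h\<bar> \<le> \<delta> \<longrightarrow>
        \<bar>(U0 i (x + h * y) - U0 i x) / h - U0' i x * y\<bar> \<le> e / 2" by blast
    have q: "\<bar>(U0 i (x + h) - U0 i x) / h - U0' i x\<bar> \<le> e / 2" if "\<bar>x\<bar> \<le> N" "0 < \<bar>h\<bar>" "\<bar>h\<bar> \<le> \<delta>" for x h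
      using \<delta>(2)[rule_format, of x 1 h] that by (simp add: abs_le_iff)
    have "\<bar>(U0 i (x + h) - U0 i x) / h - (U0 i (x + k) - U0 i x) / k\<bar> \<le> e"
      if "\<bar>x\<bar> \<le> N" "0 < \<bar>h\<bar>" "\<bar>h\<bar> \<le> \<delta>" "0 < \<bar>k\<bar>" "\<bar>k\<bar> \<le> \<delta>" for x h k
      using q[OF that(1-3)] q[OF that(1,4,5)] by linarith
    with \<delta>(1) show "\<exists>\<delta>>0. \<forall>x h k. \<bar>x\<bar> \<le> N \<longrightarrow> 0 < \<bar>h\<bar> \<longrightarrow> \<bar>h\<bar> \<le> \<delta> \<longrightarrow> 0 < \<bar>k\<bar> \<longrightarrow> \<bar>k\<bar> \<le> \<delta> \<longrightarrow>
      \<bar>(U0 i (x + h) - U0 i x) / h - (U0 i (x + k) - U0 i x) / k\<bar> \<le> e" by blast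
  qed
  then show "\<exists>\<delta>>0. \<forall>i x h k. \<bar>x\<bar> \<le> N \<longrightarrow> 0 < \<bar>h\<bar> \<longrightarrow> \<bar>h\<bar> \<le> \<delta> \<longrightarrow> 0 < \<bar>k\<bar> \<longrightarrow> \<bar>k\<bar> \<le> \<delta> \<longrightarrow>
      \<bar>(U0 i (x + h) - U0 i x) / h - (U0 i (x + k) - U0 i x) / k\<bar> \<le> e" .
next
  fix N q e :: real assume e: "0 < e"
  let ?C = "core_states (U0 Logu 0 - M * N - 1/2)"
  have two: "\<exists>\<delta>>0. \<forall>i x W E h k. \<bar>x\<bar> \<le> N \<longrightarrow> (\<forall>j. \<bar>W j - U0 j x\<bar> \<le> T * (M * exp a + bnd)) \<longrightarrow> (\<forall>j. \<bar>E j\<bar> \<le> q) \<longrightarrow>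
      0 < \<bar>h\<bar> \<longrightarrow> \<bar>h\<bar> \<le> \<delta> \<longrightarrow> 0 < \<bar>k\<bar> \<longrightarrow> \<bar>k\<bar> \<le> \<delta> \<longrightarrow>
      \<bar>(f i (\<lambda>j. W j + h * E j) - f i W) / h - (f i (\<lambda>j. W j + k * E j) - f i W) / k\<bar> \<le> e"
    if "\<And>i. tame ?C B lip (f i)" for f :: "wave_component \<Rightarrow> (wave_component \<Rightarrow> real) \<Rightarrow> real" and B
  proof -
    have "\<exists>\<delta>>0. \<forall>i p h k. (fst p \<in> ?C \<and> (\<forall>j. \<bar>snd p j\<bar> \<le> q)) \<longrightarrow> 0 < \<bar>h\<bar> \<longrightarrow> \<bar>h\<bar> \<le> \<delta> \<longrightarrow> 0 < \<bar>k\<bar> \<longrightarrow> \<bar>k\<bar> \<le> \<delta> \<longrightarrow>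
      \<bar>(f i (\<lambda>j. fst p j + h * snd p j) - f i (fst p)) / h - (f i (\<lambda>j. fst p j + k * snd p j) - f i (fst p)) / k\<bar> \<le> e"
    proof (rule uniform_over_components)
      fix i
      from tame_two_quotients[OF that[of i] e, of q] obtain \<delta> where \<delta>: "0 < \<delta>"
        "\<forall>U E h k. U \<in> ?C \<longrightarrow> (\<forall>j. \<bar>E j\<bar> \<le> q) \<longrightarrow> 0 < \<bar>h\<bar> \<longrightarrow> \<bar>h\<bar> \<le> \<delta> \<longrightarrow> 0 < \<bar>k\<bar> \<longrightarrow> \<bar>k\<bar> \<le> \<delta> \<longrightarrow>
          \<bar>(f i (\<lambda>j. U j + h * E j) - f i U) / h - (f i (\<lambda>j. U j + k * E j) - f i U) / k\<bar> \<le> e" by blast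
      show "\<exists>\<delta>>0. \<forall>p h k. (fst p \<in> ?C \<and> (\<forall>j. \<bar>snd p j\<bar> \<le> q)) \<longrightarrow> 0 < \<bar>h\<bar> \<longrightarrow> \<bar>h\<bar> \<le> \<delta> \<longrightarrow> 0 < \<bar>k\<bar> \<longrightarrow> \<bar>k\<bar> \<le> \<delta> \<longrightarrow>
        \<bar>(f i (\<lambda>j. fst p j + h * snd p j) - f i (fst p)) / h - (f i (\<lambda>j. fst p j + k * snd p j) - f i (fst p)) / k\<bar> \<le> e"
      proof (intro exI[of _ \<delta>] conjI allI impI \<delta>(1))
        fix p :: "(wave_component \<Rightarrow> real) \<times> (wave_component \<Rightarrow> real)" and h k :: real
        assume "fst p \<in> ?C \<and> (\<forall>j. \<bar>snd p j\<bar> \<le> q)" "0 < \<bar>h\<bar>" "\<bar>h\<bar> \<le> \<delta>" "0 < \<bar>k\<bar>" "\<bar>k\<bar> \<le> \<delta>"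
        then show "\<bar>(f i (\<lambda>j. fst p j + h * snd p j) - f i (fst p)) / h
            - (f i (\<lambda>j. fst p j + k * snd p j) - f i (fst p)) / k\<bar> \<le> e"
          using \<delta>(2)[THEN spec[of _ "fst p"], THEN spec[of _ "snd p"], THEN spec[of _ h], THEN spec[of _ k]] by blast
      qed
    qed
    then obtain \<delta> where \<delta>: "0 < \<delta>" "\<forall>i p h k. (fst p \<in> ?C \<and> (\<forall>j. \<bar>snd p j\<bar> \<le> q)) \<longrightarrow> 0 < \<bar>h\<bar> \<longrightarrow> \<bar>h\<bar> \<le> \<delta> \<longrightarrow> 0 < \<bar>k\<bar> \<longrightarrow> \<bar>k\<bar> \<le> \<delta> \<longrightarrow>
      \<bar>(f i (\<lambda>j. fst p j + h * snd p j) - f i (fst p)) / h - (f i (\<lambda>j. fst p j + k * snd p j) - f i (fst p)) / k\<bar> \<le> e"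
      by blast
    show ?thesis
    proof (intro exI[of _ \<delta>] conjI allI impI \<delta>(1))
      fix i and x h k :: real and W E :: "wave_component \<Rightarrow> real"
      assume "\<bar>x\<bar> \<le> N" "\<forall>j. \<bar>W j - U0 j x\<bar> \<le> T * (M * exp a + bnd)" and E: "\<forall>j. \<bar>E j\<bar> \<le> q"
        and h: "0 < \<bar>h\<bar>" "\<bar>h\<bar> \<le> \<delta>" and k: "0 < \<bar>k\<bar>" "\<bar>k\<bar> \<le> \<delta>"
      then have "W \<in> ?C" by (intro near_data_core) auto
      then show "\<bar>(f i (\<lambda>j. W j + h * E j) - f i W) / h - (f i (\<lambda>j. W j + k * E j) - f i W) / k\<bar> \<le> e"
        using \<delta>(2)[THEN spec[of _ i], THEN spec[of _ "(W, E)"], THEN spec[of _ h], THEN spec[of _ k]] E h k by simp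
    qed
  qed
  show "\<exists>\<delta>>0. \<forall>i x W E h k. \<bar>x\<bar> \<le> N \<longrightarrow> (\<forall>j. \<bar>W j - U0 j x\<bar> \<le> T * (M * exp a + bnd)) \<longrightarrow> (\<forall>j. \<bar>E j\<bar> \<le> q) \<longrightarrow>
      0 < \<bar>h\<bar> \<longrightarrow> \<bar>h\<bar> \<le> \<delta> \<longrightarrow> 0 < \<bar>k\<bar> \<longrightarrow> \<bar>k\<bar> \<le> \<delta> \<longrightarrow>
      \<bar>(speed i (\<lambda>j. W j + h * E j) - speed i W) / h - (speed i (\<lambda>j. W j + k * E j) - speed i W) / k\<bar> \<le> e"
    by (rule two[OF tame_speed])
  show "\<exists>\<delta>>0. \<forall>i x W E h k. \<bar>x\<bar> \<le> N \<longrightarrow> (\<forall>j. \<bar>W j - U0 j x\<bar> \<le> T * (M * exp a + bnd)) \<longrightarrow> (\<forall>j. \<bar>E j\<bar> \<le> q) \<longrightarrow>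
      0 < \<bar>h\<bar> \<longrightarrow> \<bar>h\<bar> \<le> \<delta> \<longrightarrow> 0 < \<bar>k\<bar> \<longrightarrow> \<bar>k\<bar> \<le> \<delta> \<longrightarrow>
      \<bar>(source i (\<lambda>j. W j + h * E j) - source i W) / h - (source i (\<lambda>j. W j + k * E j) - source i W) / k\<bar> \<le> e"
    by (rule two[OF tame_source])
qed


lemma ex_characteristic_flow: "\<exists>U X. characteristic_flow speed source U0 lip M (exp a) bnd T U X"
proof -
  from ex_fixpoint obtain U X where "admissible_pair U X" "next_U U X = U" "next_X U X = X" by blast
  then have "characteristic_flow speed source U0 lip M (exp a) bnd T U X"
    by unfold_locales
  then show ?thesis by blast
qed

text \<open>An interface without characteristics and clamps. The two decay statements are quantified
  over all weights because the weights depend on data that are specified only later.\<close>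

theorem wave_solution:
  obtains U Ux :: "wave_component \<Rightarrow> real \<Rightarrow> real \<Rightarrow> real" where
    "\<And>i t x. t \<in> {0..T} \<Longrightarrow> ((\<lambda>y. U i t y) has_real_derivative Ux i t x) (at x)"
    "\<And>t x. t \<in> {0..T} \<Longrightarrow> ((\<lambda>s. U Logu s x) has_real_derivative (U Rinv t x + U Sinv t x) / 2) (at t within {0..T})"
    "\<And>t x. t \<in> {0..T} \<Longrightarrow> ((\<lambda>s. U Rinv s x) has_real_derivative
       a / 2 * ((U Rinv t x - U Sinv t x) * U Rinv t x) + \<psi> (U Logu t x) * (U Rinv t x - U Sinv t x)
       - U Rinv t x * U Sinv t x + exp (a * (U Logu t x - U0 Logu x)) * Ux Rinv t x) (at t within {0..T})"
    "\<And>t x. t \<in> {0..T} \<Longrightarrow> ((\<lambda>s. U Sinv s x) has_real_derivative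
       a / 2 * ((U Sinv t x - U Rinv t x) * U Sinv t x) + \<psi> (U Logu t x) * (U Rinv t x - U Sinv t x)
       - U Rinv t x * U Sinv t x - exp (a * (U Logu t x - U0 Logu x)) * Ux Sinv t x) (at t within {0..T})"
    "\<And>i. continuous_on ({0..T} \<times> UNIV) (\<lambda>(t, x). U i t x)"
    "\<And>i. continuous_on ({0..T} \<times> UNIV) (\<lambda>(t, x). Ux i t x)"
    "\<And>i x. U i 0 x = U0 i x"
    "\<And>t x. \<bar>U Logu t x - U0 Logu x\<bar> \<le> 1/2"
    "\<And>t x. t \<in> {0..T} \<Longrightarrow> Ux Logu t x = exp (- (a * (U Logu t x - U0 Logu x))) * (U Rinv t x - U Sinv t x) / 2"
    "\<forall>\<omega>. continuous_on UNIV \<omega> \<longrightarrow> (\<forall>x. 0 < \<omega> x) \<longrightarrow> (\<forall>x y. \<bar>x - y\<bar> \<le> exp a * T \<longrightarrow> \<omega> y \<le> 2 * \<omega> x) \<longrightarrow>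
       (\<forall>x. \<bar>U0 Rinv x\<bar> \<le> \<omega> x \<and> \<bar>U0 Sinv x\<bar> \<le> \<omega> x) \<longrightarrow>
       (\<forall>t\<in>{0..T}. \<forall>x. \<bar>U Rinv t x\<bar> \<le> 4 * \<omega> x \<and> \<bar>U Sinv t x\<bar> \<le> 4 * \<omega> x)"
    "\<forall>\<theta> \<omega> A C. continuous_on UNIV \<theta> \<longrightarrow> (\<forall>x. 0 < \<theta> x) \<longrightarrow> (\<forall>x y. \<bar>x - y\<bar> \<le> exp a * T \<longrightarrow> \<theta> y \<le> 2 * \<theta> x) \<longrightarrow>
       (\<forall>x. 0 \<le> \<omega> x \<and> \<omega> x \<le> C \<and> (\<omega> x)\<^sup>2 \<le> A * \<theta> x) \<longrightarrow>
       (\<forall>t\<in>{0..T}. \<forall>x. \<bar>U Rinv t x\<bar> \<le> \<omega> x \<and> \<bar>U Sinv t x\<bar> \<le> \<omega> x \<and> \<bar>Ux Logu t x\<bar> \<le> \<omega> x \<and> \<bar>Ux Logu t x - U0' Logu x\<bar> \<le> \<omega> x) \<longrightarrow>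
       (\<forall>x. \<bar>U0' Rinv x\<bar> \<le> \<theta> x \<and> \<bar>U0' Sinv x\<bar> \<le> \<theta> x) \<longrightarrow>
       (\<forall>t\<in>{0..T}. \<forall>x. \<bar>Ux Rinv t x\<bar> \<le> 2 * (4 + A) * \<theta> x \<and> \<bar>Ux Sinv t x\<bar> \<le> 2 * (4 + A) * \<theta> x)"
proof -
  from ex_characteristic_flow obtain U X where "characteristic_flow speed source U0 lip M (exp a) bnd T U X" by blast
  then interpret characteristic_flow speed source U0 lip M "exp a" bnd T U X .
  let ?Lu = "\<lambda>t x. U Logu t x" and ?R = "\<lambda>t x. U Rinv t x" and ?S = "\<lambda>t x. U Sinv t x"
  have near: "\<bar>U i t x - U0 i x\<bar> \<le> 1/2" for i t x using U_dist[of i t x] T_small(2) by linarith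
  have disp_le: "\<bar>U Disp t x\<bar> \<le> 1/2" for t x using near[of Disp t x] U0_Disp by simp
  have inv_le: "\<bar>U Rinv t x\<bar> \<le> b" "\<bar>U Sinv t x\<bar> \<le> b" for t x
    using near[of Rinv t x] near[of Sinv t x] U0_inv[of x] by linarith+
  have Logu_le: "U Logu t x \<le> Vm" for t x using near[of Logu t x] U0_Logu[of x] by linarith
  have still: "X i s t x = x" if "i = Disp \<or> i = Logu" for i s t x
  proof -
    have "lam_along i t x = (\<lambda>\<tau>. 0)" using that by (auto simp: speed_def)
    then have "prim T (lam_along i t x) s = 0" for s by (simp add: prim_def)
    then show ?thesis using X_eq[of i s t x] by simp
  qed
  \<comment> \<open>Both components have speed 0 and the same source, hence they are integrated
    along the same vertical line and differ by their data.\<close>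
  have disp: "U Disp t x = U Logu t x - U0 Logu x" for t x
  proof -
    have "g_along Disp t x = g_along Logu t x" by (simp add: still source_def Let_def)
    then show ?thesis using U_eq[of Disp t x] U_eq[of Logu t x] by (simp add: still U0_Disp)
  qed
  have cl: "clamp_abs b (U Rinv t x) = U Rinv t x" "clamp_abs b (U Sinv t x) = U Sinv t x"
    "clamp_abs 1 (U Disp t x) = U Disp t x" "min Vm (U Logu t x) = U Logu t x" for t x
    using inv_le[where t = t and x = x] disp_le[of t x] Logu_le[of t x] by (auto intro!: clamp_abs_id)
  have dLogu: "((\<lambda>s. U Logu s x) has_real_derivative (U Rinv t x + U Sinv t x) / 2) (at t within {0..T})"
    if "t \<in> {0..T}" for t x
    using U_has_dt[OF that, of Logu x] by (simp add: source_def speed_def Let_def cl)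
  have dR: "((\<lambda>s. U Rinv s x) has_real_derivative
       a / 2 * ((U Rinv t x - U Sinv t x) * U Rinv t x) + \<psi> (U Logu t x) * (U Rinv t x - U Sinv t x)
       - U Rinv t x * U Sinv t x + exp (a * (U Logu t x - U0 Logu x)) * dxU Rinv t x) (at t within {0..T})"
    if "t \<in> {0..T}" for t x
    using U_has_dt[OF that, of Rinv x] by (simp add: source_def speed_def Let_def cl flip: disp)
  have dS: "((\<lambda>s. U Sinv s x) has_real_derivative
       a / 2 * ((U Sinv t x - U Rinv t x) * U Sinv t x) + \<psi> (U Logu t x) * (U Rinv t x - U Sinv t x)
       - U Rinv t x * U Sinv t x - exp (a * (U Logu t x - U0 Logu x)) * dxU Sinv t x) (at t within {0..T})"
    if "t \<in> {0..T}" for t x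
    using U_has_dt[OF that, of Sinv x] by (simp add: source_def speed_def Let_def cl flip: disp)
  have dxU0: "dxU i 0 x = U0' i x" for i x
  proof (rule DERIV_unique)
    show "((\<lambda>x. U i 0 x) has_real_derivative dxU i 0 x) (at x)" by (rule U_has_dx) (use T_pos in auto)
    show "((\<lambda>x. U i 0 x) has_real_derivative U0' i x) (at x)" using U0_deriv by (simp add: U_initial)
  qed
  have compat: "dxU Logu t x = exp (- (a * (U Logu t x - U0 Logu x))) * (U Rinv t x - U Sinv t x) / 2"
    if t: "t \<in> {0..T}" for t x
  proof -
    have c1: "continuous_on ({0..T} \<times> UNIV) (\<lambda>(t, x). (U Rinv t x + U Sinv t x) / 2)"
      using U_continuous[of "{0..T} \<times> UNIV" Rinv] U_continuous[of "{0..T} \<times> UNIV" Sinv]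
      unfolding case_prod_beta by (intro continuous_intros) auto
    have c2: "continuous_on ({0..T} \<times> UNIV) (\<lambda>(t, x). (dxU Rinv t x + dxU Sinv t x) / 2)"
      using dxU_continuous[of Rinv] dxU_continuous[of Sinv]
      unfolding case_prod_beta by (intro continuous_intros) auto
    have d1: "((\<lambda>s. dxU Logu s x) has_real_derivative (dxU Rinv s x + dxU Sinv s x) / 2) (at s within {0..T})"
      if s: "s \<in> {0..T}" for s
      by (rule dt_dx_swap[OF dLogu U_has_dx _ c1 c2 s]) (auto intro!: derivative_eq_intros U_has_dx)
    have d2: "((\<lambda>s. exp (- (a * (U Logu s x - U0 Logu x))) * (U Rinv s x - U Sinv s x) / 2) has_real_derivative
        (dxU Rinv s x + dxU Sinv s x) / 2) (at s within {0..T})" if s: "s \<in> {0..T}" for s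
    proof -
      let ?e = "exp (- (a * (U Logu s x - U0 Logu x)))"
      have inv: "?e * exp (a * (U Logu s x - U0 Logu x)) = 1" by (simp add: exp_add[symmetric])
      have "((\<lambda>s. exp (- (a * (U Logu s x - U0 Logu x)))) has_real_derivative
          ?e * - (a * ((U Rinv s x + U Sinv s x) / 2))) (at s within {0..T})"
        by (auto intro!: derivative_eq_intros dLogu[OF s])
      note D = DERIV_cdivide[OF DERIV_mult[OF this DERIV_diff[OF dR[OF s, of x] dS[OF s, of x]]], of 2]
      \<comment> \<open>The terms with \<open>p\<close> and \<open>r * s\<close> cancel in the
        difference of the two equations. Its terms with \<open>a / 2\<close> add up to a (r - s) (r
        + s) / 2, which the derivative of the exponential factor compensates.\<close>
      have "(e * - (a * ((r + s) / 2)) * (r - s)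
          + (a / 2 * ((r - s) * r) + p * (r - s) - r * s + E * P
            - (a / 2 * ((s - r) * s) + p * (r - s) - r * s - E * Q)) * e) / 2 = (e * E) * (P + Q) / 2"
        for e E r s p P Q :: real by (simp add: field_simps)
      note eq = this[of ?e "U Rinv s x" "U Sinv s x" "\<psi> (U Logu s x)" "exp (a * (U Logu s x - U0 Logu x))"
          "dxU Rinv s x" "dxU Sinv s x", unfolded inv mult_1]
      show ?thesis using D unfolding eq .
    qed
    have "\<exists>c. \<forall>s\<in>{0..T}. dxU Logu s x - exp (- (a * (U Logu s x - U0 Logu x))) * (U Rinv s x - U Sinv s x) / 2 = c"
    proof (rule has_field_derivative_zero_constant)
      show "((\<lambda>s. dxU Logu s x - exp (- (a * (U Logu s x - U0 Logu x))) * (U Rinv s x - U Sinv s x) / 2)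
        has_real_derivative 0) (at s within {0..T})" if "s \<in> {0..T}" for s
        using DERIV_diff[OF d1[OF that] d2[OF that]] by simp
    qed simp
    then obtain c where c: "\<And>s. s \<in> {0..T} \<Longrightarrow>
        dxU Logu s x - exp (- (a * (U Logu s x - U0 Logu x))) * (U Rinv s x - U Sinv s x) / 2 = c" by blast
    have "c = 0" using c[of 0] T_pos by (simp add: U_initial dxU0 compat0)
    with c[OF t] show ?thesis by simp
  qed
  have dxDisp: "dxU Disp t x = dxU Logu t x - U0' Logu x" if "t \<in> {0..T}" for t x
  proof (rule DERIV_unique[OF U_has_dx[OF that]])
    show "((\<lambda>x. U Disp t x) has_real_derivative dxU Logu t x - U0' Logu x) (at x)"
      unfolding disp by (intro DERIV_diff U_has_dx that U0_deriv)
  qed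
  have dec: "\<forall>\<omega>. continuous_on UNIV \<omega> \<longrightarrow> (\<forall>x. 0 < \<omega> x) \<longrightarrow> (\<forall>x y. \<bar>x - y\<bar> \<le> exp a * T \<longrightarrow> \<omega> y \<le> 2 * \<omega> x) \<longrightarrow>
       (\<forall>x. \<bar>U0 Rinv x\<bar> \<le> \<omega> x \<and> \<bar>U0 Sinv x\<bar> \<le> \<omega> x) \<longrightarrow>
       (\<forall>t\<in>{0..T}. \<forall>x. \<bar>U Rinv t x\<bar> \<le> 4 * \<omega> x \<and> \<bar>U Sinv t x\<bar> \<le> 4 * \<omega> x)"
  proof (intro allI impI ballI)
    fix \<omega> t x assume \<omega>: "continuous_on UNIV \<omega>" "\<forall>x. 0 < \<omega> x" "\<forall>x y. \<bar>x - y\<bar> \<le> exp a * T \<longrightarrow> \<omega> y \<le> 2 * \<omega> x"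
      "\<forall>x. \<bar>U0 Rinv x\<bar> \<le> \<omega> x \<and> \<bar>U0 Sinv x\<bar> \<le> \<omega> x" and t: "t \<in> {0..T}"
    have "\<bar>U i t x\<bar> \<le> 4 * \<omega> x" if "i \<in> {Rinv, Sinv}" for i
      by (rule decay[OF \<omega>(1) \<omega>(2)[rule_format] \<omega>(3)[rule_format] _ source_homogeneous that t])
        (use \<omega>(4) in auto)
    then show "\<bar>U Rinv t x\<bar> \<le> 4 * \<omega> x \<and> \<bar>U Sinv t x\<bar> \<le> 4 * \<omega> x" by simp
  qed
  have sdec: "\<forall>\<theta> \<omega> A C. continuous_on UNIV \<theta> \<longrightarrow> (\<forall>x. 0 < \<theta> x) \<longrightarrow> (\<forall>x y. \<bar>x - y\<bar> \<le> exp a * T \<longrightarrow> \<theta> y \<le> 2 * \<theta> x) \<longrightarrow>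
       (\<forall>x. 0 \<le> \<omega> x \<and> \<omega> x \<le> C \<and> (\<omega> x)\<^sup>2 \<le> A * \<theta> x) \<longrightarrow>
       (\<forall>t\<in>{0..T}. \<forall>x. \<bar>U Rinv t x\<bar> \<le> \<omega> x \<and> \<bar>U Sinv t x\<bar> \<le> \<omega> x \<and> \<bar>dxU Logu t x\<bar> \<le> \<omega> x \<and> \<bar>dxU Logu t x - U0' Logu x\<bar> \<le> \<omega> x) \<longrightarrow>
       (\<forall>x. \<bar>U0' Rinv x\<bar> \<le> \<theta> x \<and> \<bar>U0' Sinv x\<bar> \<le> \<theta> x) \<longrightarrow>
       (\<forall>t\<in>{0..T}. \<forall>x. \<bar>dxU Rinv t x\<bar> \<le> 2 * (4 + A) * \<theta> x \<and> \<bar>dxU Sinv t x\<bar> \<le> 2 * (4 + A) * \<theta> x)"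
  proof (intro allI impI ballI)
    fix \<theta> \<omega> A C t x
    assume \<theta>: "continuous_on UNIV \<theta>" "\<forall>x. 0 < \<theta> x" "\<forall>x y. \<bar>x - y\<bar> \<le> exp a * T \<longrightarrow> \<theta> y \<le> 2 * \<theta> x"
      and \<omega>: "\<forall>x. 0 \<le> \<omega> x \<and> \<omega> x \<le> C \<and> (\<omega> x)\<^sup>2 \<le> A * \<theta> x"
      and le: "\<forall>t\<in>{0..T}. \<forall>x. \<bar>U Rinv t x\<bar> \<le> \<omega> x \<and> \<bar>U Sinv t x\<bar> \<le> \<omega> x \<and> \<bar>dxU Logu t x\<bar> \<le> \<omega> x \<and> \<bar>dxU Logu t x - U0' Logu x\<bar> \<le> \<omega> x"
      and le0: "\<forall>x. \<bar>U0' Rinv x\<bar> \<le> \<theta> x \<and> \<bar>U0' Sinv x\<bar> \<le> \<theta> x" and t: "t \<in> {0..T}"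
    have "\<bar>dxU i t x\<bar> \<le> 2 * (4 + A) * \<theta> x" if i: "i \<in> {Rinv, Sinv}" for i
    proof (rule slope_decay[where J = "{Rinv, Sinv}" and \<theta> = \<theta> and \<omega> = \<omega> and C = C, OF \<theta>(1) \<theta>(2)[rule_format] \<theta>(3)[rule_format] _ _ _ _ _ _ source_diff i t])
      show "\<bar>U j t x\<bar> \<le> \<omega> x" if "j \<in> {Rinv, Sinv}" "t \<in> {0..T}" for j t x
        using le that by auto
      show "\<bar>dxU j t x\<bar> \<le> \<omega> x" if "j \<notin> {Rinv, Sinv}" "t \<in> {0..T}" for j t x
        using le that dxDisp[OF that(2), of x] by (cases j) auto
    qed (use \<omega> le0 in \<open>auto simp: dxU0\<close>)
    then show "\<bar>dxU Rinv t x\<bar> \<le> 2 * (4 + A) * \<theta> x \<and> \<bar>dxU Sinv t x\<bar> \<le> 2 * (4 + A) * \<theta> x" by simp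
  qed
  show ?thesis
    by (rule that[of U dxU]) (fact U_has_dx dLogu dR dS U_continuous dxU_continuous U_initial near compat dec sdec)+
qed

end


section \<open>Normalization of the data\<close>

text \<open>The lower bound makes \<open>Y\<close> expand distances by at least \<open>c\<close>: it
  is therefore onto the whole line, and its inverse is Lipschitz and so continuous, as the inverse
  function rule requires.\<close>

lemma ex_coordinate:
  fixes f :: "real \<Rightarrow> real"
  assumes cont: "continuous_on UNIV f" and c: "0 < c" "\<And>x. c \<le> f x"
  shows "\<exists>Y \<Xi>. (\<forall>x. (Y has_real_derivative f x) (at x)) \<and> (\<forall>x. \<Xi> (Y x) = x) \<and> (\<forall>y. Y (\<Xi> y) = y) \<and>
    (\<forall>y. (\<Xi> has_real_derivative inverse (f (\<Xi> y))) (at y))"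
proof -
  have "isCont f x" for x using cont by (simp add: continuous_on_eq_continuous_at)
  then obtain Y where "\<forall>x. - \<infinity> < ereal x \<longrightarrow> ereal x < \<infinity> \<longrightarrow> (Y has_vector_derivative f x) (at x)"
    using einterval_antiderivative[of "- \<infinity>" "\<infinity>" f] by auto
  then have Y: "(Y has_real_derivative f x) (at x)" for x
    by (simp add: has_real_derivative_iff_has_vector_derivative)
  have expand: "c * \<bar>x - y\<bar> \<le> \<bar>Y x - Y y\<bar>" for x y
  proof -
    from mvt_between[OF Y] obtain z where "Y x - Y y = f z * (x - y)" by blast
    moreover have "c * \<bar>x - y\<bar> \<le> f z * \<bar>x - y\<bar>" using c(2) by (intro mult_right_mono) auto
    moreover have "0 < f z" using c(2)[of z] c(1) by linarith
    ultimately show ?thesis by (simp add: abs_mult)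
  qed
  have mono: "Y x + c * (y - x) \<le> Y y" if "x \<le> y" for x y
  proof (cases "x = y")
    case False
    with that have "x < y" by simp
    from MVT2[OF this Y] obtain z where "Y y - Y x = (y - x) * f z" by blast
    moreover have "(y - x) * c \<le> (y - x) * f z" using c(2) that by (intro mult_left_mono) auto
    ultimately show ?thesis by (simp add: mult.commute)
  qed simp
  have surj: "\<exists>x. Y x = y" for y
  proof -
    define r where "r = \<bar>y - Y 0\<bar> / c"
    have r: "0 \<le> r" "c * r = \<bar>y - Y 0\<bar>" using c by (auto simp: r_def)
    have "Y (- r) \<le> y" "y \<le> Y r" using mono[of "- r" 0] mono[of 0 r] r by (auto simp: algebra_simps)
    moreover have "continuous_on {- r..r} Y"
      by (intro continuous_at_imp_continuous_on ballI) (rule DERIV_isCont[OF Y])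
    ultimately show ?thesis using IVT'[of Y "- r" y r] r by auto
  qed
  then obtain \<Xi> where \<Xi>: "\<And>y. Y (\<Xi> y) = y" by metis
  have \<Xi>Y: "\<Xi> (Y x) = x" for x
  proof -
    have "c * \<bar>\<Xi> (Y x) - x\<bar> \<le> 0" using expand[of "\<Xi> (Y x)" x] by (simp add: \<Xi>)
    then show ?thesis using c by (simp add: mult_le_0_iff)
  qed
  have "(\<Xi> has_real_derivative inverse (f (\<Xi> y))) (at y)" for y
  proof (rule DERIV_inverse_function[where a = "y - 1" and b = "y + 1"])
    show "(Y has_real_derivative f (\<Xi> y)) (at (\<Xi> y))" by (rule Y)
    show "f (\<Xi> y) \<noteq> 0" using c(2)[of "\<Xi> y"] c(1) by linarith
    have "continuous_on UNIV \<Xi>"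
    proof (rule continuous_on_if_lipschitz)
      show "\<bar>\<Xi> x - \<Xi> y\<bar> \<le> inverse c * \<bar>x - y\<bar>" for x y
        using expand[of "\<Xi> x" "\<Xi> y"] c by (simp add: \<Xi> field_simps)
    qed
    then show "isCont \<Xi> y" by (simp add: continuous_on_eq_continuous_at)
  qed (use \<Xi> in auto)
  with Y \<Xi> \<Xi>Y show ?thesis by blast
qed

lemma ex_small_time: "\<exists>T>0. T \<le> 1 \<and> T * A \<le> 1 / 64 \<and> T * B \<le> 1 / 2 \<and> T * D \<le> ln (2 :: real)"
proof -
  have l: "1 / 64 \<le> ln (2 :: real)" using ln_2_less_1 ln2_ge_two_thirds by linarith
  define E where "E = \<bar>A\<bar> + \<bar>B\<bar> + \<bar>D\<bar> + 1"
  have E: "1 \<le> E" "A \<le> E" "B \<le> E" "D \<le> E" by (auto simp: E_def)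
  have "1 / (64 * E) * X \<le> 1 / 64" if "X \<le> E" for X
    using that E(1) by (simp add: divide_simps)
  from this[OF E(2)] this[OF E(3)] this[OF E(4)] l E(1) show ?thesis
    by (intro exI[of _ "1 / (64 * E)"] conjI) (auto intro: order_trans simp: divide_simps)
qed

section \<open>The weight <x>, the constants of the problem and the weights of the data\<close>

lemma bracket_ge_1: "1 \<le> japanese_bracket x"
  by (simp add: japanese_bracket_def)

lemma bracket_powr_mono: "p \<le> q \<Longrightarrow> japanese_bracket x powr p \<le> japanese_bracket x powr q"
  using bracket_ge_1 by (intro powr_mono) auto

lemma bracket_powr_pos: "0 < japanese_bracket x powr p"
  using bracket_ge_1[of x] by simp

lemma ln_bracket_deriv: "((\<lambda>x. ln (japanese_bracket x)) has_real_derivative x / (1 + x\<^sup>2)) (at x)"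
proof -
  have p: "0 < 1 + x\<^sup>2" by (simp add: add_pos_nonneg)
  have "((\<lambda>x. ln (1 + x\<^sup>2) / 2) has_real_derivative x / (1 + x\<^sup>2)) (at x)"
    using p by (auto intro!: derivative_eq_intros simp: field_simps)
  moreover have "ln (japanese_bracket x) = ln (1 + x\<^sup>2) / 2" for x
    unfolding japanese_bracket_def by (rule ln_sqrt) (simp add: add_pos_nonneg)
  ultimately show ?thesis by (simp only:)
qed

lemma bracket_slope_le: "\<bar>x / (1 + x\<^sup>2)\<bar> \<le> (1 :: real)"
proof -
  have "\<bar>x\<bar> \<le> 1 + x\<^sup>2"
  proof (cases "\<bar>x\<bar> \<le> 1")
    case False
    then have "\<bar>x\<bar> * 1 \<le> \<bar>x\<bar> * \<bar>x\<bar>" by (intro mult_left_mono) auto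
    then show ?thesis by (simp add: power2_eq_square)
  qed (use zero_le_power2[of x] in linarith)
  then show ?thesis by (simp add: add_pos_nonneg abs_divide)
qed

lemma Ck_onD:
  assumes "Ck_on m S f" "open S" "k < m" "x \<in> S"
  shows "((deriv ^^ k) f has_real_derivative (deriv ^^ Suc k) f x) (at x)"
proof -
  have "((deriv ^^ k) f) differentiable_on S" using assms by (auto simp: Ck_on_def)
  then have "((deriv ^^ k) f) differentiable (at x)"
    using assms by (metis differentiable_on_def at_within_open)
  then show ?thesis by (simp add: DERIV_deriv_iff_real_differentiable)
qed

locale problem_constants =
  fixes a \<alpha> \<beta> \<gamma> c1 c2 c3 c4 :: real and CK :: "real \<Rightarrow> real"
  assumes exponents: "a \<ge> 0" "\<alpha> \<ge> 0" "\<beta> \<ge> 0" "\<alpha> \<le> \<beta>" "a * \<alpha> \<le> \<beta>"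
    and \<gamma>: "\<gamma> = (if a \<ge> 1 then 0 else (1 - a) * \<alpha>)"
    and c_pos: "c1 > 0" "c2 > 0" "c3 > 0" "c4 > 0" and CK_pos: "\<forall>K>0. CK K > 0"
begin

text \<open>Meaning of the constants: \<open>k\<close> bounds the ratios R/u and S/u of the data,
  and \<open>b\<close> and \<open>Vm\<close> leave distance 1 to the clamps. \<open>CF\<close> is
  the constant of F for values up to \<open>exp Vm\<close>. \<open>\<Theta>\<close> bounds
  \<open>\<theta>0\<close>, and \<open>A0\<close> compares \<open>\<omega>0\<close> squared with
  \<open>\<theta>0\<close>. \<open>M\<close> bounds the slopes of the data in y: \<open>k\<close>
  for ln u0, and \<open>\<Theta> * c4 + k\<^sup>2\<close> for the ratios. \<open>D\<close> bounds
  the slopes in y of the logarithms of both weights.\<close>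

definition "k = c3 / c1"
definition "b = k + 1"
definition "Vm = ln c2 + 1"
definition "CF = CK (exp Vm)"
definition "\<Theta> = (if a \<ge> 1 then c2 powr (a - 1) else c1 powr (a - 1))"
definition "M = k + \<Theta> * c4 + k\<^sup>2"
definition "D = c2 powr a * (\<beta> + \<gamma>) + (a + 2) * k"
definition "A0 = c3\<^sup>2 / c1 powr (a + 1)"

lemma const_pos: "0 < k" "0 < CF" "0 < \<Theta>" "0 < A0" "0 \<le> \<gamma>"
  using exponents c_pos CK_pos by (auto simp: k_def CF_def \<Theta>_def A0_def \<gamma>)

text \<open>For a \<ge> 1 the second inequality is the sum of a \<alpha> \<le> \<beta> and \<alpha>
  \<le> \<beta>; for a < 1 its left side is 2 \<alpha>.\<close>

lemma gamma_le: "\<gamma> \<le> \<beta>" "\<alpha> * (a + 1) + \<gamma> \<le> 2 * \<beta>"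
proof -
  have "(1 - a) * \<alpha> \<le> \<alpha>" using exponents by (simp add: left_diff_distrib)
  then show "\<gamma> \<le> \<beta>" using exponents by (auto simp: \<gamma>)
  show "\<alpha> * (a + 1) + \<gamma> \<le> 2 * \<beta>" using exponents by (auto simp: \<gamma> algebra_simps)
qed

text \<open>After \<open>T \<le> 1\<close> the conditions serve, in this order, the contraction and
  the absorption arguments, the inactivity of the clamps, and the comparison of the weights within a
  factor 2 over the distance \<open>exp a * T\<close> that a characteristic can travel.\<close>

definition good_time :: "real \<Rightarrow> bool" where
  "good_time T \<longleftrightarrow> 0 < T \<and> T \<le> 1 \<and>
     T * (wave_system.lip a b (CF / 2) (CF * (1 + a) / 2) * (1 + M)\<^sup>2) \<le> 1 / 64 \<and>
     T * (M * exp a + wave_system.bnd a b (CF / 2)) \<le> 1 / 2 \<and> T * (exp a * D) \<le> ln 2"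

lemma ex_good_time: "\<exists>T. good_time T"
  using ex_small_time unfolding good_time_def by blast

end

locale problem = problem_constants +
  fixes u0 u1 F :: "real \<Rightarrow> real"
  assumes data: "admissible_data a \<alpha> \<beta> \<gamma> c1 c2 c3 c4 u0 u1"
    and nonlin: "admissible_nonlinearity a CK F"
begin

lemma u0_ge: "c1 * japanese_bracket x powr (- \<alpha>) \<le> u0 x" and u0_le: "u0 x \<le> c2"
  using data by (auto simp: admissible_data_def)

lemma u0_pos: "0 < u0 x"
  using u0_ge[of x] mult_pos_pos[OF c_pos(1) bracket_powr_pos[of x "- \<alpha>"]] by linarith

definition "u0' = deriv u0"
definition "u0'' = deriv u0'"

lemma u0_deriv: "(u0 has_real_derivative u0' x) (at x)" "(u0' has_real_derivative u0'' x) (at x)"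
  and u0_cont: "continuous_on UNIV u0" "continuous_on UNIV u0'" "continuous_on UNIV u0''"
proof -
  have C: "Ck_on 2 UNIV u0" using data by (simp add: admissible_data_def)
  show "(u0 has_real_derivative u0' x) (at x)" "(u0' has_real_derivative u0'' x) (at x)"
    using Ck_onD[OF C, of 0 x] Ck_onD[OF C, of 1 x] by (simp_all add: u0'_def u0''_def)
  have "\<forall>k\<le>2. continuous_on UNIV ((deriv ^^ k) u0)" using C by (simp add: Ck_on_def)
  from this[rule_format, of 0] this[rule_format, of 1] this[rule_format, of 2]
  show "continuous_on UNIV u0" "continuous_on UNIV u0'" "continuous_on UNIV u0''"
    by (simp_all add: u0'_def u0''_def numeral_2_eq_2)
qed

lemma u1_deriv: "(u1 has_real_derivative deriv u1 x) (at x)"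
  and u1_cont: "continuous_on UNIV u1" "continuous_on UNIV (deriv u1)"
proof -
  have C: "Ck_on 1 UNIV u1" using data by (simp add: admissible_data_def Ckb_def)
  show "(u1 has_real_derivative deriv u1 x) (at x)" using Ck_onD[OF C, of 0 x] by simp
  have "\<forall>k\<le>1. continuous_on UNIV ((deriv ^^ k) u1)" using C by (simp add: Ck_on_def)
  from this[rule_format, of 0] this[rule_format, of 1]
  show "continuous_on UNIV u1" "continuous_on UNIV (deriv u1)" by simp_all
qed

text \<open>The initial values of R for \<sigma> = 1 and of S for \<sigma> = -1.\<close>

definition inv0 :: "real \<Rightarrow> real \<Rightarrow> real" where
  "inv0 \<sigma> x = u1 x + \<sigma> * (u0 x powr a * u0' x)"

definition inv0' :: "real \<Rightarrow> real \<Rightarrow> real" where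
  "inv0' \<sigma> x = deriv u1 x + \<sigma> * (a * u0 x powr (a - 1) * u0' x * u0' x + u0 x powr a * u0'' x)"

lemma inv0_deriv: "(inv0 \<sigma> has_real_derivative inv0' \<sigma> x) (at x)"
  unfolding inv0_def[abs_def] inv0'_def using u0_pos[of x]
  by (auto intro!: derivative_eq_intros u0_deriv u1_deriv simp: powr_diff field_simps)

lemma inv0_cont: "continuous_on UNIV (inv0 \<sigma>)" "continuous_on UNIV (inv0' \<sigma>)"
proof -
  have ne: "u0 x \<noteq> 0" for x using u0_pos[of x] by simp
  show "continuous_on UNIV (inv0 \<sigma>)" "continuous_on UNIV (inv0' \<sigma>)"
    unfolding inv0_def[abs_def] inv0'_def[abs_def]
    by (intro continuous_intros u0_cont u1_cont; simp add: ne)+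
qed

lemma inv0_le: "\<sigma> \<in> {1, -1} \<Longrightarrow> \<bar>inv0 \<sigma> x\<bar> \<le> c3 * japanese_bracket x powr (- \<beta>)"
  using data by (auto simp: admissible_data_def inv0_def u0'_def)

lemma inv0'_le:
  assumes "\<sigma> \<in> {1, -1}" shows "\<bar>inv0' \<sigma> x\<bar> \<le> c4 * japanese_bracket x powr (- \<gamma>)"
proof -
  have "\<bar>deriv (inv0 \<sigma>) x\<bar> \<le> c4 * japanese_bracket x powr (- \<gamma>)"
    using data assms unfolding admissible_data_def inv0_def[abs_def] u0'_def by blast
  then show ?thesis by (simp add: DERIV_imp_deriv[OF inv0_deriv])
qed

text \<open>\<open>\<omega>0\<close> measures the ratios R/u and S/u, and \<open>\<theta>0\<close>
  their slopes in y, where the power of \<open>u0\<close> combines the division by u with dx/dy =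
  u0^a. Built with \<open>u0\<close> itself and not with its bounds, the weights return the required
  powers of <x> when the final estimates are multiplied by u.\<close>

definition "\<omega>0 x = c3 * japanese_bracket x powr (- \<beta>) / u0 x"
definition "\<theta>0 x = u0 x powr (a - 1) * japanese_bracket x powr (- \<gamma>)"

lemma weights_pos: "0 < \<omega>0 x" "0 < \<theta>0 x"
  using c_pos u0_pos[of x] bracket_powr_pos by (auto simp: \<omega>0_def \<theta>0_def)

lemma \<omega>0_le: "\<omega>0 x \<le> k"
proof -
  have "c3 * japanese_bracket x powr (- \<beta>) \<le> c3 * japanese_bracket x powr (- \<alpha>)"
    using c_pos exponents by (intro mult_left_mono bracket_powr_mono) auto
  also have "\<dots> = k * (c1 * japanese_bracket x powr (- \<alpha>))" using c_pos by (simp add: k_def)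
  also have "\<dots> \<le> k * u0 x" using const_pos u0_ge by (intro mult_left_mono) auto
  finally show ?thesis using u0_pos[of x] by (simp add: \<omega>0_def pos_divide_le_eq)
qed

lemma \<theta>0_le: "\<theta>0 x \<le> \<Theta>"
proof (cases "a \<ge> 1")
  case True
  then have "u0 x powr (a - 1) \<le> c2 powr (a - 1)" using u0_le u0_pos[of x] by (intro powr_mono2) auto
  moreover have "\<gamma> = 0" using True by (simp add: \<gamma>)
  ultimately show ?thesis using bracket_ge_1[of x] True unfolding \<theta>0_def \<Theta>_def by simp
next
  case False
  let ?j = "japanese_bracket x"
  have j: "0 < ?j" using bracket_ge_1[of x] by linarith
  have "u0 x powr (a - 1) \<le> (c1 * ?j powr (- \<alpha>)) powr (a - 1)"
    using u0_ge[of x] False c_pos bracket_powr_pos by (intro powr_mono2') auto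
  also have "\<dots> = c1 powr (a - 1) * ?j powr \<gamma>"
    using False c_pos by (simp add: powr_mult powr_powr \<gamma> algebra_simps)
  finally have "\<theta>0 x \<le> c1 powr (a - 1) * ?j powr \<gamma> * ?j powr (- \<gamma>)"
    unfolding \<theta>0_def by (intro mult_right_mono) auto
  also have "\<dots> = c1 powr (a - 1)" using j by (simp add: powr_minus)
  finally show ?thesis using False by (simp add: \<Theta>_def)
qed

text \<open>Clearing denominators leaves <x>^(-2 \<beta>) against u0^(a + 1) <x>^(-\<gamma>). The
  lower bound on \<open>u0\<close> reduces this to the second part of
  \<open>gamma_le\<close>.\<close>

lemma \<omega>0_sq_le: "(\<omega>0 x)\<^sup>2 \<le> A0 * \<theta>0 x"
proof -
  let ?j = "japanese_bracket x"
  have j: "0 < ?j" using bracket_ge_1[of x] by linarith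
  have u: "0 < u0 x" by (rule u0_pos)
  have "c1 powr (a + 1) * ?j powr (- (2 * \<beta>)) \<le> c1 powr (a + 1) * ?j powr (- (\<alpha> * (a + 1)) - \<gamma>)"
    using gamma_le by (intro mult_left_mono bracket_powr_mono) auto
  also have "\<dots> = (c1 * ?j powr (- \<alpha>)) powr (a + 1) * ?j powr (- \<gamma>)"
  proof -
    have "(c1 * ?j powr (- \<alpha>)) powr (a + 1) = c1 powr (a + 1) * ?j powr (- (\<alpha> * (a + 1)))"
      using c_pos by (simp add: powr_mult powr_powr)
    then show ?thesis using powr_add[of ?j "- (\<alpha> * (a + 1))" "- \<gamma>"] by simp
  qed
  also have "\<dots> \<le> u0 x powr (a + 1) * ?j powr (- \<gamma>)"
    using u0_ge[of x] c_pos exponents bracket_powr_pos by (intro mult_right_mono powr_mono2) auto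
  finally have 1: "c1 powr (a + 1) * ?j powr (- (2 * \<beta>)) \<le> u0 x powr (a + 1) * ?j powr (- \<gamma>)" .
  have "(\<omega>0 x)\<^sup>2 = A0 * (c1 powr (a + 1) * ?j powr (- (2 * \<beta>))) / (u0 x)\<^sup>2"
    using c_pos j by (simp add: \<omega>0_def A0_def power_divide power_mult_distrib powr_power mult.commute)
  also have "\<dots> \<le> A0 * (u0 x powr (a + 1) * ?j powr (- \<gamma>)) / (u0 x)\<^sup>2"
    using 1 const_pos by (intro divide_right_mono mult_left_mono) auto
  also have "\<dots> = A0 * \<theta>0 x"
    using u by (simp add: \<theta>0_def powr_add powr_diff field_simps power2_eq_square)
  finally show ?thesis .
qed

lemma inv0_ratio: "\<sigma> \<in> {1, -1} \<Longrightarrow> \<bar>inv0 \<sigma> x / u0 x\<bar> \<le> \<omega>0 x"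
  using inv0_le[of \<sigma> x] u0_pos[of x] by (simp add: \<omega>0_def abs_divide divide_right_mono)

lemma slope_eq: "u0 x powr a * u0' x = (inv0 1 x - inv0 (-1) x) / 2"
  by (simp add: inv0_def)

lemma log_slope_le: "\<bar>u0 x powr a * u0' x / u0 x\<bar> \<le> \<omega>0 x"
proof -
  have "u0 x powr a * u0' x / u0 x = (inv0 1 x / u0 x - inv0 (-1) x / u0 x) / 2"
    by (simp add: slope_eq diff_divide_distrib)
  moreover have "\<bar>inv0 1 x / u0 x\<bar> \<le> \<omega>0 x" "\<bar>inv0 (-1) x / u0 x\<bar> \<le> \<omega>0 x"
    by (intro inv0_ratio; simp)+
  moreover have "\<bar>z\<bar> \<le> w" if "z = (p - q) / 2" "\<bar>p\<bar> \<le> w" "\<bar>q\<bar> \<le> w" for p q w z :: real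
    using that unfolding abs_le_iff by auto
  ultimately show ?thesis by blast
qed

end


lemma ratio_le_2:
  fixes f :: "real \<Rightarrow> real"
  assumes f: "\<And>x. (f has_real_derivative f' x) (at x)" and b: "\<And>x. \<bar>f' x\<bar> \<le> D"
    and r: "r * D \<le> ln 2" and xy: "\<bar>x - y\<bar> \<le> r"
  shows "exp (f y) \<le> 2 * exp (f x)"
proof -
  have D: "0 \<le> D" using b[of 0] by linarith
  from mvt_between[OF f] obtain z where z: "f y - f x = f' z * (y - x)" by blast
  have "\<bar>f' z * (y - x)\<bar> \<le> D * r"
    unfolding abs_mult using b xy D by (intro mult_mono) (auto simp: abs_minus_commute)
  with z r have "f y \<le> f x + ln 2" by (simp add: mult.commute)
  then have "exp (f y) \<le> exp (f x + ln 2)" by simp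
  then show ?thesis by (simp add: exp_add)
qed

context problem begin

text \<open>F(u) u^(-a) / 2 as a function of v = ln u. The hypotheses on F and F' say that this
  function and its derivative remain bounded as v tends to minus infinity.\<close>

definition "\<psi> v = F (exp v) * exp (- (a * v)) / 2"
definition "\<psi>' v = (deriv F (exp v) * exp v * exp (- (a * v)) - a * (F (exp v) * exp (- (a * v)))) / 2"

lemma F_deriv: "0 < x \<Longrightarrow> (F has_real_derivative deriv F x) (at x)"
  using Ck_onD[of 1 "{0<..}" F 0 x] nonlin by (simp add: admissible_nonlinearity_def)

lemma deriv_F_cont: "continuous_on {0<..} (deriv F)"
proof -
  have "\<forall>k\<le>1. continuous_on {0<..} ((deriv ^^ k) F)"
    using nonlin by (simp add: admissible_nonlinearity_def Ck_on_def)
  from this[rule_format, of 1] show ?thesis by simp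
qed

lemma F_cont: "continuous_on {0<..} F"
  by (intro continuous_at_imp_continuous_on ballI) (auto intro: DERIV_isCont[OF F_deriv])

lemma \<psi>_deriv: "(\<psi> has_real_derivative \<psi>' v) (at v)"
proof -
  have "((\<lambda>v. F (exp v)) has_real_derivative deriv F (exp v) * exp v) (at v)"
    by (rule DERIV_chain2[OF F_deriv DERIV_exp]) simp
  moreover have "((\<lambda>v. exp (- (a * v))) has_real_derivative exp (- (a * v)) * (- a)) (at v)"
    by (auto intro!: derivative_eq_intros)
  ultimately have "((\<lambda>v. F (exp v) * exp (- (a * v)) / 2) has_real_derivative
      (deriv F (exp v) * exp v * exp (- (a * v)) + exp (- (a * v)) * (- a) * F (exp v)) / 2) (at v)"
    by (intro DERIV_cdivide DERIV_mult)
  then show ?thesis unfolding \<psi>_def[abs_def] \<psi>'_def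
    by (rule DERIV_cong) (simp add: ac_simps)
qed

lemma \<psi>'_cont: "continuous_on UNIV \<psi>'"
  unfolding \<psi>'_def[abs_def]
  by (intro continuous_intros continuous_on_compose2[OF F_cont] continuous_on_compose2[OF deriv_F_cont]) auto

lemma F_le: "v \<le> Vm \<Longrightarrow> \<bar>F (exp v)\<bar> \<le> CF * exp (a * v)"
  and deriv_F_le: "v \<le> Vm \<Longrightarrow> \<bar>deriv F (exp v)\<bar> \<le> CF * exp ((a - 1) * v)"
proof -
  have "\<bar>F (exp v)\<bar> \<le> CF * exp v powr a \<and> \<bar>deriv F (exp v)\<bar> \<le> CF * exp v powr (a - 1)" if "v \<le> Vm"
    using nonlin that unfolding admissible_nonlinearity_def CF_def by simp
  then show "v \<le> Vm \<Longrightarrow> \<bar>F (exp v)\<bar> \<le> CF * exp (a * v)"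
    "v \<le> Vm \<Longrightarrow> \<bar>deriv F (exp v)\<bar> \<le> CF * exp ((a - 1) * v)"
    by (simp_all add: powr_def)
qed

lemma \<psi>_le: "v \<le> Vm \<Longrightarrow> \<bar>\<psi> v\<bar> \<le> CF / 2"
proof -
  assume v: "v \<le> Vm"
  have "\<bar>F (exp v)\<bar> * exp (- (a * v)) \<le> CF * exp (a * v) * exp (- (a * v))"
    by (intro mult_right_mono F_le v) auto
  also have "\<dots> = CF" by (simp add: exp_minus)
  finally show ?thesis by (simp add: \<psi>_def abs_mult)
qed

lemma \<psi>'_le: "v \<le> Vm \<Longrightarrow> \<bar>\<psi>' v\<bar> \<le> CF * (1 + a) / 2"
proof -
  assume v: "v \<le> Vm"
  have "\<bar>deriv F (exp v) * exp v * exp (- (a * v))\<bar> \<le> CF * exp ((a - 1) * v) * exp v * exp (- (a * v))"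
    unfolding abs_mult using deriv_F_le[OF v] by (intro mult_mono) auto
  also have "\<dots> = CF" by (simp add: mult_exp_exp algebra_simps)
  finally have 1: "\<bar>deriv F (exp v) * exp v * exp (- (a * v))\<bar> \<le> CF" .
  have "a * \<bar>2 * \<psi> v\<bar> \<le> a * CF" using \<psi>_le[OF v] exponents by (intro mult_left_mono) auto
  then have 2: "\<bar>a * (F (exp v) * exp (- (a * v)))\<bar> \<le> a * CF"
    using exponents by (simp add: \<psi>_def abs_mult)
  have "CF * (1 + a) = CF + a * CF" by (simp add: algebra_simps)
  moreover have "\<bar>deriv F (exp v) * exp v * exp (- (a * v)) - a * (F (exp v) * exp (- (a * v)))\<bar> \<le> CF + a * CF"
    by (rule order_trans[OF abs_triangle_ineq4 add_mono[OF 1 2]])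
  ultimately show ?thesis unfolding \<psi>'_def by simp
qed

lemma \<psi>_lip:
  assumes "v \<le> Vm" "w \<le> Vm" shows "\<bar>\<psi> v - \<psi> w\<bar> \<le> CF * (1 + a) / 2 * \<bar>v - w\<bar>"
proof -
  have le: "\<bar>\<psi> q - \<psi> p\<bar> \<le> CF * (1 + a) / 2 * \<bar>q - p\<bar>" if "p < q" "q \<le> Vm" for p q
  proof -
    from MVT2[OF that(1) \<psi>_deriv] obtain z where z: "p < z" "z < q" "\<psi> q - \<psi> p = (q - p) * \<psi>' z" by blast
    have "\<bar>q - p\<bar> * \<bar>\<psi>' z\<bar> \<le> \<bar>q - p\<bar> * (CF * (1 + a) / 2)"
      using z that by (intro mult_left_mono \<psi>'_le) auto
    with z(3) show ?thesis by (simp add: abs_mult mult.commute)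
  qed
  consider "v < w" | "w < v" | "v = w" by linarith
  then show ?thesis
    by cases (use le[of v w] le[of w v] assms in \<open>auto simp: abs_minus_commute\<close>)
qed

definition init :: "(real \<Rightarrow> real) \<Rightarrow> wave_component \<Rightarrow> real \<Rightarrow> real" where
  "init \<Xi> i y = (case i of Disp \<Rightarrow> 0 | Logu \<Rightarrow> ln (u0 (\<Xi> y))
     | Rinv \<Rightarrow> inv0 1 (\<Xi> y) / u0 (\<Xi> y) | Sinv \<Rightarrow> inv0 (-1) (\<Xi> y) / u0 (\<Xi> y))"

definition init' :: "(real \<Rightarrow> real) \<Rightarrow> wave_component \<Rightarrow> real \<Rightarrow> real" where
  "init' \<Xi> i y = (let x = \<Xi> y in case i of Disp \<Rightarrow> 0 | Logu \<Rightarrow> u0 x powr a * u0' x / u0 x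
     | Rinv \<Rightarrow> u0 x powr a * (inv0' 1 x * u0 x - inv0 1 x * u0' x) / (u0 x * u0 x)
     | Sinv \<Rightarrow> u0 x powr a * (inv0' (-1) x * u0 x - inv0 (-1) x * u0' x) / (u0 x * u0 x))"

text \<open>The quotient rule in the coordinate y. The derivative of R or S is controlled by the
  hypothesis with c4, and the other term is the product of two ratios, each at most
  \<open>\<omega>0\<close>.\<close>

lemma ratio_slope_le:
  assumes "\<sigma> \<in> {1, -1}"
  shows "\<bar>u0 x powr a * (inv0' \<sigma> x * u0 x - inv0 \<sigma> x * u0' x) / (u0 x * u0 x)\<bar> \<le> c4 * \<theta>0 x + (\<omega>0 x)\<^sup>2"
proof -
  have u: "0 < u0 x" by (rule u0_pos)
  have "u0 x powr a * (inv0' \<sigma> x * u0 x - inv0 \<sigma> x * u0' x) / (u0 x * u0 x)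
      = u0 x powr (a - 1) * inv0' \<sigma> x - inv0 \<sigma> x / u0 x * (u0 x powr a * u0' x / u0 x)"
    using u by (simp add: powr_diff field_simps)
  moreover have "\<bar>u0 x powr (a - 1) * inv0' \<sigma> x\<bar> \<le> u0 x powr (a - 1) * (c4 * japanese_bracket x powr (- \<gamma>))"
    using inv0'_le[OF assms] by (simp add: abs_mult mult_left_mono)
  moreover have "\<bar>inv0 \<sigma> x / u0 x * (u0 x powr a * u0' x / u0 x)\<bar> \<le> \<omega>0 x * \<omega>0 x"
    unfolding abs_mult[of "inv0 \<sigma> x / u0 x"]
    using weights_pos(1)[of x] by (intro mult_mono inv0_ratio[OF assms] log_slope_le) auto
  moreover have "u0 x powr (a - 1) * (c4 * japanese_bracket x powr (- \<gamma>)) = c4 * \<theta>0 x"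
    by (simp add: \<theta>0_def)
  ultimately show ?thesis unfolding power2_eq_square by linarith
qed

lemma ratio_slope_le_M:
  assumes "\<sigma> \<in> {1, -1}"
  shows "\<bar>u0 x powr a * (inv0' \<sigma> x * u0 x - inv0 \<sigma> x * u0' x) / (u0 x * u0 x)\<bar> \<le> M"
proof -
  have "c4 * \<theta>0 x \<le> c4 * \<Theta>" using \<theta>0_le c_pos by (intro mult_left_mono) auto
  moreover have "(\<omega>0 x)\<^sup>2 \<le> k\<^sup>2" using \<omega>0_le weights_pos(1)[of x] by (intro power_mono) auto
  moreover have "c4 * \<Theta> + k\<^sup>2 \<le> M" using const_pos by (simp add: M_def)
  ultimately show ?thesis using ratio_slope_le[OF assms, of x] by linarith
qed

lemma wave_data_init:
  assumes \<Xi>: "\<And>y. (\<Xi> has_real_derivative u0 (\<Xi> y) powr a) (at y)" and T: "good_time T"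
  shows "wave_data a b Vm (CF / 2) (CF * (1 + a) / 2) \<psi> \<psi>' (init \<Xi>) (init' \<Xi>) M T"
proof -
  interpret wave_system a b Vm "CF / 2" "CF * (1 + a) / 2" \<psi> \<psi>'
    by unfold_locales (use exponents const_pos \<psi>_le \<psi>_lip \<psi>_deriv in
      \<open>auto simp: b_def intro: continuous_on_subset[OF \<psi>'_cont]\<close>)
  have \<Xi>_cont: "continuous_on UNIV \<Xi>"
    by (intro continuous_at_imp_continuous_on ballI) (rule DERIV_isCont[OF \<Xi>])
  note comp = continuous_on_compose2[OF _ \<Xi>_cont subset_UNIV]
  have ne: "u0 x \<noteq> 0" "u0 x * u0 x \<noteq> 0" for x using u0_pos[of x] by auto
  show ?thesis
  proof
    show "(init \<Xi> i has_real_derivative init' \<Xi> i y) (at y)" for i y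
    proof (cases i)
      case Logu
      have "((\<lambda>y. ln (u0 (\<Xi> y))) has_real_derivative u0 (\<Xi> y) powr a * u0' (\<Xi> y) / u0 (\<Xi> y)) (at y)"
        using u0_pos[of "\<Xi> y"]
        by (auto intro!: derivative_eq_intros DERIV_chain2[OF u0_deriv(1)] \<Xi> simp: field_simps)
      then show ?thesis by (simp add: Logu init_def[abs_def] init'_def Let_def)
    next
      case Rinv
      have "((\<lambda>y. inv0 1 (\<Xi> y) / u0 (\<Xi> y)) has_real_derivative
          u0 (\<Xi> y) powr a * (inv0' 1 (\<Xi> y) * u0 (\<Xi> y) - inv0 1 (\<Xi> y) * u0' (\<Xi> y)) / (u0 (\<Xi> y) * u0 (\<Xi> y))) (at y)"
        using ne(1)[of "\<Xi> y"]
        by (auto intro!: derivative_eq_intros DERIV_chain2[OF u0_deriv(1)] DERIV_chain2[OF inv0_deriv] \<Xi>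
          simp: algebra_simps)
      then show ?thesis by (simp add: Rinv init_def[abs_def] init'_def Let_def)
    next
      case Sinv
      have "((\<lambda>y. inv0 (-1) (\<Xi> y) / u0 (\<Xi> y)) has_real_derivative
          u0 (\<Xi> y) powr a * (inv0' (-1) (\<Xi> y) * u0 (\<Xi> y) - inv0 (-1) (\<Xi> y) * u0' (\<Xi> y)) / (u0 (\<Xi> y) * u0 (\<Xi> y))) (at y)"
        using ne(1)[of "\<Xi> y"]
        by (auto intro!: derivative_eq_intros DERIV_chain2[OF u0_deriv(1)] DERIV_chain2[OF inv0_deriv] \<Xi>
          simp: algebra_simps)
      then show ?thesis by (simp add: Sinv init_def[abs_def] init'_def Let_def)
    qed (simp add: init_def[abs_def] init'_def)
    have c: "continuous_on UNIV (\<lambda>x. u0 x powr a * u0' x / u0 x)"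
      "continuous_on UNIV (\<lambda>x. u0 x powr a * (inv0' \<sigma> x * u0 x - inv0 \<sigma> x * u0' x) / (u0 x * u0 x))" for \<sigma>
      by (intro continuous_intros u0_cont inv0_cont; use ne in auto)+
    show "continuous_on UNIV (init' \<Xi> i)" for i
      using comp[OF c(1)] comp[OF c(2)] by (cases i) (simp_all add: init'_def[abs_def] Let_def)
    show "\<bar>init' \<Xi> i x\<bar> \<le> M" for i x
    proof (cases i)
      case Logu
      have "\<bar>init' \<Xi> i x\<bar> \<le> k"
        using order_trans[OF log_slope_le \<omega>0_le, of "\<Xi> x"] by (simp add: Logu init'_def Let_def)
      also have "k \<le> M" using const_pos c_pos by (simp add: M_def)
      finally show ?thesis .
    next
      case Disp
      have "0 \<le> M" using const_pos c_pos by (simp add: M_def)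
      then show ?thesis by (simp add: Disp init'_def)
    qed (use ratio_slope_le_M[of 1 "\<Xi> x"] ratio_slope_le_M[of "-1" "\<Xi> x"] in \<open>simp_all add: init'_def Let_def\<close>)
    show "init \<Xi> Disp x = 0" for x by (simp add: init_def)
    show "init \<Xi> Logu x \<le> Vm - 1" for x
      using u0_le[of "\<Xi> x"] u0_pos[of "\<Xi> x"] by (simp add: init_def Vm_def)
    show "\<bar>init \<Xi> Rinv x\<bar> \<le> b - 1" "\<bar>init \<Xi> Sinv x\<bar> \<le> b - 1" for x
      using order_trans[OF inv0_ratio \<omega>0_le, of 1 "\<Xi> x"] order_trans[OF inv0_ratio \<omega>0_le, of "-1" "\<Xi> x"]
      by (simp_all add: init_def b_def)
    show "init' \<Xi> Logu x = (init \<Xi> Rinv x - init \<Xi> Sinv x) / 2" for x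
      by (simp add: init_def init'_def Let_def slope_eq diff_divide_distrib)
    show "0 < T" "T \<le> 1" "T * lip * (1 + M)\<^sup>2 \<le> 1 / 64" "T * (M * exp a + bnd) \<le> 1 / 2"
      using T by (auto simp: good_time_def mult.assoc)
  qed
qed

text \<open>Both weights are exponentials of functions of \<open>y\<close> with slope at most \<open>D\<close>.\<close>

lemma weights_vary_slowly:
  assumes \<Xi>: "\<And>y. (\<Xi> has_real_derivative u0 (\<Xi> y) powr a) (at y)" and T: "good_time T"
    and xy: "\<bar>x - y\<bar> \<le> exp a * T"
  shows "\<omega>0 (\<Xi> y) \<le> 2 * \<omega>0 (\<Xi> x)" "\<theta>0 (\<Xi> y) \<le> 2 * \<theta>0 (\<Xi> x)"
proof -
  have r: "exp a * T * D \<le> ln 2" using T by (simp add: good_time_def ac_simps)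
  let ?l = "\<lambda>y. ln (japanese_bracket (\<Xi> y))" and ?v = "\<lambda>y. ln (u0 (\<Xi> y))"
  let ?l' = "\<lambda>y. \<Xi> y / (1 + (\<Xi> y)\<^sup>2) * u0 (\<Xi> y) powr a" and ?v' = "\<lambda>y. u0 (\<Xi> y) powr a * u0' (\<Xi> y) / u0 (\<Xi> y)"
  have dl: "(?l has_real_derivative ?l' y) (at y)" for y
    by (rule DERIV_chain2[OF ln_bracket_deriv \<Xi>])
  have dv: "(?v has_real_derivative ?v' y) (at y)" for y
    using u0_pos[of "\<Xi> y"]
    by (auto intro!: derivative_eq_intros DERIV_chain2[OF u0_deriv(1)] \<Xi> simp: field_simps)
  have l_le: "\<bar>?l' y\<bar> \<le> c2 powr a" for y
  proof -
    have "u0 (\<Xi> y) powr a \<le> c2 powr a" using u0_le[of "\<Xi> y"] u0_pos[of "\<Xi> y"] exponents by (intro powr_mono2) auto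
    then have "\<bar>\<Xi> y / (1 + (\<Xi> y)\<^sup>2)\<bar> * \<bar>u0 (\<Xi> y) powr a\<bar> \<le> 1 * c2 powr a"
      using bracket_slope_le by (intro mult_mono) auto
    then show ?thesis by (simp only: abs_mult)
  qed
  have v_le: "\<bar>?v' y\<bar> \<le> k" for y using order_trans[OF log_slope_le \<omega>0_le] .
  have \<omega>: "\<omega>0 (\<Xi> y) = c3 * exp (- \<beta> * ?l y - ?v y)" for y
    using bracket_ge_1[of "\<Xi> y"] u0_pos[of "\<Xi> y"]
    by (simp add: \<omega>0_def powr_def exp_diff)
  have \<theta>: "\<theta>0 (\<Xi> y) = exp ((a - 1) * ?v y - \<gamma> * ?l y)" for y
    using bracket_ge_1[of "\<Xi> y"] u0_pos[of "\<Xi> y"]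
    by (simp add: \<theta>0_def powr_def mult_exp_exp)
  have "exp (- \<beta> * ?l y - ?v y) \<le> 2 * exp (- \<beta> * ?l x - ?v x)"
  proof (rule ratio_le_2[OF _ _ r xy])
    show "((\<lambda>y. - \<beta> * ?l y - ?v y) has_real_derivative - \<beta> * ?l' y - ?v' y) (at y)" for y
      by (intro DERIV_diff DERIV_cmult dl dv)
    show "\<bar>- \<beta> * ?l' y - ?v' y\<bar> \<le> D" for y
    proof -
      have "\<bar>\<beta> * ?l' y\<bar> \<le> \<beta> * c2 powr a"
        using mult_left_mono[OF l_le exponents(3)] exponents by (simp add: abs_mult)
      moreover have "D = \<beta> * c2 powr a + \<gamma> * c2 powr a + a * k + 2 * k" by (simp add: D_def algebra_simps)
      moreover have "0 \<le> \<gamma> * c2 powr a" "0 \<le> a * k" using const_pos exponents by auto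
      ultimately show ?thesis
        using abs_triangle_ineq4[of "- \<beta> * ?l' y" "?v' y"] v_le[of y] const_pos(1) by simp
    qed
  qed
  then have "c3 * exp (- \<beta> * ?l y - ?v y) \<le> c3 * (2 * exp (- \<beta> * ?l x - ?v x))"
    using c_pos by (intro mult_left_mono) auto
  then show "\<omega>0 (\<Xi> y) \<le> 2 * \<omega>0 (\<Xi> x)" unfolding \<omega> by (simp add: ac_simps)
  show "\<theta>0 (\<Xi> y) \<le> 2 * \<theta>0 (\<Xi> x)"
    unfolding \<theta>
  proof (rule ratio_le_2[OF _ _ r xy])
    show "((\<lambda>y. (a - 1) * ?v y - \<gamma> * ?l y) has_real_derivative (a - 1) * ?v' y - \<gamma> * ?l' y) (at y)" for y
      by (intro DERIV_diff DERIV_cmult dl dv)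
    show "\<bar>(a - 1) * ?v' y - \<gamma> * ?l' y\<bar> \<le> D" for y
    proof -
      have 1: "\<bar>\<gamma> * ?l' y\<bar> \<le> \<gamma> * c2 powr a"
        using mult_left_mono[OF l_le const_pos(5)] const_pos by (simp add: abs_mult)
      have 2: "\<bar>(a - 1) * ?v' y\<bar> \<le> (a + 1) * k"
        unfolding abs_mult[of "a - 1"] using v_le exponents by (intro mult_mono) auto
      note order_trans[OF abs_triangle_ineq4 add_mono[OF 2 1]]
      also have "(a + 1) * k + \<gamma> * c2 powr a = D - (\<beta> * c2 powr a + k)" by (simp add: D_def algebra_simps)
      also have "\<dots> \<le> D"
        using mult_nonneg_nonneg[OF exponents(3), of "c2 powr a"] const_pos(1) by simp
      finally show ?thesis .
    qed
  qed
qed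

end


section \<open>Existence\<close>

text \<open>The derivatives are arguments, so the rules below compute them together with their
  continuity. The operators \<open>dt\<close> and \<open>dx\<close> are reached through
  \<open>C1_strip_dt\<close> and \<open>C1_strip_dx\<close>.\<close>

definition C1_strip :: "real \<Rightarrow> (real \<Rightarrow> real \<Rightarrow> real) \<Rightarrow> (real \<Rightarrow> real \<Rightarrow> real) \<Rightarrow> (real \<Rightarrow> real \<Rightarrow> real) \<Rightarrow> bool" where
  "C1_strip T f ft fx \<longleftrightarrow>
     (\<forall>t\<in>{0..T}. \<forall>x. ((\<lambda>s. f s x) has_real_derivative ft t x) (at t within {0..T}) \<and>
        ((\<lambda>y. f t y) has_real_derivative fx t x) (at x)) \<and>
     continuous_on ({0..T} \<times> UNIV) (\<lambda>p. f (fst p) (snd p)) \<and>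
     continuous_on ({0..T} \<times> UNIV) (\<lambda>p. ft (fst p) (snd p)) \<and>
     continuous_on ({0..T} \<times> UNIV) (\<lambda>p. fx (fst p) (snd p))"

lemma C1_stripD:
  assumes "C1_strip T f ft fx"
  shows "t \<in> {0..T} \<Longrightarrow> ((\<lambda>s. f s x) has_real_derivative ft t x) (at t within {0..T})"
    "t \<in> {0..T} \<Longrightarrow> ((\<lambda>y. f t y) has_real_derivative fx t x) (at x)"
    "continuous_on ({0..T} \<times> UNIV) (\<lambda>p. f (fst p) (snd p))"
    "continuous_on ({0..T} \<times> UNIV) (\<lambda>p. ft (fst p) (snd p))"
    "continuous_on ({0..T} \<times> UNIV) (\<lambda>p. fx (fst p) (snd p))"
  using assms by (auto simp: C1_strip_def)

lemma C1_strip_mult: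
  assumes f: "C1_strip T f ft fx" and g: "C1_strip T g gt gx"
  shows "C1_strip T (\<lambda>t x. f t x * g t x) (\<lambda>t x. ft t x * g t x + gt t x * f t x) (\<lambda>t x. fx t x * g t x + gx t x * f t x)"
  unfolding C1_strip_def
  by (intro conjI ballI allI DERIV_mult continuous_intros C1_stripD[OF f] C1_stripD[OF g])

lemma C1_strip_lincomb:
  assumes f: "C1_strip T f ft fx" and g: "C1_strip T g gt gx"
  shows "C1_strip T (\<lambda>t x. c * f t x + d * g t x) (\<lambda>t x. c * ft t x + d * gt t x) (\<lambda>t x. c * fx t x + d * gx t x)"
  unfolding C1_strip_def
  by (intro conjI ballI allI DERIV_add DERIV_cmult continuous_intros C1_stripD[OF f] C1_stripD[OF g])

lemma C1_strip_compose:
  assumes f: "C1_strip T f ft fx" and S: "\<And>t x. t \<in> {0..T} \<Longrightarrow> f t x \<in> S"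
    and \<phi>: "\<And>z. z \<in> S \<Longrightarrow> (\<phi> has_real_derivative \<phi>' z) (at z)" "continuous_on S \<phi>'"
  shows "C1_strip T (\<lambda>t x. \<phi> (f t x)) (\<lambda>t x. \<phi>' (f t x) * ft t x) (\<lambda>t x. \<phi>' (f t x) * fx t x)"
proof -
  have c: "continuous_on S \<phi>" by (intro continuous_at_imp_continuous_on ballI) (rule DERIV_isCont[OF \<phi>(1)])
  have "continuous_on ({0..T} \<times> UNIV) (\<lambda>p. \<phi> (f (fst p) (snd p)))"
    "continuous_on ({0..T} \<times> UNIV) (\<lambda>p. \<phi>' (f (fst p) (snd p)))"
    by (rule continuous_on_compose2[OF c C1_stripD(3)[OF f]] continuous_on_compose2[OF \<phi>(2) C1_stripD(3)[OF f]];
      use S in force)+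
  then show ?thesis
    unfolding C1_strip_def
    by (intro conjI ballI allI continuous_intros C1_stripD[OF f] DERIV_chain2[OF \<phi>(1)] S)
qed

lemma C1_strip_exp:
  assumes "C1_strip T f ft fx"
  shows "C1_strip T (\<lambda>t x. exp (c * f t x)) (\<lambda>t x. exp (c * f t x) * c * ft t x) (\<lambda>t x. exp (c * f t x) * c * fx t x)"
  by (rule C1_strip_compose[OF assms, where S = UNIV and \<phi> = "\<lambda>z. exp (c * z)"])
    (auto intro!: derivative_eq_intros continuous_intros)

lemma C1_strip_cong:
  assumes "C1_strip T f ft fx" and eq: "\<And>t x. t \<in> {0..T} \<Longrightarrow> g t x = f t x"
    "\<And>t x. t \<in> {0..T} \<Longrightarrow> gt t x = ft t x" "\<And>t x. t \<in> {0..T} \<Longrightarrow> gx t x = fx t x"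
  shows "C1_strip T g gt gx"
  unfolding C1_strip_def
proof (intro conjI ballI allI)
  fix t x assume t: "t \<in> {0..T}"
  show "((\<lambda>s. g s x) has_real_derivative gt t x) (at t within {0..T})"
    unfolding eq(2)[OF t]
    by (rule has_field_derivative_transform_within[OF C1_stripD(1)[OF assms(1) t] zero_less_one t]) (rule eq(1)[symmetric])
  show "((\<lambda>y. g t y) has_real_derivative gx t x) (at x)"
  proof -
    have "(\<lambda>y. g t y) = (\<lambda>y. f t y)" using eq(1)[OF t] by (rule ext)
    then show ?thesis unfolding eq(3)[OF t] using C1_stripD(2)[OF assms(1) t] by (simp only:)
  qed
next
  show "continuous_on ({0..T} \<times> UNIV) (\<lambda>p. g (fst p) (snd p))"
    using C1_stripD(3)[OF assms(1)] by (rule continuous_on_eq) (auto simp: eq)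
  show "continuous_on ({0..T} \<times> UNIV) (\<lambda>p. gt (fst p) (snd p))"
    using C1_stripD(4)[OF assms(1)] by (rule continuous_on_eq) (auto simp: eq)
  show "continuous_on ({0..T} \<times> UNIV) (\<lambda>p. gx (fst p) (snd p))"
    using C1_stripD(5)[OF assms(1)] by (rule continuous_on_eq) (auto simp: eq)
qed

lemma C1_strip_dt: "C1_strip T f ft fx \<Longrightarrow> 0 < T \<Longrightarrow> t \<in> {0..T} \<Longrightarrow> dt T f t x = ft t x"
  unfolding dt_def
  by (rule vector_derivative_within_closed_interval)
    (auto dest: C1_stripD(1) simp: has_real_derivative_iff_has_vector_derivative)

lemma C1_strip_dx: "C1_strip T f ft fx \<Longrightarrow> t \<in> {0..T} \<Longrightarrow> dx f t x = fx t x"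
  unfolding dx_def by (rule DERIV_imp_deriv) (rule C1_stripD(2))

lemma C1_strip_iff_Ck_strip:
  assumes "0 < T"
  shows "Ck_strip T 1 f \<longleftrightarrow> C1_strip T f (dt T f) (dx f)"
proof -
  have "((\<lambda>s. f s x) differentiable (at t within {0..T})) \<longleftrightarrow> ((\<lambda>s. f s x) has_real_derivative dt T f t x) (at t within {0..T})"
    if "t \<in> {0..T}" for t x
    unfolding dt_def has_real_derivative_iff_has_vector_derivative
    by (metis vector_derivative_works differentiableI_vector)
  moreover have "((\<lambda>y. f t y) differentiable (at x)) \<longleftrightarrow> ((\<lambda>y. f t y) has_real_derivative dx f t x) (at x)" for t x
    unfolding dx_def by (metis DERIV_deriv_iff_real_differentiable)
  ultimately show ?thesis by (auto simp: C1_strip_def case_prod_beta)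
qed

lemma C1_strip_Ck_strip:
  assumes "0 < T" "C1_strip T f ft fx"
  shows "Ck_strip T 1 f"
  unfolding C1_strip_iff_Ck_strip[OF assms(1)]
  by (rule C1_strip_cong[OF assms(2)]) (auto simp: C1_strip_dt[OF assms(2,1)] C1_strip_dx[OF assms(2)])

lemma Ck_strip_2_iff:
  assumes "0 < T"
  shows "Ck_strip T 2 f \<longleftrightarrow> C1_strip T f (dt T f) (dx f) \<and> C1_strip T (dt T f) (dt T (dt T f)) (dx (dt T f))
    \<and> C1_strip T (dx f) (dt T (dx f)) (dx (dx f))"
proof -
  have "Ck_strip T 2 f \<longleftrightarrow> Ck_strip T 1 f \<and> Ck_strip T 1 (dt T f) \<and> Ck_strip T 1 (dx f)"
    by (auto simp: numeral_2_eq_2)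
  then show ?thesis by (simp only: C1_strip_iff_Ck_strip[OF assms])
qed

lemma Ck_strip_2I:
  assumes "0 < T" "C1_strip T f ft fx" "C1_strip T ft ftt ftx" "C1_strip T fx fxt fxx"
  shows "Ck_strip T 2 f"
proof -
  have "C1_strip T (dt T f) ftt ftx" "C1_strip T (dx f) fxt fxx"
    by (rule C1_strip_cong[OF assms(3)] C1_strip_cong[OF assms(4)];
      simp add: C1_strip_dt[OF assms(2,1)] C1_strip_dx[OF assms(2)])+
  then have "Ck_strip T 1 (dt T f)" "Ck_strip T 1 (dx f)" "Ck_strip T 1 f"
    using C1_strip_Ck_strip[OF assms(1)] assms(2) by blast+
  then show ?thesis by (auto simp: numeral_2_eq_2)
qed


section \<open>Return to the original variables and the weighted bounds\<close>

context problem begin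

theorem existence:
  assumes good: "good_time T"
  shows "\<exists>u. cauchy_solution a F u0 u1 T u \<and>
    (\<exists>C1>0. \<exists>C2>0. \<exists>C3>0. \<exists>C4>0. solution_bounds a \<alpha> \<beta> \<gamma> C1 C2 C3 C4 T u)"
proof -
  have T0: "0 < T" using good by (simp add: good_time_def)
  have u0_ne: "u0 x \<noteq> 0" for x using u0_pos[of x] by simp
  have "c2 powr (- a) \<le> u0 x powr (- a)" for x
    using u0_le[of x] u0_pos[of x] exponents by (intro powr_mono2') auto
  moreover have "continuous_on UNIV (\<lambda>x. u0 x powr (- a))"
    by (intro continuous_intros u0_cont) (simp add: u0_ne)
  ultimately obtain Y \<Xi> where Y: "\<And>x. (Y has_real_derivative u0 x powr (- a)) (at x)"
    and \<Xi>Y: "\<And>x. \<Xi> (Y x) = x" and "\<And>y. (\<Xi> has_real_derivative inverse (u0 (\<Xi> y) powr (- a))) (at y)"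
    using ex_coordinate[of "\<lambda>x. u0 x powr (- a)" "c2 powr (- a)"] c_pos by auto
  then have \<Xi>: "(\<Xi> has_real_derivative u0 (\<Xi> y) powr a) (at y)" for y by (simp add: powr_minus)
  have Y_cont: "continuous_on UNIV Y"
    by (intro continuous_at_imp_continuous_on ballI) (rule DERIV_isCont[OF Y])
  have \<Xi>_cont: "continuous_on UNIV \<Xi>"
    by (intro continuous_at_imp_continuous_on ballI) (rule DERIV_isCont[OF \<Xi>])
  interpret wave_data a b Vm "CF / 2" "CF * (1 + a) / 2" \<psi> \<psi>' "init \<Xi>" "init' \<Xi>" M T
    by (rule wave_data_init[OF \<Xi> good])
  obtain U P where
    dxU: "\<And>i t x. t \<in> {0..T} \<Longrightarrow> ((\<lambda>y. U i t y) has_real_derivative P i t x) (at x)"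
    and dtV: "\<And>t x. t \<in> {0..T} \<Longrightarrow> ((\<lambda>s. U Logu s x) has_real_derivative (U Rinv t x + U Sinv t x) / 2) (at t within {0..T})"
    and dtR: "\<And>t x. t \<in> {0..T} \<Longrightarrow> ((\<lambda>s. U Rinv s x) has_real_derivative
       a / 2 * ((U Rinv t x - U Sinv t x) * U Rinv t x) + \<psi> (U Logu t x) * (U Rinv t x - U Sinv t x)
       - U Rinv t x * U Sinv t x + exp (a * (U Logu t x - init \<Xi> Logu x)) * P Rinv t x) (at t within {0..T})"
    and dtS: "\<And>t x. t \<in> {0..T} \<Longrightarrow> ((\<lambda>s. U Sinv s x) has_real_derivative
       a / 2 * ((U Sinv t x - U Rinv t x) * U Sinv t x) + \<psi> (U Logu t x) * (U Rinv t x - U Sinv t x)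
       - U Rinv t x * U Sinv t x - exp (a * (U Logu t x - init \<Xi> Logu x)) * P Sinv t x) (at t within {0..T})"
    and cU: "\<And>i. continuous_on ({0..T} \<times> UNIV) (\<lambda>(t, x). U i t x)"
    and cP: "\<And>i. continuous_on ({0..T} \<times> UNIV) (\<lambda>(t, x). P i t x)"
    and U_init: "\<And>i x. U i 0 x = init \<Xi> i x"
    and near: "\<And>t x. \<bar>U Logu t x - init \<Xi> Logu x\<bar> \<le> 1/2"
    and compat: "\<And>t x. t \<in> {0..T} \<Longrightarrow> P Logu t x = exp (- (a * (U Logu t x - init \<Xi> Logu x))) * (U Rinv t x - U Sinv t x) / 2"
    and decay: "\<forall>\<omega>. continuous_on UNIV \<omega> \<longrightarrow> (\<forall>x. 0 < \<omega> x) \<longrightarrow> (\<forall>x y. \<bar>x - y\<bar> \<le> exp a * T \<longrightarrow> \<omega> y \<le> 2 * \<omega> x) \<longrightarrow>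
       (\<forall>x. \<bar>init \<Xi> Rinv x\<bar> \<le> \<omega> x \<and> \<bar>init \<Xi> Sinv x\<bar> \<le> \<omega> x) \<longrightarrow>
       (\<forall>t\<in>{0..T}. \<forall>x. \<bar>U Rinv t x\<bar> \<le> 4 * \<omega> x \<and> \<bar>U Sinv t x\<bar> \<le> 4 * \<omega> x)"
    and slope_decay: "\<forall>\<theta> \<omega> A C. continuous_on UNIV \<theta> \<longrightarrow> (\<forall>x. 0 < \<theta> x) \<longrightarrow> (\<forall>x y. \<bar>x - y\<bar> \<le> exp a * T \<longrightarrow> \<theta> y \<le> 2 * \<theta> x) \<longrightarrow>
       (\<forall>x. 0 \<le> \<omega> x \<and> \<omega> x \<le> C \<and> (\<omega> x)\<^sup>2 \<le> A * \<theta> x) \<longrightarrow>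
       (\<forall>t\<in>{0..T}. \<forall>x. \<bar>U Rinv t x\<bar> \<le> \<omega> x \<and> \<bar>U Sinv t x\<bar> \<le> \<omega> x \<and> \<bar>P Logu t x\<bar> \<le> \<omega> x \<and> \<bar>P Logu t x - init' \<Xi> Logu x\<bar> \<le> \<omega> x) \<longrightarrow>
       (\<forall>x. \<bar>init' \<Xi> Rinv x\<bar> \<le> \<theta> x \<and> \<bar>init' \<Xi> Sinv x\<bar> \<le> \<theta> x) \<longrightarrow>
       (\<forall>t\<in>{0..T}. \<forall>x. \<bar>P Rinv t x\<bar> \<le> 2 * (4 + A) * \<theta> x \<and> \<bar>P Sinv t x\<bar> \<le> 2 * (4 + A) * \<theta> x)"
    by (rule wave_solution, rule that) assumption+
  note weights = weights_vary_slowly[OF \<Xi> good]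
  have ln_u0: "init \<Xi> Logu (Y x) = ln (u0 x)" for x by (simp add: init_def \<Xi>Y)
  define V where "V t x = U Logu t (Y x)" for t x
  define R where "R t x = U Rinv t (Y x)" for t x
  define S where "S t x = U Sinv t (Y x)" for t x
  define Rx where "Rx t x = P Rinv t (Y x) * u0 x powr (- a)" for t x
  define Sx where "Sx t x = P Sinv t (Y x) * u0 x powr (- a)" for t x
  define Rt where "Rt t x = a / 2 * ((R t x - S t x) * R t x) + \<psi> (V t x) * (R t x - S t x)
    - R t x * S t x + exp (a * V t x) * Rx t x" for t x
  define St where "St t x = a / 2 * ((S t x - R t x) * S t x) + \<psi> (V t x) * (R t x - S t x)
    - R t x * S t x - exp (a * V t x) * Sx t x" for t x
  \<comment> \<open>The factor \<open>u0 x powr (- a)\<close> is the derivative of \<open>Y\<close>;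
    it turns slopes in y into slopes in x and leaves u^a as the speed in x.\<close>
  have speed: "exp (a * (V t x - ln (u0 x))) = exp (a * V t x) * u0 x powr (- a)" for t x
    using u0_pos[of x] by (simp add: powr_def right_diff_distrib mult_exp_exp)
  have slice: "((\<lambda>y. U i t (Y y)) has_real_derivative P i t (Y x) * u0 x powr (- a)) (at x)" if "t \<in> {0..T}" for i t x
    by (rule DERIV_chain2[OF dxU[OF that] Y])
  have cont: "continuous_on ({0..T} \<times> UNIV) (\<lambda>p. h (fst p) (Y (snd p)))"
    if "continuous_on ({0..T} \<times> UNIV) (\<lambda>(t, x). h t x)" for h :: "real \<Rightarrow> real \<Rightarrow> real"
  proof -
    have "continuous_on ({0..T} \<times> UNIV) (\<lambda>p. (fst p, Y (snd p)))"
      by (intro continuous_intros continuous_on_compose2[OF Y_cont]) auto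
    from continuous_on_compose2[OF that this] show ?thesis by (simp add: image_subset_iff mem_Times_iff)
  qed
  have cV: "continuous_on ({0..T} \<times> UNIV) (\<lambda>p. V (fst p) (snd p))"
    and cR: "continuous_on ({0..T} \<times> UNIV) (\<lambda>p. R (fst p) (snd p))"
    and cS: "continuous_on ({0..T} \<times> UNIV) (\<lambda>p. S (fst p) (snd p))"
    unfolding V_def R_def S_def by (intro cont cU)+
  have cu0: "continuous_on ({0..T} \<times> UNIV) (\<lambda>p. u0 (snd p) powr (- a))"
    by (intro continuous_intros continuous_on_compose2[OF u0_cont(1)]) (auto simp: u0_ne)
  have cRx: "continuous_on ({0..T} \<times> UNIV) (\<lambda>p. Rx (fst p) (snd p))"
    and cSx: "continuous_on ({0..T} \<times> UNIV) (\<lambda>p. Sx (fst p) (snd p))"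
    unfolding Rx_def Sx_def by (intro continuous_on_mult cont cP cu0)+
  have c\<psi>: "continuous_on ({0..T} \<times> UNIV) (\<lambda>p. \<psi> (V (fst p) (snd p)))"
  proof -
    have "continuous_on UNIV \<psi>"
      by (intro continuous_at_imp_continuous_on ballI) (rule DERIV_isCont[OF problem.\<psi>_deriv[OF problem_axioms]])
    from continuous_on_compose2[OF this cV] show ?thesis by simp
  qed
  \<comment> \<open>In x the relation \<open>compat\<close> loses its dependence on
    \<open>u0\<close> and says that u^a u_x / u is half the difference of the ratios.\<close>
  have hV: "C1_strip T V (\<lambda>t x. 1/2 * R t x + 1/2 * S t x) (\<lambda>t x. exp (- (a * V t x)) * (1/2 * R t x - 1/2 * S t x))"
    unfolding C1_strip_def
  proof (intro conjI ballI allI)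
    fix t x assume t: "t \<in> {0..T}"
    show "((\<lambda>s. V s x) has_real_derivative 1/2 * R t x + 1/2 * S t x) (at t within {0..T})"
      using dtV[OF t, of "Y x"] by (simp add: V_def R_def S_def add_divide_distrib)
    have "exp (a * ln (u0 x)) * u0 x powr (- a) = 1"
      using u0_pos[of x] by (simp add: powr_def mult_exp_exp)
    then have "P Logu t (Y x) * u0 x powr (- a) = exp (- (a * V t x)) * (1/2 * R t x - 1/2 * S t x)"
      unfolding compat[OF t] ln_u0 V_def[symmetric] R_def[symmetric] S_def[symmetric]
      by (simp add: right_diff_distrib exp_diff exp_minus field_simps)
    with slice[OF t, of Logu x]
    show "((\<lambda>y. V t y) has_real_derivative exp (- (a * V t x)) * (1/2 * R t x - 1/2 * S t x)) (at x)"
      unfolding V_def[symmetric] by simp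
  qed (intro continuous_intros cV cR cS)+
  have cRt: "continuous_on ({0..T} \<times> UNIV) (\<lambda>p. Rt (fst p) (snd p))"
    and cSt: "continuous_on ({0..T} \<times> UNIV) (\<lambda>p. St (fst p) (snd p))"
    unfolding Rt_def St_def by (intro continuous_intros cV cR cS cRx cSx c\<psi>)+
  have hR: "C1_strip T R Rt Rx"
    unfolding C1_strip_def
  proof (intro conjI ballI allI)
    fix t x assume t: "t \<in> {0..T}"
    show "((\<lambda>s. R s x) has_real_derivative Rt t x) (at t within {0..T})"
      using dtR[OF t, of "Y x"] unfolding ln_u0 V_def[symmetric] R_def[symmetric] S_def[symmetric] speed
      by (simp add: Rt_def Rx_def ac_simps)
    show "((\<lambda>y. R t y) has_real_derivative Rx t x) (at x)"
      using slice[OF t, of Rinv x] unfolding R_def[symmetric] Rx_def .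
  qed (rule cR cRt cRx)+
  have hS: "C1_strip T S St Sx"
    unfolding C1_strip_def
  proof (intro conjI ballI allI)
    fix t x assume t: "t \<in> {0..T}"
    show "((\<lambda>s. S s x) has_real_derivative St t x) (at t within {0..T})"
      using dtS[OF t, of "Y x"] unfolding ln_u0 V_def[symmetric] R_def[symmetric] S_def[symmetric] speed
      by (simp add: St_def Sx_def ac_simps)
    show "((\<lambda>y. S t y) has_real_derivative Sx t x) (at x)"
      using slice[OF t, of Sinv x] unfolding S_def[symmetric] Sx_def .
  qed (rule cS cSt cSx)+
  define u where "u t x = exp (V t x)" for t x
  \<comment> \<open>The factors \<open>1 *\<close> and \<open>(- 1/2)\<close> here and below are
    those that the rules for \<open>C1_strip\<close> produce, so that folding the definitions
    matches literally.\<close>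
  define ut where "ut t x = exp (1 * V t x) * (1/2 * R t x + 1/2 * S t x)" for t x
  define ux where "ux t x = exp ((1 - a) * V t x) * (1/2 * R t x + (- 1/2) * S t x)" for t x
  define flux where "flux t x = exp ((1 + a) * V t x) * (1/2 * R t x + (- 1/2) * S t x)" for t x
  have hu: "C1_strip T u ut ux"
    by (rule C1_strip_cong[OF C1_strip_exp[OF hV, of 1]])
      (simp_all add: u_def ut_def ux_def left_diff_distrib exp_diff exp_minus field_simps)
  note hut = C1_strip_mult[OF C1_strip_exp[OF hV, of 1] C1_strip_lincomb[OF hR hS, of "1/2" "1/2"], folded ut_def]
  note hux = C1_strip_mult[OF C1_strip_exp[OF hV, of "1 - a"] C1_strip_lincomb[OF hR hS, of "1/2" "- 1/2"], folded ux_def]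
  note hflux = C1_strip_mult[OF C1_strip_exp[OF hV, of "1 + a"] C1_strip_lincomb[OF hR hS, of "1/2" "- 1/2"], folded flux_def]
  note hER = C1_strip_mult[OF C1_strip_exp[OF hV, of 1] hR] and hES = C1_strip_mult[OF C1_strip_exp[OF hV, of 1] hS]
  have dtu: "dt T u t x = ut t x" and dxu: "dx u t x = ux t x" if "t \<in> {0..T}" for t x
    using C1_strip_dt[OF hu T0 that] C1_strip_dx[OF hu that] by auto
  have u_pow: "u t x powr p = exp (p * V t x)" for t x p by (simp add: u_def powr_def)
  have solution: "cauchy_solution a F u0 u1 T u"
    unfolding cauchy_solution_def
  proof (intro conjI ballI allI)
    show "Ck_strip T 2 u" by (rule Ck_strip_2I[OF T0 hu hut hux])
  next
    fix t x assume "t \<in> {0<..T}"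
    then have t: "t \<in> {0..T}" by auto
    have h: "dt T (dt T u) t x = exp (1 * V t x) * 1 * (1/2 * R t x + 1/2 * S t x) * (1/2 * R t x + 1/2 * S t x)
        + (1/2 * Rt t x + 1/2 * St t x) * exp (1 * V t x)"
      by (rule C1_strip_dt[OF C1_strip_cong[OF hut dtu refl refl] T0 t])
    have fl: "u s y powr (2 * a) * dx u s y = flux s y" if "s \<in> {0..T}" for s y
    proof -
      have e: "exp (2 * a * V s y) * exp ((1 - a) * V s y) = exp ((1 + a) * V s y)"
        by (simp add: mult_exp_exp algebra_simps)
      show ?thesis unfolding dxu[OF that] u_pow ux_def flux_def e[symmetric] by (simp only: mult.assoc)
    qed
    have h': "dx (\<lambda>s y. u s y powr (2 * a) * dx u s y) t x
        = exp ((1 + a) * V t x) * (1 + a) * (exp (- (a * V t x)) * (1/2 * R t x - 1/2 * S t x)) * (1/2 * R t x + (- 1/2) * S t x)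
        + (1/2 * Rx t x + (- 1/2) * Sx t x) * exp ((1 + a) * V t x)"
      by (rule C1_strip_dx[OF C1_strip_cong[OF hflux fl refl refl] t])
    let ?e = "exp (1 * V t x)" and ?A = "exp (a * V t x)" and ?B = "exp (- (a * V t x))"
    have AB: "?B = 1 / ?A" "?A \<noteq> 0" by (simp_all add: exp_minus divide_inverse)
    have pw: "exp ((1 + a) * V t x) = ?e * ?A" "exp ((1 - a) * V t x) = ?e * ?B"
      by (simp_all add: mult_exp_exp algebra_simps)
    have uV: "u t x = exp (V t x)" by (simp add: u_def)
    have \<psi>_eq: "\<psi> (V t x) = F (exp (V t x)) * ?B / 2" by (simp add: \<psi>_def)
    \<comment> \<open>The wave equation, read with e = u, A = u^a and f = F(u). The term -r s turns
      the square of (r + s)/2 into the square of (r - s)/2, which joins the terms with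
      \<open>a / 2\<close> to form the factor 1 + a that arises from differentiating the
      flux.\<close>
    have alg: "e * 1 * (1/2 * r + 1/2 * s) * (1/2 * r + 1/2 * s) +
      (1/2 * (a / 2 * ((r - s) * r) + f * B / 2 * (r - s) - r * s + A * rx)
        + 1/2 * (a / 2 * ((s - r) * s) + f * B / 2 * (r - s) - r * s - A * sx)) * e
      = e * A * (1 + a) * (B * (1/2 * r - 1/2 * s)) * (1/2 * r + (- 1/2) * s)
        + (1/2 * rx + (- 1/2) * sx) * (e * A) + f * (e * B * (1/2 * r + (- 1/2) * s))"
      if "B = 1 / A" "A \<noteq> 0" for e r s f A B rx sx :: real
      using that(2) unfolding that(1) by (simp add: field_simps)
    show "dt T (dt T u) t x = dx (\<lambda>s y. u s y powr (2 * a) * dx u s y) t x + F (u t x) * dx u t x"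
      unfolding h h' dxu[OF t] Rt_def St_def ux_def uV pw \<psi>_eq
      by (rule alg[OF AB])
  next
    fix x
    have 0: "0 \<in> {0..T}" using T0 by simp
    have init0: "V 0 x = ln (u0 x)" "R 0 x = inv0 1 x / u0 x" "S 0 x = inv0 (-1) x / u0 x"
      by (simp_all add: V_def R_def S_def U_init init_def \<Xi>Y)
    show "u 0 x = u0 x" using u0_pos[of x] by (simp add: u_def init0)
    show "dt T u 0 x = u1 x"
      using u0_pos[of x] by (simp add: dtu[OF 0] ut_def init0 inv0_def field_simps)
  qed
  \<comment> \<open>With this factor \<open>q * \<omega>0\<close> dominates the ratios (4), the
    slope of ln u in y (4 exp (a/2)), and the difference of that slope from its initial value (one
    more \<open>\<omega>0\<close>). \<open>H\<close> and \<open>Q\<close> will be the constants of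
    the slopes and of products of two ratios, relative to \<open>\<theta>0\<close>.\<close>
  define q where "q = 4 * exp (a / 2) + 1"
  define A where "A = q\<^sup>2"
  define H where "H = 2 * (4 + A) * (c4 + A0)"
  define Q where "Q = A * (c4 + A0)"
  have q: "5 \<le> q" using exponents by (simp add: q_def)
  have A: "0 \<le> A" by (simp add: A_def)
  have c4A: "0 < c4 + A0" using c_pos const_pos by simp
  have H: "0 \<le> H" and Q: "0 \<le> Q" using A c4A by (auto simp: H_def Q_def)
  have bracket_cont: "continuous_on UNIV japanese_bracket"
    unfolding japanese_bracket_def[abs_def] by (intro continuous_intros)
  have j_ne: "japanese_bracket x \<noteq> 0" for x using bracket_ge_1[of x] by linarith
  have \<omega>_cont: "continuous_on UNIV (\<lambda>y. \<omega>0 (\<Xi> y))"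
    unfolding \<omega>0_def
    by (intro continuous_intros continuous_on_compose2[OF u0_cont(1) \<Xi>_cont]
      continuous_on_compose2[OF bracket_cont \<Xi>_cont]; simp add: u0_ne j_ne)
  have \<theta>_cont: "continuous_on UNIV (\<lambda>y. \<theta>0 (\<Xi> y))"
    unfolding \<theta>0_def
    by (intro continuous_intros continuous_on_compose2[OF u0_cont(1) \<Xi>_cont]
      continuous_on_compose2[OF bracket_cont \<Xi>_cont]; simp add: u0_ne j_ne)
  have init_le: "\<bar>init \<Xi> Rinv y\<bar> \<le> \<omega>0 (\<Xi> y)" "\<bar>init \<Xi> Sinv y\<bar> \<le> \<omega>0 (\<Xi> y)" for y
    using inv0_ratio[of 1 "\<Xi> y"] inv0_ratio[of "-1" "\<Xi> y"] by (simp_all add: init_def)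
  have RS_le: "\<bar>U Rinv t y\<bar> \<le> 4 * \<omega>0 (\<Xi> y)" "\<bar>U Sinv t y\<bar> \<le> 4 * \<omega>0 (\<Xi> y)" if "t \<in> {0..T}" for t y
    using decay[rule_format, OF \<omega>_cont weights_pos(1) weights(1) _ that] init_le by blast+
  have sq_le: "(q * \<omega>0 x)\<^sup>2 \<le> A * ((c4 + A0) * \<theta>0 x)" for x
  proof -
    have "(q * \<omega>0 x)\<^sup>2 \<le> A * (A0 * \<theta>0 x)"
      using \<omega>0_sq_le[of x] by (simp add: power_mult_distrib A_def mult_left_mono)
    also have "\<dots> \<le> A * ((c4 + A0) * \<theta>0 x)"
      using A c_pos weights_pos(2)[of x] by (intro mult_left_mono mult_right_mono) auto
    finally show ?thesis .
  qed
  have V_near: "\<bar>V t x - ln (u0 x)\<bar> \<le> 1/2" for t x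
    using near[of t "Y x"] by (simp add: V_def ln_u0)
  have P_Logu_le: "\<bar>P Logu t y\<bar> \<le> 4 * exp (a / 2) * \<omega>0 (\<Xi> y)" if t: "t \<in> {0..T}" for t y
  proof -
    have "- (a * (U Logu t y - init \<Xi> Logu y)) \<le> a / 2"
    proof -
      have "a * (- (U Logu t y - init \<Xi> Logu y)) \<le> a * (1 / 2)"
        by (rule mult_left_mono[OF _ exponents(1)]) (use near[of t y] in \<open>unfold abs_le_iff, linarith\<close>)
      then show ?thesis by (simp only: mult_minus_right times_divide_eq_right mult_1_right)
    qed
    moreover have "\<bar>U Rinv t y - U Sinv t y\<bar> \<le> 8 * \<omega>0 (\<Xi> y)"
      using abs_triangle_ineq4[of "U Rinv t y" "U Sinv t y"] RS_le[OF t, of y] by linarith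
    ultimately have "exp (- (a * (U Logu t y - init \<Xi> Logu y))) * \<bar>U Rinv t y - U Sinv t y\<bar>
        \<le> exp (a / 2) * (8 * \<omega>0 (\<Xi> y))"
      by (intro mult_mono) auto
    then show ?thesis unfolding compat[OF t] by (simp add: abs_mult)
  qed
  have P_le: "\<bar>P Rinv t y\<bar> \<le> H * \<theta>0 (\<Xi> y)" "\<bar>P Sinv t y\<bar> \<le> H * \<theta>0 (\<Xi> y)" if t: "t \<in> {0..T}" for t y
  proof -
    \<comment> \<open>The weight \<open>(c4 + A0) * \<theta>0\<close> dominates the initial slopes,
      which are at most \<open>c4 * \<theta>0 + \<omega>0\<^sup>2\<close>, by
      \<open>\<omega>0_sq_le\<close>.\<close>
    have "\<forall>t\<in>{0..T}. \<forall>y. \<bar>P Rinv t y\<bar> \<le> 2 * (4 + A) * ((c4 + A0) * \<theta>0 (\<Xi> y)) \<and>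
        \<bar>P Sinv t y\<bar> \<le> 2 * (4 + A) * ((c4 + A0) * \<theta>0 (\<Xi> y))"
    proof (rule slope_decay[THEN spec, THEN spec, THEN spec, THEN spec, THEN mp, THEN mp, THEN mp, THEN mp, THEN mp, THEN mp,
          of _ "\<lambda>y. q * \<omega>0 (\<Xi> y)" "q * k"])
      show "continuous_on UNIV (\<lambda>y. (c4 + A0) * \<theta>0 (\<Xi> y))" by (intro continuous_intros \<theta>_cont)
      show "\<forall>y. 0 < (c4 + A0) * \<theta>0 (\<Xi> y)" using c4A weights_pos(2) by auto
      show "\<forall>x y. \<bar>x - y\<bar> \<le> exp a * T \<longrightarrow> (c4 + A0) * \<theta>0 (\<Xi> y) \<le> 2 * ((c4 + A0) * \<theta>0 (\<Xi> x))"
      proof (intro allI impI)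
        fix x y assume "\<bar>x - y\<bar> \<le> exp a * T"
        from mult_left_mono[OF weights(2)[OF this], of "c4 + A0"] c4A
        show "(c4 + A0) * \<theta>0 (\<Xi> y) \<le> 2 * ((c4 + A0) * \<theta>0 (\<Xi> x))" by simp
      qed
      show "\<forall>y. 0 \<le> q * \<omega>0 (\<Xi> y) \<and> q * \<omega>0 (\<Xi> y) \<le> q * k \<and> (q * \<omega>0 (\<Xi> y))\<^sup>2 \<le> A * ((c4 + A0) * \<theta>0 (\<Xi> y))"
        using sq_le \<omega>0_le less_imp_le[OF weights_pos(1)] q by (simp add: mult_left_mono)
      show "\<forall>t\<in>{0..T}. \<forall>y. \<bar>U Rinv t y\<bar> \<le> q * \<omega>0 (\<Xi> y) \<and> \<bar>U Sinv t y\<bar> \<le> q * \<omega>0 (\<Xi> y) \<and>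
          \<bar>P Logu t y\<bar> \<le> q * \<omega>0 (\<Xi> y) \<and> \<bar>P Logu t y - init' \<Xi> Logu y\<bar> \<le> q * \<omega>0 (\<Xi> y)"
      proof (intro ballI allI)
        fix t y assume t: "t \<in> {0..T}"
        have "4 * \<omega>0 (\<Xi> y) \<le> q * \<omega>0 (\<Xi> y)" using q weights_pos(1)[of "\<Xi> y"] by (intro mult_right_mono) auto
        moreover have "q * \<omega>0 (\<Xi> y) = 4 * exp (a / 2) * \<omega>0 (\<Xi> y) + \<omega>0 (\<Xi> y)" by (simp add: q_def algebra_simps)
        moreover have "\<bar>init' \<Xi> Logu y\<bar> \<le> \<omega>0 (\<Xi> y)" using log_slope_le[of "\<Xi> y"] by (simp add: init'_def Let_def)
        ultimately show "\<bar>U Rinv t y\<bar> \<le> q * \<omega>0 (\<Xi> y) \<and> \<bar>U Sinv t y\<bar> \<le> q * \<omega>0 (\<Xi> y) \<and>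
          \<bar>P Logu t y\<bar> \<le> q * \<omega>0 (\<Xi> y) \<and> \<bar>P Logu t y - init' \<Xi> Logu y\<bar> \<le> q * \<omega>0 (\<Xi> y)"
          using RS_le[OF t, of y] P_Logu_le[OF t, of y] weights_pos(1)[of "\<Xi> y"]
            abs_triangle_ineq4[of "P Logu t y" "init' \<Xi> Logu y"] by linarith
      qed
      show "\<forall>y. \<bar>init' \<Xi> Rinv y\<bar> \<le> (c4 + A0) * \<theta>0 (\<Xi> y) \<and> \<bar>init' \<Xi> Sinv y\<bar> \<le> (c4 + A0) * \<theta>0 (\<Xi> y)"
      proof
        fix y
        show "\<bar>init' \<Xi> Rinv y\<bar> \<le> (c4 + A0) * \<theta>0 (\<Xi> y) \<and> \<bar>init' \<Xi> Sinv y\<bar> \<le> (c4 + A0) * \<theta>0 (\<Xi> y)"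
          using ratio_slope_le[of 1 "\<Xi> y"] ratio_slope_le[of "-1" "\<Xi> y"] \<omega>0_sq_le[of "\<Xi> y"]
          by (simp add: init'_def Let_def algebra_simps)
      qed
    qed
    then show "\<bar>P Rinv t y\<bar> \<le> H * \<theta>0 (\<Xi> y)" "\<bar>P Sinv t y\<bar> \<le> H * \<theta>0 (\<Xi> y)"
      using t by (auto simp: H_def mult.assoc)
  qed
  define C3 where "C3 = 4 * exp (1/2) * c3"
  define C4t where "C4t = exp (1/2) * (((a + 2) * Q + exp (a / 2) * H) * c2 powr a + 4 * CF * c3)"
  define C4x where "C4x = exp (1/2) * (Q + H)"
  \<comment> \<open>Stated for arbitrary \<open>r\<close>, \<open>rt\<close> and \<open>rx\<close>
    within the common bounds, so that it covers both signs.\<close>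
  have inv_bounds: "\<bar>exp (1 * V t x) * r\<bar> \<le> C3 * japanese_bracket x powr (- \<beta>)"
      "\<bar>exp (1 * V t x) * 1 * (1/2 * R t x + 1/2 * S t x) * r + rt * exp (1 * V t x)\<bar> \<le> C4t * japanese_bracket x powr (- \<gamma>)"
      "\<bar>exp (1 * V t x) * 1 * (exp (- (a * V t x)) * (1/2 * R t x - 1/2 * S t x)) * r + rx * exp (1 * V t x)\<bar>
        \<le> C4x * japanese_bracket x powr (- \<gamma>)"
    if t: "t \<in> {0..T}" and r: "\<bar>r\<bar> \<le> 4 * \<omega>0 x" and rx: "\<bar>rx\<bar> \<le> H * \<theta>0 x * u0 x powr (- a)"
      and rt: "\<bar>rt\<bar> \<le> (a + 1) * (Q * \<theta>0 x) + 4 * CF * \<omega>0 x + exp (a / 2) * (H * \<theta>0 x)"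
    for t x r rt rx
  proof -
    let ?e = "exp (1 * V t x)" and ?j = "japanese_bracket x" and ?W = "q * \<omega>0 x"
    note pos = weights_pos(1)[of x] weights_pos(2)[of x] u0_pos[of x]
    have e: "?e \<le> exp (1/2) * u0 x"
    proof -
      have "?e \<le> exp (1/2 + ln (u0 x))" using V_near[of t x] unfolding abs_le_iff by auto
      then show ?thesis using pos by (simp add: exp_add)
    qed
    \<comment> \<open>Multiplication by \<open>u0\<close>, which is comparable with u, turns the
      weights back into powers of <x>. For time derivatives a factor u0^a \<le> c2^a remains; for x
      derivatives it is cancelled by the change of coordinate.\<close>
    have u\<omega>: "u0 x * \<omega>0 x = c3 * ?j powr (- \<beta>)" using pos by (simp add: \<omega>0_def)
    have u\<theta>: "u0 x * \<theta>0 x \<le> c2 powr a * ?j powr (- \<gamma>)"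
    proof -
      have "u0 x * \<theta>0 x = u0 x powr a * ?j powr (- \<gamma>)" using pos by (simp add: \<theta>0_def powr_diff)
      also have "\<dots> \<le> c2 powr a * ?j powr (- \<gamma>)"
        using u0_le[of x] pos exponents by (intro mult_right_mono powr_mono2) auto
      finally show ?thesis .
    qed
    have u\<theta>x: "u0 x * (\<theta>0 x * u0 x powr (- a)) = ?j powr (- \<gamma>)"
      using pos by (simp add: \<theta>0_def powr_diff powr_minus)
    have scale: "\<bar>?e * z\<bar> \<le> exp (1/2) * (u0 x * w)" if "\<bar>z\<bar> \<le> w" for z w
    proof -
      have "?e * \<bar>z\<bar> \<le> exp (1/2) * u0 x * w" using e that pos by (intro mult_mono) auto
      then show ?thesis by (simp add: abs_mult)
    qed
    have "exp (1/2) * (u0 x * (4 * \<omega>0 x)) = 4 * exp (1/2) * (u0 x * \<omega>0 x)" by (simp only: ac_simps)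
    also have "\<dots> = C3 * ?j powr (- \<beta>)" unfolding u\<omega> C3_def by (simp only: ac_simps)
    finally show "\<bar>?e * r\<bar> \<le> C3 * ?j powr (- \<beta>)" using scale[OF r] by (simp only:)
    have RS: "\<bar>R t x\<bar> \<le> 4 * \<omega>0 x" "\<bar>S t x\<bar> \<le> 4 * \<omega>0 x"
      using RS_le[OF t, of "Y x"] by (simp_all add: R_def S_def \<Xi>Y)
    have q\<omega>: "4 * \<omega>0 x \<le> ?W" "4 * exp (a / 2) * \<omega>0 x \<le> ?W"
    proof -
      show "4 * \<omega>0 x \<le> ?W" using q pos by (intro mult_right_mono) auto
      have "?W = 4 * exp (a / 2) * \<omega>0 x + \<omega>0 x" by (simp add: q_def algebra_simps)
      then show "4 * exp (a / 2) * \<omega>0 x \<le> ?W" using pos by linarith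
    qed
    have W2: "?W * ?W \<le> Q * \<theta>0 x" using sq_le[of x] by (simp add: Q_def power2_eq_square)
    have half: "\<bar>1/2 * R t x + 1/2 * S t x\<bar> \<le> 4 * \<omega>0 x" "\<bar>1/2 * R t x - 1/2 * S t x\<bar> \<le> 4 * \<omega>0 x"
      using RS abs_triangle_ineq[of "1/2 * R t x" "1/2 * S t x"] abs_triangle_ineq4[of "1/2 * R t x" "1/2 * S t x"]
      by (simp_all add: abs_mult)
    have 1: "\<bar>(1/2 * R t x + 1/2 * S t x) * r\<bar> \<le> Q * \<theta>0 x"
    proof -
      have "\<bar>(1/2 * R t x + 1/2 * S t x) * r\<bar> \<le> ?W * ?W"
        unfolding abs_mult using pos q
        by (intro mult_mono order_trans[OF half(1) q\<omega>(1)] order_trans[OF r q\<omega>(1)]) auto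
      with W2 show ?thesis by linarith
    qed
    have fact: "?e * 1 * z * r + w * ?e = ?e * (z * r + w)" for z w by (simp add: algebra_simps)
    have "Q * \<theta>0 x + ((a + 1) * (Q * \<theta>0 x) + 4 * CF * \<omega>0 x + exp (a / 2) * (H * \<theta>0 x))
        = ((a + 2) * Q + exp (a / 2) * H) * \<theta>0 x + 4 * CF * \<omega>0 x" by (simp add: algebra_simps)
    note scale[OF order_trans[OF abs_triangle_ineq add_mono[OF 1 rt], unfolded this]]
    also have "exp (1/2) * (u0 x * (((a + 2) * Q + exp (a / 2) * H) * \<theta>0 x + 4 * CF * \<omega>0 x))
        = exp (1/2) * (((a + 2) * Q + exp (a / 2) * H) * (u0 x * \<theta>0 x) + 4 * CF * (u0 x * \<omega>0 x))"
      by (simp only: distrib_left mult.left_commute)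
    also have "\<dots> \<le> exp (1/2) * (((a + 2) * Q + exp (a / 2) * H) * (c2 powr a * ?j powr (- \<gamma>)) + 4 * CF * (c3 * ?j powr (- \<gamma>)))"
    proof (intro mult_left_mono add_mono u\<theta>)
      \<comment> \<open>The term with F is linear in the ratios and is measured by
        \<open>\<omega>0\<close>; its decay is sufficient because \<gamma> \<le> \<beta>.\<close>
      show "u0 x * \<omega>0 x \<le> c3 * ?j powr (- \<gamma>)"
        unfolding u\<omega> using c_pos gamma_le by (intro mult_left_mono bracket_powr_mono) auto
    qed (use Q H exponents const_pos in auto)
    also have "\<dots> = C4t * ?j powr (- \<gamma>)"
      unfolding C4t_def by (simp only: distrib_left distrib_right mult.assoc)
    finally show "\<bar>?e * 1 * (1/2 * R t x + 1/2 * S t x) * r + rt * ?e\<bar> \<le> C4t * ?j powr (- \<gamma>)"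
      unfolding fact .
    have 2: "\<bar>exp (- (a * V t x)) * (1/2 * R t x - 1/2 * S t x)\<bar> \<le> ?W * u0 x powr (- a)"
    proof -
      have "a * (ln (u0 x) - V t x) \<le> a * (1/2)"
        by (rule mult_left_mono[OF _ exponents(1)]) (use V_near[of t x] in \<open>unfold abs_le_iff, linarith\<close>)
      then have "exp (- (a * V t x)) \<le> exp (a / 2 - a * ln (u0 x))" by (simp add: algebra_simps)
      also have "\<dots> = exp (a / 2) * u0 x powr (- a)" using pos by (simp add: powr_def mult_exp_exp)
      finally have "exp (- (a * V t x)) * \<bar>1/2 * R t x - 1/2 * S t x\<bar> \<le> exp (a / 2) * u0 x powr (- a) * (4 * \<omega>0 x)"
        using half(2) by (intro mult_mono) auto
      also have "\<dots> = 4 * exp (a / 2) * \<omega>0 x * u0 x powr (- a)" by simp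
      also have "\<dots> \<le> ?W * u0 x powr (- a)" by (intro mult_right_mono q\<omega>(2)) auto
      finally show ?thesis by (simp add: abs_mult)
    qed
    have 3: "\<bar>exp (- (a * V t x)) * (1/2 * R t x - 1/2 * S t x) * r\<bar> \<le> Q * \<theta>0 x * u0 x powr (- a)"
    proof -
      have "\<bar>exp (- (a * V t x)) * (1/2 * R t x - 1/2 * S t x) * r\<bar> \<le> ?W * u0 x powr (- a) * ?W"
        unfolding abs_mult[of _ r] using pos q
        by (intro mult_mono 2 order_trans[OF r q\<omega>(1)]) auto
      also have "\<dots> = ?W * ?W * u0 x powr (- a)" by simp
      also have "\<dots> \<le> Q * \<theta>0 x * u0 x powr (- a)" by (intro mult_right_mono W2) auto
      finally show ?thesis .
    qed
    note scale[OF order_trans[OF abs_triangle_ineq add_mono[OF 3 rx]]]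
    also have "u0 x * (Q * \<theta>0 x * u0 x powr (- a) + H * \<theta>0 x * u0 x powr (- a)) = (Q + H) * ?j powr (- \<gamma>)"
    proof -
      have "u0 x * (Q * \<theta>0 x * u0 x powr (- a) + H * \<theta>0 x * u0 x powr (- a))
          = (Q + H) * (u0 x * (\<theta>0 x * u0 x powr (- a)))" by (simp add: algebra_simps)
      then show ?thesis unfolding u\<theta>x .
    qed
    finally show "\<bar>?e * 1 * (exp (- (a * V t x)) * (1/2 * R t x - 1/2 * S t x)) * r + rx * ?e\<bar> \<le> C4x * ?j powr (- \<gamma>)"
      unfolding fact C4x_def by (simp only: mult.assoc)
  qed
  have time_bounds: "\<bar>a / 2 * ((r - s) * r) + \<psi> (V t x) * (R t x - S t x) - R t x * S t x + z\<bar>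
      \<le> (a + 1) * (Q * \<theta>0 x) + 4 * CF * \<omega>0 x + exp (a / 2) * (H * \<theta>0 x)"
    if t: "t \<in> {0..T}" and r: "\<bar>r\<bar> \<le> 4 * \<omega>0 x" "\<bar>s\<bar> \<le> 4 * \<omega>0 x"
      and z: "\<bar>z\<bar> \<le> exp (a / 2) * (H * \<theta>0 x)" for t x r s z
  proof -
    have w: "0 < \<omega>0 x" by (rule weights_pos)
    have w2: "32 * (\<omega>0 x * \<omega>0 x) \<le> 2 * (Q * \<theta>0 x)" "16 * (\<omega>0 x * \<omega>0 x) \<le> Q * \<theta>0 x"
    proof -
      have "5 * 5 \<le> q * q" using q by (intro mult_mono) auto
      then have "25 * (\<omega>0 x * \<omega>0 x) \<le> q * q * (\<omega>0 x * \<omega>0 x)" using w by (intro mult_right_mono) auto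
      also have "\<dots> \<le> Q * \<theta>0 x" using sq_le[of x] by (simp add: Q_def power2_eq_square ac_simps)
      finally show "32 * (\<omega>0 x * \<omega>0 x) \<le> 2 * (Q * \<theta>0 x)" "16 * (\<omega>0 x * \<omega>0 x) \<le> Q * \<theta>0 x"
        using w mult_pos_pos[OF w w] by linarith+
    qed
    have RS: "\<bar>R t x\<bar> \<le> 4 * \<omega>0 x" "\<bar>S t x\<bar> \<le> 4 * \<omega>0 x"
      using RS_le[OF t, of "Y x"] by (simp_all add: R_def S_def \<Xi>Y)
    have "\<bar>r - s\<bar> * \<bar>r\<bar> \<le> (8 * \<omega>0 x) * (4 * \<omega>0 x)"
      using r abs_triangle_ineq4[of r s] w by (intro mult_mono) auto
    also have "\<dots> = 32 * (\<omega>0 x * \<omega>0 x)" by simp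
    also note w2(1)
    finally have "a / 2 * (\<bar>r - s\<bar> * \<bar>r\<bar>) \<le> a / 2 * (2 * (Q * \<theta>0 x))"
      using exponents by (intro mult_left_mono) auto
    then have 1: "\<bar>a / 2 * ((r - s) * r)\<bar> \<le> a * (Q * \<theta>0 x)" using exponents by (simp add: abs_mult)
    have "V t x \<le> Vm"
    proof -
      have "ln (u0 x) \<le> ln c2" using u0_le[of x] u0_pos[of x] by simp
      then show ?thesis using V_near[of t x] unfolding abs_le_iff Vm_def by linarith
    qed
    then have "\<bar>\<psi> (V t x)\<bar> * \<bar>R t x - S t x\<bar> \<le> CF / 2 * (8 * \<omega>0 x)"
      using RS abs_triangle_ineq4[of "R t x" "S t x"] const_pos by (intro mult_mono problem.\<psi>_le[OF problem_axioms]) auto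
    then have 2: "\<bar>\<psi> (V t x) * (R t x - S t x)\<bar> \<le> 4 * CF * \<omega>0 x" by (simp add: abs_mult)
    have "\<bar>R t x\<bar> * \<bar>S t x\<bar> \<le> (4 * \<omega>0 x) * (4 * \<omega>0 x)" using RS w by (intro mult_mono) auto
    then have 3: "\<bar>R t x * S t x\<bar> \<le> Q * \<theta>0 x" using w2(2) by (simp add: abs_mult)
    have tri: "\<bar>x1 + x2 - x3 + x4\<bar> \<le> p1 + p2 + p3 + p4"
      if "\<bar>x1\<bar> \<le> p1" "\<bar>x2\<bar> \<le> p2" "\<bar>x3\<bar> \<le> p3" "\<bar>x4\<bar> \<le> p4" for x1 x2 x3 x4 p1 p2 p3 p4 :: real
      using that unfolding abs_le_iff by linarith
    from tri[OF 1 2 3 z] show ?thesis by (simp add: algebra_simps)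
  qed
  have inv_slope: "\<bar>exp (a * V t x) * (p * u0 x powr (- a))\<bar> \<le> exp (a / 2) * (H * \<theta>0 x)"
    if "\<bar>p\<bar> \<le> H * \<theta>0 x" for t x p
  proof -
    have "a * (V t x - ln (u0 x)) \<le> a * (1/2)"
      by (rule mult_left_mono[OF _ exponents(1)]) (use V_near[of t x] in \<open>unfold abs_le_iff, linarith\<close>)
    then have "exp (a * V t x) * u0 x powr (- a) \<le> exp (a / 2)" by (simp add: speed[symmetric])
    then have "(exp (a * V t x) * u0 x powr (- a)) * \<bar>p\<bar> \<le> exp (a / 2) * (H * \<theta>0 x)"
      using that by (intro mult_mono) auto
    then show ?thesis by (simp add: abs_mult ac_simps)
  qed
  have comb: "exp (a * V t x) * (exp ((1 - a) * V t x) * z) = exp (1 * V t x) * z" for t x z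
    by (simp add: mult.assoc[symmetric] mult_exp_exp) (simp add: algebra_simps)
  have cR1: "char_comb 1 a T u t x = exp (1 * V t x) * R t x" if "t \<in> {0..T}" for t x
    unfolding char_comb_def dtu[OF that] dxu[OF that] ut_def ux_def u_pow comb
    by (simp add: algebra_simps)
  have cS1: "char_comb (-1) a T u t x = exp (1 * V t x) * S t x" if "t \<in> {0..T}" for t x
    unfolding char_comb_def dtu[OF that] dxu[OF that] ut_def ux_def u_pow comb
    by (simp add: algebra_simps)
  have hR1t: "dt T (char_comb 1 a T u) t x = exp (1 * V t x) * 1 * (1/2 * R t x + 1/2 * S t x) * R t x + Rt t x * exp (1 * V t x)"
    if t: "t \<in> {0..T}" for t x
    by (rule C1_strip_dt[OF C1_strip_cong[OF hER cR1 refl refl] T0 t])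
  have hR1x: "dx (char_comb 1 a T u) t x
      = exp (1 * V t x) * 1 * (exp (- (a * V t x)) * (1/2 * R t x - 1/2 * S t x)) * R t x + Rx t x * exp (1 * V t x)"
    if t: "t \<in> {0..T}" for t x
    by (rule C1_strip_dx[OF C1_strip_cong[OF hER cR1 refl refl] t])
  have hS1t: "dt T (char_comb (-1) a T u) t x = exp (1 * V t x) * 1 * (1/2 * R t x + 1/2 * S t x) * S t x + St t x * exp (1 * V t x)"
    if t: "t \<in> {0..T}" for t x
    by (rule C1_strip_dt[OF C1_strip_cong[OF hES cS1 refl refl] T0 t])
  have hS1x: "dx (char_comb (-1) a T u) t x
      = exp (1 * V t x) * 1 * (exp (- (a * V t x)) * (1/2 * R t x - 1/2 * S t x)) * S t x + Sx t x * exp (1 * V t x)"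
    if t: "t \<in> {0..T}" for t x
    by (rule C1_strip_dx[OF C1_strip_cong[OF hES cS1 refl refl] t])
  have "solution_bounds a \<alpha> \<beta> \<gamma> (c1 * exp (- 1/2)) (c2 * exp (1/2)) C3 (C4t + C4x) T u"
    unfolding solution_bounds_def
  proof (intro ballI allI conjI)
    fix t x assume t: "t \<in> {0..T}"
    have "exp (ln (u0 x) + - 1/2) \<le> u t x" "u t x \<le> exp (ln (u0 x) + 1/2)"
      unfolding u_def using V_near[of t x] unfolding abs_le_iff by auto
    then have e: "u0 x * exp (- 1/2) \<le> u t x" "u t x \<le> u0 x * exp (1/2)"
      unfolding exp_add exp_ln[OF u0_pos] .
    have "c1 * japanese_bracket x powr (- \<alpha>) * exp (- 1/2) \<le> u0 x * exp (- 1/2)"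
      by (intro mult_right_mono u0_ge) auto
    also note e(1)
    finally show "c1 * exp (- 1/2) * japanese_bracket x powr (- \<alpha>) \<le> u t x" by (simp only: ac_simps)
    have "u0 x * exp (1/2) \<le> c2 * exp (1/2)" by (intro mult_right_mono u0_le) auto
    with e(2) show "u t x \<le> c2 * exp (1/2)" by linarith
    have RS: "\<bar>R t x\<bar> \<le> 4 * \<omega>0 x" "\<bar>S t x\<bar> \<le> 4 * \<omega>0 x"
      using RS_le[OF t, of "Y x"] by (simp_all add: R_def S_def \<Xi>Y)
    have P: "\<bar>P Rinv t (Y x)\<bar> \<le> H * \<theta>0 x" "\<bar>P Sinv t (Y x)\<bar> \<le> H * \<theta>0 x"
      using P_le[OF t, of "Y x"] by (simp_all add: \<Xi>Y)
    have Px: "\<bar>Rx t x\<bar> \<le> H * \<theta>0 x * u0 x powr (- a)" "\<bar>Sx t x\<bar> \<le> H * \<theta>0 x * u0 x powr (- a)"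
      using P by (simp_all add: Rx_def Sx_def abs_mult mult_right_mono)
    have Pt: "\<bar>Rt t x\<bar> \<le> (a + 1) * (Q * \<theta>0 x) + 4 * CF * \<omega>0 x + exp (a / 2) * (H * \<theta>0 x)"
      "\<bar>St t x\<bar> \<le> (a + 1) * (Q * \<theta>0 x) + 4 * CF * \<omega>0 x + exp (a / 2) * (H * \<theta>0 x)"
      using time_bounds[OF t RS inv_slope[OF P(1)], of t] time_bounds[OF t RS(2,1), of "- (exp (a * V t x) * Sx t x)"]
        inv_slope[OF P(2), of t]
      by (simp_all add: Rt_def St_def Rx_def Sx_def)
    note BR = inv_bounds[OF t RS(1) Px(1) Pt(1)] and BS = inv_bounds[OF t RS(2) Px(2) Pt(2)]
    fix \<sigma> :: real assume "\<sigma> \<in> {1, -1}"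
    then consider "\<sigma> = 1" | "\<sigma> = -1" by blast
    then have "\<bar>char_comb \<sigma> a T u t x\<bar> \<le> C3 * japanese_bracket x powr (- \<beta>) \<and>
      \<bar>dt T (char_comb \<sigma> a T u) t x\<bar> + \<bar>dx (char_comb \<sigma> a T u) t x\<bar> \<le> (C4t + C4x) * japanese_bracket x powr (- \<gamma>)"
    proof cases
      case 1
      show ?thesis unfolding 1 cR1[OF t] hR1t[OF t] hR1x[OF t] distrib_right[of C4t]
        by (intro conjI add_mono BR)
    next
      case 2
      show ?thesis unfolding 2 cS1[OF t] hS1t[OF t] hS1x[OF t] distrib_right[of C4t]
        by (intro conjI add_mono BS)
    qed
    then show "\<bar>char_comb \<sigma> a T u t x\<bar> \<le> C3 * japanese_bracket x powr (- \<beta>)"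
      "\<bar>dt T (char_comb \<sigma> a T u) t x\<bar> + \<bar>dx (char_comb \<sigma> a T u) t x\<bar> \<le> (C4t + C4x) * japanese_bracket x powr (- \<gamma>)"
      by auto
  qed
  moreover have "0 < c1 * exp (- 1/2)" "0 < c2 * exp (1/2)" "0 < C3" using c_pos by (auto simp: C3_def)
  moreover have "0 < C4t + C4x"
  proof -
    have "0 < exp (1/2) * (4 * CF * c3)" using c_pos const_pos by simp
    moreover have "0 \<le> exp (1/2) * (((a + 2) * Q + exp (a / 2) * H) * c2 powr a)" "0 \<le> C4x"
      using Q H exponents by (auto simp: C4x_def)
    ultimately show ?thesis unfolding C4t_def distrib_left[of "exp (1/2)"] by linarith
  qed
  ultimately show ?thesis using solution by blast
qed

end


section \<open>Uniqueness\<close>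

text \<open>The chain rule along a straight line, one-sided at the ends of the time interval. A line
  with the speed frozen at one point can replace the characteristic in the maximum principle, since
  only the derivative at that point is used.\<close>

lemma C1_strip_along:
  assumes f: "C1_strip T f ft fx" and t: "t \<in> {0..T}"
  shows "((\<lambda>s. f s (x + l * (s - t))) has_real_derivative ft t x + l * fx t x) (at t within {0..T})"
proof -
  let ?F = "at t within {0..T}"
  define \<xi> where "\<xi> s = x + l * (s - t)" for s
  have "\<forall>s. \<exists>z. s \<in> {0..T} \<longrightarrow> \<bar>z - x\<bar> \<le> \<bar>\<xi> s - x\<bar> \<and> f s (\<xi> s) - f s x = fx s z * (\<xi> s - x)"
    using mvt_between[OF C1_stripD(2)[OF f]] by blast
  then obtain z where z: "\<And>s. s \<in> {0..T} \<Longrightarrow> \<bar>z s - x\<bar> \<le> \<bar>\<xi> s - x\<bar>"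
    "\<And>s. s \<in> {0..T} \<Longrightarrow> f s (\<xi> s) - f s x = fx s (z s) * (\<xi> s - x)" by metis
  have z_lim: "(z \<longlongrightarrow> x) ?F"
  proof (rule Lim_transform2[OF tendsto_const])
    have "((\<lambda>s. \<bar>x + l * (s - t) - x\<bar>) \<longlongrightarrow> \<bar>x + l * (t - t) - x\<bar>) ?F" by (intro tendsto_intros)
    then have lim: "((\<lambda>s. \<bar>\<xi> s - x\<bar>) \<longlongrightarrow> 0) ?F" by (simp add: \<xi>_def)
    show "((\<lambda>s. x - z s) \<longlongrightarrow> 0) ?F"
      by (rule Lim_null_comparison[OF _ lim])
        (use z(1) in \<open>auto simp: eventually_at_filter abs_minus_commute intro!: always_eventually\<close>)
  qed
  have q_lim: "((\<lambda>s. fx s (z s)) \<longlongrightarrow> fx t x) ?F"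
  proof -
    have "((\<lambda>s. (s, z s)) \<longlongrightarrow> (t, x)) ?F" by (intro tendsto_intros z_lim)
    moreover have "\<forall>\<^sub>F s in ?F. (s, z s) \<in> {0..T} \<times> UNIV"
      by (auto simp: eventually_at_filter)
    ultimately have "((\<lambda>s. (\<lambda>p. fx (fst p) (snd p)) (s, z s)) \<longlongrightarrow> (\<lambda>p. fx (fst p) (snd p)) (t, x)) ?F"
      using t by (intro continuous_on_tendsto_compose[OF C1_stripD(5)[OF f]]) auto
    then show ?thesis by simp
  qed
  have "((\<lambda>s. (f s x - f t x) / (s - t) + l * fx s (z s)) \<longlongrightarrow> ft t x + l * fx t x) ?F"
    using C1_stripD(1)[OF f t, of x] unfolding has_field_derivative_iff by (intro tendsto_intros q_lim)
  then have "((\<lambda>s. (f s (\<xi> s) - f t (\<xi> t)) / (s - t)) \<longlongrightarrow> ft t x + l * fx t x) ?F"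
  proof (rule Lim_transform_eventually)
    show "\<forall>\<^sub>F s in ?F. (f s x - f t x) / (s - t) + l * fx s (z s) = (f s (\<xi> s) - f t (\<xi> t)) / (s - t)"
      unfolding eventually_at_filter
    proof (intro always_eventually allI impI)
      fix s assume "s \<noteq> t" "s \<in> {0..T}"
      from z(2)[OF this(2)] have "f s (\<xi> s) - f t (\<xi> t) = (f s x - f t x) + l * fx s (z s) * (s - t)"
        by (simp add: \<xi>_def algebra_simps)
      with \<open>s \<noteq> t\<close> show "(f s x - f t x) / (s - t) + l * fx s (z s) = (f s (\<xi> s) - f t (\<xi> t)) / (s - t)"
        by (simp add: add_divide_distrib)
    qed
  qed
  then show ?thesis unfolding has_field_derivative_iff \<xi>_def .
qed

lemma derivative_nonneg_at_right_max:
  fixes h :: "real \<Rightarrow> real"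
  assumes d: "(h has_real_derivative D) (at t within {0..t})" and t: "0 < t" and le: "\<And>s. s \<in> {0..t} \<Longrightarrow> h s \<le> h t"
  shows "0 \<le> D"
proof (rule tendsto_lowerbound)
  show "((\<lambda>s. (h s - h t) / (s - t)) \<longlongrightarrow> D) (at t within {0..t})" using d by (simp add: has_field_derivative_iff)
  show "\<forall>\<^sub>F s in at t within {0..t}. 0 \<le> (h s - h t) / (s - t)"
    unfolding eventually_at_filter
  proof (intro always_eventually allI impI)
    fix s assume "s \<in> {0..t}"
    with le[OF this] show "0 \<le> (h s - h t) / (s - t)" by (intro divide_nonpos_nonpos) auto
  qed
  show "at t within {0..t} \<noteq> bot" using t by (simp add: at_within_Icc_at_left)
qed

definition dependence_cone :: "real \<Rightarrow> real \<Rightarrow> real \<Rightarrow> (real \<times> real) set" where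
  "dependence_cone T \<Lambda> N = {p. 0 \<le> fst p \<and> fst p \<le> T \<and> \<bar>snd p\<bar> \<le> N + \<Lambda> * (T - fst p)}"

lemma compact_dependence_cone:
  assumes "0 \<le> \<Lambda>" shows "compact (dependence_cone T \<Lambda> N)"
proof -
  have "dependence_cone T \<Lambda> N = ({0..T} \<times> {-(N + \<Lambda> * T)..N + \<Lambda> * T}) \<inter> {p. \<bar>snd p\<bar> \<le> N + \<Lambda> * (T - fst p)}"
  proof (intro equalityI subsetI)
    fix p assume p: "p \<in> dependence_cone T \<Lambda> N"
    then have "0 \<le> \<Lambda> * fst p" using assms by (simp add: dependence_cone_def)
    with p show "p \<in> ({0..T} \<times> {-(N + \<Lambda> * T)..N + \<Lambda> * T}) \<inter> {p. \<bar>snd p\<bar> \<le> N + \<Lambda> * (T - fst p)}"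
      by (cases p) (auto simp: dependence_cone_def abs_le_iff algebra_simps)
  qed (auto simp: dependence_cone_def)
  moreover have "closed {p :: real \<times> real. \<bar>snd p\<bar> \<le> N + \<Lambda> * (T - fst p)}"
    by (intro closed_Collect_le continuous_intros)
  ultimately show ?thesis by (auto intro!: compact_Int_closed compact_Times)
qed

text \<open>At a positive maximum of \<open>exp (- (K + 1) t) \<bar>w\<^sub>i\<bar>\<close> over the cone the derivative along
  the incoming characteristic, which stays in the cone, would be negative.\<close>

lemma cone_uniqueness:
  fixes w :: "'i::finite \<Rightarrow> real \<Rightarrow> real \<Rightarrow> real"
  assumes w: "\<And>i. C1_strip T (w i) (wt i) (wx i)" and \<Lambda>: "0 \<le> \<Lambda>"
    and lam: "\<And>i t x. t \<in> {0..T} \<Longrightarrow> \<bar>lam i t x\<bar> \<le> \<Lambda>"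
    and eq: "\<And>i t x e. (t, x) \<in> dependence_cone T \<Lambda> N \<Longrightarrow> 0 < t \<Longrightarrow> (\<And>j. \<bar>w j t x\<bar> \<le> e) \<Longrightarrow>
      \<bar>wt i t x + lam i t x * wx i t x\<bar> \<le> K * e"
    and init: "\<And>i x. w i 0 x = 0"
    and tx: "(t, x) \<in> dependence_cone T \<Lambda> N"
  shows "w i t x = 0"
proof (rule ccontr)
  assume nz: "w i t x \<noteq> 0"
  \<comment> \<open>With the exponent \<open>K + 1\<close> the derivative at the maximum is at most
    \<open>- m\<close>, which is strictly negative.\<close>
  let ?C = "dependence_cone T \<Lambda> N" and ?k = "K + 1"
  have sub: "?C \<subseteq> {0..T} \<times> UNIV" by (auto simp: dependence_cone_def)
  define f where "f i p = exp (- (?k * fst p)) * \<bar>w i (fst p) (snd p)\<bar>" for i and p :: "real \<times> real"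
  define A where "A = (\<Union>i. f i ` ?C)"
  have "continuous_on ?C (f i)" for i
    unfolding f_def by (intro continuous_intros continuous_on_subset[OF C1_stripD(3)[OF w] sub])
  then have "compact A"
    unfolding A_def by (intro compact_UN finite compact_continuous_image compact_dependence_cone \<Lambda>)
  moreover have fA: "f i (t, x) \<in> A" using tx by (auto simp: A_def)
  ultimately obtain m where m: "m \<in> A" "\<And>y. y \<in> A \<Longrightarrow> y \<le> m"
    using compact_attains_sup[of A] by blast
  have "0 < f i (t, x)" using nz by (simp add: f_def)
  with m(2)[OF fA] have m0: "0 < m" by linarith
  from m(1) obtain j s y where sy: "(s, y) \<in> ?C" and mj: "m = f j (s, y)" by (auto simp: A_def)
  have f_le: "f j p \<le> m" if "p \<in> ?C" for j p using that by (intro m(2)) (auto simp: A_def)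
  have sT: "s \<in> {0..T}" using sy by (auto simp: dependence_cone_def)
  have s0: "0 < s"
  proof (rule ccontr)
    assume "\<not> 0 < s"
    with sT have "s = 0" by auto
    with mj m0 show False by (simp add: f_def init)
  qed
  define l where "l = lam j s y"
  \<comment> \<open>Multiplication by the sign at the maximum point replaces the absolute value by a
    differentiable function that lies below it and agrees with it at that point.\<close>
  define c where "c = sgn (w j s y)"
  have c: "\<bar>c\<bar> \<le> 1" "c * w j s y = \<bar>w j s y\<bar>" by (auto simp: c_def sgn_if)
  define h where "h r = exp (- (?k * r)) * (c * w j r (y + l * (r - s)))" for r
  have hs: "h s = m" by (simp add: h_def mj f_def c)
  have "((\<lambda>r. exp (- (?k * r))) has_real_derivative exp (- (?k * s)) * - ?k) (at s within {0..T})"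
    by (auto intro!: derivative_eq_intros)
  from DERIV_mult[OF this DERIV_cmult[OF C1_strip_along[OF w sT, of j y l], of c]]
  have dh: "(h has_real_derivative exp (- (?k * s)) * - ?k * (c * w j s y)
      + c * (wt j s y + l * wx j s y) * exp (- (?k * s))) (at s within {0..T})"
    unfolding h_def by simp
  have "0 \<le> exp (- (?k * s)) * - ?k * (c * w j s y) + c * (wt j s y + l * wx j s y) * exp (- (?k * s))"
  proof (rule derivative_nonneg_at_right_max[OF has_field_derivative_subset[OF dh] s0])
    show "{0..s} \<subseteq> {0..T}" using sT by auto
    fix r assume r: "r \<in> {0..s}"
    have "\<bar>l * (r - s)\<bar> \<le> \<Lambda> * (s - r)"
      unfolding abs_mult l_def using lam[OF sT] r \<Lambda> by (intro mult_mono) auto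
    then have "\<bar>y + l * (r - s)\<bar> \<le> N + \<Lambda> * (T - s) + \<Lambda> * (s - r)"
      using sy abs_triangle_ineq[of y "l * (r - s)"] by (auto simp: dependence_cone_def)
    then have "(r, y + l * (r - s)) \<in> ?C" using r sT by (auto simp: dependence_cone_def algebra_simps)
    from f_le[OF this, of j] have "exp (- (?k * r)) * \<bar>w j r (y + l * (r - s))\<bar> \<le> m" by (simp add: f_def)
    moreover have "c * w j r (y + l * (r - s)) \<le> 1 * \<bar>w j r (y + l * (r - s))\<bar>"
    proof -
      have "\<bar>c\<bar> * \<bar>w j r (y + l * (r - s))\<bar> \<le> 1 * \<bar>w j r (y + l * (r - s))\<bar>" using c by (intro mult_right_mono) auto
      then show ?thesis by (metis abs_ge_self abs_mult order_trans)
    qed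
    then have "h r \<le> exp (- (?k * r)) * \<bar>w j r (y + l * (r - s))\<bar>" unfolding h_def by (simp add: mult_left_mono)
    ultimately show "h r \<le> h s" using hs by linarith
  qed
  moreover have "\<bar>wt j s y + l * wx j s y\<bar> \<le> K * (m * exp (?k * s))"
    unfolding l_def
  proof (rule eq[OF sy s0])
    fix i
    have "exp (- (?k * s)) * \<bar>w i s y\<bar> * exp (?k * s) \<le> m * exp (?k * s)"
      using f_le[OF sy, of i] by (intro mult_right_mono) (auto simp: f_def)
    moreover have "exp (- (?k * s)) * \<bar>w i s y\<bar> * exp (?k * s) = \<bar>w i s y\<bar>" by (simp add: exp_minus)
    ultimately show "\<bar>w i s y\<bar> \<le> m * exp (?k * s)" by linarith
  qed
  then have "c * (wt j s y + l * wx j s y) \<le> K * (m * exp (?k * s))"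
  proof -
    assume a: "\<bar>wt j s y + l * wx j s y\<bar> \<le> K * (m * exp (?k * s))"
    have "\<bar>c\<bar> * \<bar>wt j s y + l * wx j s y\<bar> \<le> 1 * \<bar>wt j s y + l * wx j s y\<bar>" using c by (intro mult_right_mono) auto
    also have "1 * \<bar>wt j s y + l * wx j s y\<bar> \<le> K * (m * exp (?k * s))" using a by (simp only: mult_1)
    finally show ?thesis by (rule order_trans[rotated]) (simp only: abs_mult[symmetric] abs_ge_self)
  qed
  then have "c * (wt j s y + l * wx j s y) * exp (- (?k * s)) \<le> K * (m * exp (?k * s)) * exp (- (?k * s))"
    by (intro mult_right_mono) auto
  moreover have "K * (m * exp (?k * s)) * exp (- (?k * s)) = K * m" by (simp add: exp_minus)
  moreover have "exp (- (?k * s)) * - ?k * (c * w j s y) = - (?k * m)"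
    unfolding mj f_def c(2) fst_conv snd_conv by (simp only: mult_minus_left mult_minus_right ac_simps)
  moreover have "?k * m = K * m + m" by (simp add: algebra_simps)
  ultimately show False using m0 by linarith
qed

text \<open>Asserted for all sufficiently large constants, so that one constant can be chosen for
  several functions.\<close>

lemma C1_lipschitz_compact:
  fixes \<phi> :: "real \<Rightarrow> real"
  assumes d: "\<And>x. x \<in> {p..q} \<Longrightarrow> (\<phi> has_real_derivative \<phi>' x) (at x)" and c: "continuous_on {p..q} \<phi>'"
  shows "\<exists>B. \<forall>L\<ge>B. \<forall>x\<in>{p..q}. \<forall>y\<in>{p..q}. \<bar>\<phi> x\<bar> \<le> L \<and> \<bar>\<phi> x - \<phi> y\<bar> \<le> L * \<bar>x - y\<bar>"
proof -
  have "continuous_on {p..q} \<phi>" by (intro continuous_at_imp_continuous_on ballI) (rule DERIV_isCont[OF d])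
  then have "bounded (\<phi> ` {p..q})" "bounded (\<phi>' ` {p..q})"
    using c by (auto intro!: compact_imp_bounded compact_continuous_image)
  then obtain B B' where "\<forall>y\<in>\<phi> ` {p..q}. norm y \<le> B" "\<forall>y\<in>\<phi>' ` {p..q}. norm y \<le> B'"
    unfolding bounded_iff by blast
  then have B: "\<And>x. x \<in> {p..q} \<Longrightarrow> \<bar>\<phi> x\<bar> \<le> B" "\<And>x. x \<in> {p..q} \<Longrightarrow> \<bar>\<phi>' x\<bar> \<le> B'"
    by auto
  have lip: "\<bar>\<phi> y - \<phi> x\<bar> \<le> B' * \<bar>y - x\<bar>" if "x \<in> {p..q}" "y \<in> {p..q}" "x < y" for x y
  proof -
    have "\<exists>z>x. z < y \<and> \<phi> y - \<phi> x = (y - x) * \<phi>' z" using that by (intro MVT2 d) auto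
    then obtain z where z: "x < z" "z < y" "\<phi> y - \<phi> x = (y - x) * \<phi>' z" by auto
    have "\<bar>y - x\<bar> * \<bar>\<phi>' z\<bar> \<le> \<bar>y - x\<bar> * B'" using z that by (intro mult_left_mono B) auto
    with z(3) show ?thesis by (simp add: abs_mult mult.commute)
  qed
  have "\<bar>\<phi> x\<bar> \<le> L \<and> \<bar>\<phi> x - \<phi> y\<bar> \<le> L * \<bar>x - y\<bar>"
    if L: "max B B' \<le> L" and xy: "x \<in> {p..q}" "y \<in> {p..q}" for L x y
  proof -
    have "\<bar>\<phi> x - \<phi> y\<bar> \<le> B' * \<bar>x - y\<bar>"
      using lip[of x y] lip[of y x] xy by (cases x y rule: linorder_cases) (auto simp: abs_minus_commute)
    also have "\<dots> \<le> L * \<bar>x - y\<bar>" using L by (intro mult_right_mono) auto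
    finally show ?thesis using B(1)[OF xy(1)] L by auto
  qed
  then show ?thesis by blast
qed


lemma bounded_on_cone:
  fixes f :: "real \<times> real \<Rightarrow> real"
  assumes "continuous_on ({0..T} \<times> UNIV) f" "0 \<le> \<Lambda>"
  shows "\<exists>B. \<forall>B'\<ge>B. \<forall>p\<in>dependence_cone T \<Lambda> N. \<bar>f p\<bar> \<le> B'"
proof -
  have "dependence_cone T \<Lambda> N \<subseteq> {0..T} \<times> UNIV" by (auto simp: dependence_cone_def)
  from continuous_on_subset[OF assms(1) this]
  have "bounded (f ` dependence_cone T \<Lambda> N)"
    by (intro compact_imp_bounded compact_continuous_image compact_dependence_cone assms(2))
  then obtain B where "\<forall>y\<in>f ` dependence_cone T \<Lambda> N. norm y \<le> B" unfolding bounded_iff by blast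
  then show ?thesis by (auto intro: order_trans)
qed

context problem begin

text \<open>For an arbitrary positive solution R and S are taken undivided: uniqueness is a question
  on a compact cone, where 1/u is bounded, and it needs no uniform constants.\<close>

lemma riemann_form:
  assumes T: "0 < T" and sol: "cauchy_solution a F u0 u1 T u" and pos: "\<And>t x. t \<in> {0..T} \<Longrightarrow> 0 < u t x"
  obtains pt px where "\<And>\<sigma>. C1_strip T (char_comb \<sigma> a T u) (pt \<sigma>) (px \<sigma>)"
    "\<And>\<sigma> t x. \<sigma> \<in> {1, -1} \<Longrightarrow> t \<in> {0<..T} \<Longrightarrow> pt \<sigma> t x - \<sigma> * u t x powr a * px \<sigma> t x
      = \<sigma> * (a / 2 * inverse (u t x) * ((char_comb 1 a T u t x - char_comb (-1) a T u t x) * char_comb \<sigma> a T u t x))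
        + 1 / 2 * F (u t x) * u t x powr (- a) * (char_comb 1 a T u t x - char_comb (-1) a T u t x)"
proof -
  let ?ut = "dt T u" and ?ux = "dx u"
  let ?utt = "dt T ?ut" and ?utx = "dx ?ut" and ?uxt = "dt T ?ux" and ?uxx = "dx ?ux"
  have "Ck_strip T 2 u" using sol by (simp add: cauchy_solution_def)
  then have h1: "C1_strip T u ?ut ?ux" and h2: "C1_strip T ?ut ?utt ?utx" and h3: "C1_strip T ?ux ?uxt ?uxx"
    by (auto simp: Ck_strip_2_iff[OF T])
  \<comment> \<open>The class C^2 as defined contains both mixed derivatives, but their equality has
    to be derived.\<close>
  have swap: "?uxt t x = ?utx t x" if t: "t \<in> {0..T}" for t x
  proof -
    have "((\<lambda>s. ?ux s x) has_real_derivative ?utx t x) (at t within {0..T})"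
      by (rule dt_dx_swap[OF C1_stripD(1)[OF h1] C1_stripD(2)[OF h1] C1_stripD(2)[OF h2] _ _ t])
        (use C1_stripD(3)[OF h2] C1_stripD(5)[OF h2] in \<open>simp_all add: case_prod_beta\<close>)
    then show ?thesis
      unfolding dt_def[of T ?ux] using T t
      by (intro vector_derivative_within_closed_interval) (simp_all add: has_real_derivative_iff_has_vector_derivative)
  qed
  have hpow: "C1_strip T (\<lambda>t x. u t x powr r) (\<lambda>t x. r * u t x powr (r - 1) * ?ut t x) (\<lambda>t x. r * u t x powr (r - 1) * ?ux t x)" for r
    by (rule C1_strip_compose[OF h1, where S = "{0<..}"])
      (auto intro!: derivative_eq_intros continuous_intros simp: pos)
  note hflux = C1_strip_mult[OF hpow[of "2 * a"] h3]
  let ?pt = "\<lambda>\<sigma> t x. 1 * ?utt t x + \<sigma> * (a * u t x powr (a - 1) * ?ut t x * ?ux t x + ?uxt t x * u t x powr a)"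
  let ?px = "\<lambda>\<sigma> t x. 1 * ?utx t x + \<sigma> * (a * u t x powr (a - 1) * ?ux t x * ?ux t x + ?uxx t x * u t x powr a)"
  show thesis
  proof (rule that[of ?pt ?px])
    show "C1_strip T (char_comb \<sigma> a T u) (?pt \<sigma>) (?px \<sigma>)" for \<sigma>
      by (rule C1_strip_cong[OF C1_strip_lincomb[OF h2 C1_strip_mult[OF hpow[of a] h3], of 1 \<sigma>]])
        (simp_all add: char_comb_def)
  next
    fix \<sigma> t x :: real assume \<sigma>: "\<sigma> \<in> {1, -1}" and t0: "t \<in> {0<..T}"
    then have t: "t \<in> {0..T}" by auto
    have "?utt t x = dx (\<lambda>s y. u s y powr (2 * a) * dx u s y) t x + F (u t x) * dx u t x"
      using sol t0 by (simp add: cauchy_solution_def)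
    then have utt: "?utt t x = 2 * a * u t x powr (2 * a - 1) * ?ux t x * ?ux t x + ?uxx t x * u t x powr (2 * a) + F (u t x) * ?ux t x"
      unfolding C1_strip_dx[OF hflux t] by simp
    have ne: "u t x \<noteq> 0" using pos[OF t, of x] by simp
    have pw: "u t x powr (2 * a - 1) = u t x powr a * u t x powr a / u t x" "u t x powr (2 * a) = u t x powr a * u t x powr a"
      "u t x powr (a - 1) = u t x powr a / u t x" "u t x powr (- a) = 1 / u t x powr a"
      using pos[OF t, of x] by (simp_all add: powr_diff powr_add[symmetric] powr_minus divide_inverse)
    have c0: "u t x powr a \<noteq> 0" using ne by simp
    have alg: "1 * (2 * a * (c * c / z) * q * q + qx * (c * c) + f * q) + \<sigma> * (a * (c / z) * p * q + px * c)
        - \<sigma> * c * (1 * px + \<sigma> * (a * (c / z) * q * q + qx * c))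
      = \<sigma> * (a / 2 * inverse z * ((p + 1 * (c * q) - (p + - 1 * (c * q))) * (p + \<sigma> * (c * q))))
        + 1 / 2 * f * (1 / c) * (p + 1 * (c * q) - (p + - 1 * (c * q)))"
      if "z \<noteq> 0" "c \<noteq> 0" for c z q qx f p px :: real
      using \<sigma> that by (auto simp: field_simps)
    show "?pt \<sigma> t x - \<sigma> * u t x powr a * ?px \<sigma> t x
      = \<sigma> * (a / 2 * inverse (u t x) * ((char_comb 1 a T u t x - char_comb (-1) a T u t x) * char_comb \<sigma> a T u t x))
        + 1 / 2 * F (u t x) * u t x powr (- a) * (char_comb 1 a T u t x - char_comb (-1) a T u t x)"
      unfolding utt swap[OF t] char_comb_def pw by (rule alg[OF ne c0])
  qed
qed

text \<open>Subtracting the two diagonal systems, with the speed of \<open>u\<close> in the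
  transport term, leaves a linear system for the differences of u, R and S. Its coefficients are
  bounded on the cone, where both solutions and the slopes of the invariants of \<open>v\<close> are
  bounded and u and v are bounded away from 0.\<close>

theorem uniqueness:
  assumes T: "0 < T" and u: "cauchy_solution a F u0 u1 T u" and v: "cauchy_solution a F u0 u1 T v"
    and u_pos: "\<And>t x. t \<in> {0..T} \<Longrightarrow> 0 < u t x" and v_pos: "\<And>t x. t \<in> {0..T} \<Longrightarrow> 0 < v t x"
    and u_le: "\<And>t x. t \<in> {0..T} \<Longrightarrow> u t x \<le> C" and v_le: "\<And>t x. t \<in> {0..T} \<Longrightarrow> v t x \<le> C"
    and t: "t \<in> {0..T}"
  shows "v t x = u t x"
proof -
  define \<Lambda> where "\<Lambda> = C powr a"
  define N where "N = \<bar>x\<bar>"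
  let ?D = "dependence_cone T \<Lambda> N"
  have \<Lambda>: "0 \<le> \<Lambda>" by (simp add: \<Lambda>_def)
  obtain pt px where p: "\<And>\<sigma>. C1_strip T (char_comb \<sigma> a T u) (pt \<sigma>) (px \<sigma>)"
    "\<And>\<sigma> t x. \<sigma> \<in> {1, -1} \<Longrightarrow> t \<in> {0<..T} \<Longrightarrow> pt \<sigma> t x - \<sigma> * u t x powr a * px \<sigma> t x
      = \<sigma> * (a / 2 * inverse (u t x) * ((char_comb 1 a T u t x - char_comb (-1) a T u t x) * char_comb \<sigma> a T u t x))
        + 1 / 2 * F (u t x) * u t x powr (- a) * (char_comb 1 a T u t x - char_comb (-1) a T u t x)"
    by (rule riemann_form[OF T u u_pos], assumption, rule that) assumption+
  obtain qt qx where q: "\<And>\<sigma>. C1_strip T (char_comb \<sigma> a T v) (qt \<sigma>) (qx \<sigma>)"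
    "\<And>\<sigma> t x. \<sigma> \<in> {1, -1} \<Longrightarrow> t \<in> {0<..T} \<Longrightarrow> qt \<sigma> t x - \<sigma> * v t x powr a * qx \<sigma> t x
      = \<sigma> * (a / 2 * inverse (v t x) * ((char_comb 1 a T v t x - char_comb (-1) a T v t x) * char_comb \<sigma> a T v t x))
        + 1 / 2 * F (v t x) * v t x powr (- a) * (char_comb 1 a T v t x - char_comb (-1) a T v t x)"
    by (rule riemann_form[OF T v v_pos], assumption, rule that) assumption+
  let ?P = "\<lambda>\<sigma>. char_comb \<sigma> a T u" and ?Q = "\<lambda>\<sigma>. char_comb \<sigma> a T v"
  have hu: "C1_strip T u (dt T u) (dx u)" and hv: "C1_strip T v (dt T v) (dx v)"
    using u v by (auto simp: cauchy_solution_def Ck_strip_2_iff[OF T])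
  obtain B where B: "\<forall>p\<in>?D. \<bar>inverse (u (fst p) (snd p))\<bar> \<le> B" "\<forall>p\<in>?D. \<bar>inverse (v (fst p) (snd p))\<bar> \<le> B"
    "\<And>\<sigma>. \<sigma> \<in> {1, -1} \<Longrightarrow> \<forall>p\<in>?D. \<bar>?P \<sigma> (fst p) (snd p)\<bar> \<le> B \<and> \<bar>?Q \<sigma> (fst p) (snd p)\<bar> \<le> B \<and> \<bar>qx \<sigma> (fst p) (snd p)\<bar> \<le> B"
    "0 < B"
  proof -
    have "continuous_on ({0..T} \<times> UNIV) (\<lambda>p. inverse (u (fst p) (snd p)))"
      "continuous_on ({0..T} \<times> UNIV) (\<lambda>p. inverse (v (fst p) (snd p)))"
    proof -
      have nz: "\<forall>p\<in>{0..T} \<times> UNIV. u (fst p) (snd p) \<noteq> 0" "\<forall>p\<in>{0..T} \<times> UNIV. v (fst p) (snd p) \<noteq> 0"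
        using u_pos v_pos by (metis less_irrefl mem_Times_iff)+
      show "continuous_on ({0..T} \<times> UNIV) (\<lambda>p. inverse (u (fst p) (snd p)))"
        by (rule continuous_on_inverse[OF C1_stripD(3)[OF hu] nz(1)])
      show "continuous_on ({0..T} \<times> UNIV) (\<lambda>p. inverse (v (fst p) (snd p)))"
        by (rule continuous_on_inverse[OF C1_stripD(3)[OF hv] nz(2)])
    qed
    note cu = this
    obtain b1 where b1: "\<forall>B\<ge>b1. \<forall>p\<in>?D. \<bar>inverse (u (fst p) (snd p))\<bar> \<le> B"
      using bounded_on_cone[OF cu(1) \<Lambda>, of N] by blast
    obtain b2 where b2: "\<forall>B\<ge>b2. \<forall>p\<in>?D. \<bar>inverse (v (fst p) (snd p))\<bar> \<le> B"
      using bounded_on_cone[OF cu(2) \<Lambda>, of N] by blast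
    obtain b3 where b3: "\<forall>B\<ge>b3. \<forall>p\<in>?D. \<bar>?P 1 (fst p) (snd p)\<bar> \<le> B"
      using bounded_on_cone[OF C1_stripD(3)[OF p(1)[of "1"]] \<Lambda>, of N] by blast
    obtain b4 where b4: "\<forall>B\<ge>b4. \<forall>p\<in>?D. \<bar>?Q 1 (fst p) (snd p)\<bar> \<le> B"
      using bounded_on_cone[OF C1_stripD(3)[OF q(1)[of "1"]] \<Lambda>, of N] by blast
    obtain b5 where b5: "\<forall>B\<ge>b5. \<forall>p\<in>?D. \<bar>qx 1 (fst p) (snd p)\<bar> \<le> B"
      using bounded_on_cone[OF C1_stripD(5)[OF q(1)[of "1"]] \<Lambda>, of N] by blast
    obtain b6 where b6: "\<forall>B\<ge>b6. \<forall>p\<in>?D. \<bar>?P (-1) (fst p) (snd p)\<bar> \<le> B"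
      using bounded_on_cone[OF C1_stripD(3)[OF p(1)[of "-1"]] \<Lambda>, of N] by blast
    obtain b7 where b7: "\<forall>B\<ge>b7. \<forall>p\<in>?D. \<bar>?Q (-1) (fst p) (snd p)\<bar> \<le> B"
      using bounded_on_cone[OF C1_stripD(3)[OF q(1)[of "-1"]] \<Lambda>, of N] by blast
    obtain b8 where b8: "\<forall>B\<ge>b8. \<forall>p\<in>?D. \<bar>qx (-1) (fst p) (snd p)\<bar> \<le> B"
      using bounded_on_cone[OF C1_stripD(5)[OF q(1)[of "-1"]] \<Lambda>, of N] by blast
    \<comment> \<open>The entry 1 ensures that \<open>B\<close> is positive; \<open>1 / B\<close>
      serves below as the lower bound of both solutions on the cone.\<close>
    define B where "B = Max {1, b1, b2, b3, b4, b5, b6, b7, b8}"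
    have le: "b1 \<le> B" "b2 \<le> B" "b3 \<le> B" "b4 \<le> B" "b5 \<le> B" "b6 \<le> B" "b7 \<le> B" "b8 \<le> B" "1 \<le> B"
      unfolding B_def by (rule Max_ge; blast)+
    show thesis
    proof (rule that[of B])
      show "\<forall>p\<in>?D. \<bar>inverse (u (fst p) (snd p))\<bar> \<le> B" by (rule b1[THEN spec, THEN mp, OF le(1)])
      show "\<forall>p\<in>?D. \<bar>inverse (v (fst p) (snd p))\<bar> \<le> B" by (rule b2[THEN spec, THEN mp, OF le(2)])
      show "0 < B" by (rule less_le_trans[OF zero_less_one le(9)])
      fix \<sigma> :: real assume "\<sigma> \<in> {1, -1}"
      then consider "\<sigma> = 1" | "\<sigma> = -1" by blast
      then show "\<forall>p\<in>?D. \<bar>?P \<sigma> (fst p) (snd p)\<bar> \<le> B \<and> \<bar>?Q \<sigma> (fst p) (snd p)\<bar> \<le> B \<and> \<bar>qx \<sigma> (fst p) (snd p)\<bar> \<le> B"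
      proof cases
        case 1
        show ?thesis
        proof (intro ballI conjI)
          fix p assume p: "p \<in> ?D"
          show "\<bar>?P \<sigma> (fst p) (snd p)\<bar> \<le> B" unfolding 1 by (rule b3[rule_format, OF le(3) p])
          show "\<bar>?Q \<sigma> (fst p) (snd p)\<bar> \<le> B" unfolding 1 by (rule b4[rule_format, OF le(4) p])
          show "\<bar>qx \<sigma> (fst p) (snd p)\<bar> \<le> B" unfolding 1 by (rule b5[rule_format, OF le(5) p])
        qed
      next
        case 2
        show ?thesis
        proof (intro ballI conjI)
          fix p assume p: "p \<in> ?D"
          show "\<bar>?P \<sigma> (fst p) (snd p)\<bar> \<le> B" unfolding 2 by (rule b6[rule_format, OF le(6) p])
          show "\<bar>?Q \<sigma> (fst p) (snd p)\<bar> \<le> B" unfolding 2 by (rule b7[rule_format, OF le(7) p])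
          show "\<bar>qx \<sigma> (fst p) (snd p)\<bar> \<le> B" unfolding 2 by (rule b8[rule_format, OF le(8) p])
        qed
      qed
    qed
  qed
  let ?p = "1 / B"
  have range: "u s y \<in> {?p..C}" "v s y \<in> {?p..C}" if "(s, y) \<in> ?D" for s y
  proof -
    have s: "s \<in> {0..T}" using that by (auto simp: dependence_cone_def)
    have "inverse (u s y) \<le> B" "inverse (v s y) \<le> B"
      by (rule order_trans[OF abs_ge_self bspec[OF B(1) that, unfolded fst_conv snd_conv]]
        order_trans[OF abs_ge_self bspec[OF B(2) that, unfolded fst_conv snd_conv]])+
    then show "u s y \<in> {?p..C}" "v s y \<in> {?p..C}"
      using u_pos[OF s, of y] v_pos[OF s, of y] u_le[OF s, of y] v_le[OF s, of y] B(4) by (auto simp: field_simps)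
  qed
  have pC: "0 < z" if "z \<in> {?p..C}" for z
  proof -
    have "0 < ?p" using B(4) by simp
    with that show ?thesis by (simp only: atLeastAtMost_iff) linarith
  qed
  have d1: "((\<lambda>z. a / 2 * inverse z) has_real_derivative - (a / 2 * (inverse z * inverse z))) (at z)"
    and d2: "((\<lambda>z. 1 / 2 * F z * z powr (- a)) has_real_derivative
      1 / 2 * deriv F z * z powr (- a) + - a * z powr (- a - 1) * (1 / 2 * F z)) (at z)"
    and d3: "((\<lambda>z. z powr a) has_real_derivative a * z powr (a - 1)) (at z)" if "z \<in> {?p..C}" for z
  proof -
    note z = pC[OF that]
    show "((\<lambda>z. a / 2 * inverse z) has_real_derivative - (a / 2 * (inverse z * inverse z))) (at z)"
      using z by (auto intro!: derivative_eq_intros)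
    have "((\<lambda>z. z powr (- a)) has_real_derivative - a * z powr (- a - 1)) (at z)"
      using z by (auto intro!: derivative_eq_intros)
    from DERIV_mult[OF DERIV_cmult[OF F_deriv[OF z], of "1 / 2"] this]
    show "((\<lambda>z. 1 / 2 * F z * z powr (- a)) has_real_derivative
      1 / 2 * deriv F z * z powr (- a) + - a * z powr (- a - 1) * (1 / 2 * F z)) (at z)" .
    show "((\<lambda>z. z powr a) has_real_derivative a * z powr (a - 1)) (at z)"
      using z by (auto intro!: derivative_eq_intros)
  qed
  have sub: "{?p..C} \<subseteq> {0<..}" using pC by auto
  have ne: "\<forall>z\<in>{?p..C}. z \<noteq> 0" using pC less_irrefl by blast
  have c1: "continuous_on {?p..C} (\<lambda>z. - (a / 2 * (inverse z * inverse z)))"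
    by (intro continuous_intros ne)
  have c2: "continuous_on {?p..C} (\<lambda>z. 1 / 2 * deriv F z * z powr (- a) + - a * z powr (- a - 1) * (1 / 2 * F z))"
    using ne by (intro continuous_intros continuous_on_subset[OF deriv_F_cont sub] continuous_on_subset[OF F_cont sub]) auto
  have c3: "continuous_on {?p..C} (\<lambda>z. a * z powr (a - 1))"
    using ne by (intro continuous_intros) auto
  define \<phi>1 where "\<phi>1 z = a / 2 * inverse z" for z :: real
  define \<phi>2 where "\<phi>2 z = 1 / 2 * F z * z powr (- a)" for z :: real
  define \<phi>3 where "\<phi>3 z = z powr a" for z :: real
  obtain L where L: "0 \<le> L"
    "\<And>z z'. z \<in> {?p..C} \<Longrightarrow> z' \<in> {?p..C} \<Longrightarrow> \<bar>\<phi>1 z\<bar> \<le> L \<and> \<bar>\<phi>1 z - \<phi>1 z'\<bar> \<le> L * \<bar>z - z'\<bar>"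
    "\<And>z z'. z \<in> {?p..C} \<Longrightarrow> z' \<in> {?p..C} \<Longrightarrow> \<bar>\<phi>2 z\<bar> \<le> L \<and> \<bar>\<phi>2 z - \<phi>2 z'\<bar> \<le> L * \<bar>z - z'\<bar>"
    "\<And>z z'. z \<in> {?p..C} \<Longrightarrow> z' \<in> {?p..C} \<Longrightarrow> \<bar>\<phi>3 z\<bar> \<le> L \<and> \<bar>\<phi>3 z - \<phi>3 z'\<bar> \<le> L * \<bar>z - z'\<bar>"
  proof -
    from C1_lipschitz_compact[OF d1 c1] C1_lipschitz_compact[OF d2 c2] C1_lipschitz_compact[OF d3 c3]
    obtain b1 b2 b3 where b: "\<forall>L\<ge>b1. \<forall>x\<in>{?p..C}. \<forall>y\<in>{?p..C}. \<bar>\<phi>1 x\<bar> \<le> L \<and> \<bar>\<phi>1 x - \<phi>1 y\<bar> \<le> L * \<bar>x - y\<bar>"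
      "\<forall>L\<ge>b2. \<forall>x\<in>{?p..C}. \<forall>y\<in>{?p..C}. \<bar>\<phi>2 x\<bar> \<le> L \<and> \<bar>\<phi>2 x - \<phi>2 y\<bar> \<le> L * \<bar>x - y\<bar>"
      "\<forall>L\<ge>b3. \<forall>x\<in>{?p..C}. \<forall>y\<in>{?p..C}. \<bar>\<phi>3 x\<bar> \<le> L \<and> \<bar>\<phi>3 x - \<phi>3 y\<bar> \<le> L * \<bar>x - y\<bar>"
      unfolding \<phi>1_def \<phi>2_def \<phi>3_def by blast
    show thesis
      by (rule that[of "max 0 (max b1 (max b2 b3))"]; (rule b[THEN spec, THEN mp, THEN bspec, THEN bspec])?) auto
  qed
  define K where "K = 1 + (L * (4 * B) + L * (2 * B * B)) + (L * 2 + L * (2 * B)) + L * B"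
  have K1: "1 \<le> K" using L(1) B(4) by (simp add: K_def)
  \<comment> \<open>The existing type serves as the index set of three differences, so
    \<open>Disp\<close> and \<open>Logu\<close> both carry u - v. The coefficients 1 and -1 are
    written out to match \<open>C1_strip_lincomb\<close>.\<close>
  define w where "w i = (case i of Rinv \<Rightarrow> (\<lambda>t x. 1 * ?P 1 t x + (-1) * ?Q 1 t x)
    | Sinv \<Rightarrow> (\<lambda>t x. 1 * ?P (-1) t x + (-1) * ?Q (-1) t x) | _ \<Rightarrow> (\<lambda>t x. 1 * u t x + (-1) * v t x))" for i
  define wt where "wt i = (case i of Rinv \<Rightarrow> (\<lambda>t x. 1 * pt 1 t x + (-1) * qt 1 t x)
    | Sinv \<Rightarrow> (\<lambda>t x. 1 * pt (-1) t x + (-1) * qt (-1) t x) | _ \<Rightarrow> (\<lambda>t x. 1 * dt T u t x + (-1) * dt T v t x))" for i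
  define wx where "wx i = (case i of Rinv \<Rightarrow> (\<lambda>t x. 1 * px 1 t x + (-1) * qx 1 t x)
    | Sinv \<Rightarrow> (\<lambda>t x. 1 * px (-1) t x + (-1) * qx (-1) t x) | _ \<Rightarrow> (\<lambda>t x. 1 * dx u t x + (-1) * dx v t x))" for i
  define lam where "lam i t x = (case i of Rinv \<Rightarrow> - (1 * u t x powr a) | Sinv \<Rightarrow> - (-1 * u t x powr a) | _ \<Rightarrow> 0)" for i t x
  have main: "\<bar>1 * pt \<sigma> s y + (-1) * qt \<sigma> s y + - (\<sigma> * u s y powr a) * (1 * px \<sigma> s y + (-1) * qx \<sigma> s y)\<bar> \<le> K * e"
    if \<sigma>: "\<sigma> \<in> {1, -1}" and sy: "(s, y) \<in> ?D" and s0: "0 < s" and we: "\<bar>u s y - v s y\<bar> \<le> e"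
      "\<bar>?P 1 s y - ?Q 1 s y\<bar> \<le> e" "\<bar>?P (-1) s y - ?Q (-1) s y\<bar> \<le> e" for \<sigma> s y e
  proof -
    have sT: "s \<in> {0<..T}" using sy s0 by (auto simp: dependence_cone_def)
    have e0: "0 \<le> e" using we(1) by linarith
    define r where "r = ?P 1 s y - ?P (-1) s y"
    define r' where "r' = ?Q 1 s y - ?Q (-1) s y"
    have bnd: "\<bar>?P \<tau> s y\<bar> \<le> B" "\<bar>?Q \<tau> s y\<bar> \<le> B" "\<bar>qx \<tau> s y\<bar> \<le> B" if "\<tau> \<in> {1, -1}" for \<tau>
      using bspec[OF B(3)[OF that] sy] by simp_all
    have rr: "\<bar>r - r'\<bar> \<le> 2 * e" using we(2,3) unfolding r_def r'_def by linarith
    have r'B: "\<bar>r'\<bar> \<le> 2 * B"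
      using abs_triangle_ineq4[of "?Q 1 s y" "?Q (-1) s y"] bnd(2)[of 1] bnd(2)[of "-1"] unfolding r'_def by simp
    have rB: "\<bar>r\<bar> \<le> 2 * B"
      using abs_triangle_ineq4[of "?P 1 s y" "?P (-1) s y"] bnd(1)[of 1] bnd(1)[of "-1"] unfolding r_def by simp
    have ws: "\<bar>?P \<sigma> s y - ?Q \<sigma> s y\<bar> \<le> e" using \<sigma> we by auto
    note ranges = range[OF sy]
    have l: "\<bar>\<phi>1 (u s y) - \<phi>1 (v s y)\<bar> \<le> L * e" "\<bar>\<phi>2 (u s y) - \<phi>2 (v s y)\<bar> \<le> L * e" "\<bar>\<phi>3 (u s y) - \<phi>3 (v s y)\<bar> \<le> L * e"
      using L(2-4)[OF ranges] mult_left_mono[OF we(1) L(1)] by linarith+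
    have bl: "\<bar>\<phi>1 (u s y)\<bar> \<le> L" "\<bar>\<phi>2 (u s y)\<bar> \<le> L" using L(2,3)[OF ranges] by auto
    have prod: "\<bar>r * ?P \<sigma> s y - r' * ?Q \<sigma> s y\<bar> \<le> 4 * B * e"
    proof -
      have "\<bar>r\<bar> * \<bar>?P \<sigma> s y - ?Q \<sigma> s y\<bar> \<le> 2 * B * e" "\<bar>r - r'\<bar> * \<bar>?Q \<sigma> s y\<bar> \<le> 2 * e * B"
        using rB ws rr bnd(2)[OF \<sigma>] e0 B(4) by (auto intro!: mult_mono)
      moreover have "2 * e * B = 2 * B * e" by simp
      ultimately show ?thesis using abs_mult_diff_le[of r "?P \<sigma> s y" r' "?Q \<sigma> s y"] by linarith
    qed
    have prod': "\<bar>r' * ?Q \<sigma> s y\<bar> \<le> 2 * B * B"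
      unfolding abs_mult using r'B bnd(2)[OF \<sigma>] B(4) by (intro mult_mono) auto
    have A1: "\<bar>\<phi>1 (u s y) * (r * ?P \<sigma> s y) - \<phi>1 (v s y) * (r' * ?Q \<sigma> s y)\<bar> \<le> L * (4 * B * e) + L * e * (2 * B * B)"
      using L(1) e0 by (intro order_trans[OF abs_mult_diff_le] add_mono mult_mono bl l prod prod') auto
    have A2: "\<bar>\<phi>2 (u s y) * r - \<phi>2 (v s y) * r'\<bar> \<le> L * (2 * e) + L * e * (2 * B)"
      using L(1) e0 by (intro order_trans[OF abs_mult_diff_le] add_mono mult_mono bl l rr r'B) auto
    have A3: "\<bar>(\<phi>3 (u s y) - \<phi>3 (v s y)) * qx \<sigma> s y\<bar> \<le> L * e * B"
      unfolding abs_mult using L(1) e0 by (intro mult_mono l bnd(3)[OF \<sigma>]) auto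
    \<comment> \<open>Transporting both invariants with the speed of \<open>u\<close> leaves the
      mismatch of u^a and v^a, multiplied by the slope \<open>qx\<close> of the second
      solution.\<close>
    have eq: "1 * pt \<sigma> s y + (-1) * qt \<sigma> s y + - (\<sigma> * u s y powr a) * (1 * px \<sigma> s y + (-1) * qx \<sigma> s y)
      = \<sigma> * (\<phi>1 (u s y) * (r * ?P \<sigma> s y) - \<phi>1 (v s y) * (r' * ?Q \<sigma> s y)) + (\<phi>2 (u s y) * r - \<phi>2 (v s y) * r')
        + \<sigma> * ((\<phi>3 (u s y) - \<phi>3 (v s y)) * qx \<sigma> s y)"
    proof -
      have "pt \<sigma> s y - \<sigma> * u s y powr a * px \<sigma> s y = \<sigma> * (\<phi>1 (u s y) * (r * ?P \<sigma> s y)) + \<phi>2 (u s y) * r"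
        using p(2)[OF \<sigma> sT, of y] by (simp only: \<phi>1_def \<phi>2_def r_def)
      moreover have "qt \<sigma> s y - \<sigma> * v s y powr a * qx \<sigma> s y = \<sigma> * (\<phi>1 (v s y) * (r' * ?Q \<sigma> s y)) + \<phi>2 (v s y) * r'"
        using q(2)[OF \<sigma> sT, of y] by (simp only: \<phi>1_def \<phi>2_def r'_def)
      ultimately show ?thesis unfolding \<phi>3_def by (simp add: algebra_simps)
    qed
    have abs\<sigma>: "\<bar>\<sigma> * z\<bar> = \<bar>z\<bar>" for z using \<sigma> by auto
    have tri: "\<bar>z1 + z2 + z3\<bar> \<le> b1 + b2 + b3" if "\<bar>z1\<bar> \<le> b1" "\<bar>z2\<bar> \<le> b2" "\<bar>z3\<bar> \<le> b3" for z1 z2 z3 b1 b2 b3 :: real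
      using that by linarith
    have "\<bar>1 * pt \<sigma> s y + (-1) * qt \<sigma> s y + - (\<sigma> * u s y powr a) * (1 * px \<sigma> s y + (-1) * qx \<sigma> s y)\<bar>
      \<le> (L * (4 * B * e) + L * e * (2 * B * B)) + (L * (2 * e) + L * e * (2 * B)) + L * e * B"
      unfolding eq by (rule tri) (simp_all only: abs\<sigma> A1 A2 A3)
    also have "\<dots> = K * e - e" by (simp add: K_def algebra_simps)
    finally show ?thesis using e0 by linarith
  qed
  have "w Disp t x = 0"
  proof (rule cone_uniqueness[where w = w and T = T and \<Lambda> = \<Lambda> and wt = wt and wx = wx and lam = lam and K = K and N = N, OF _ \<Lambda>])
    show "C1_strip T (w i) (wt i) (wx i)" for i
      by (cases i) (simp_all only: w_def wt_def wx_def wave_component.case C1_strip_lincomb[OF hu hv] C1_strip_lincomb[OF p(1) q(1)])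
    show "\<bar>lam i t x\<bar> \<le> \<Lambda>" if "t \<in> {0..T}" for i t x
    proof -
      have "u t x powr a \<le> \<Lambda>" unfolding \<Lambda>_def
        using u_pos[OF that, of x] u_le[OF that, of x] exponents by (intro powr_mono2) auto
      then show ?thesis using \<Lambda> by (cases i) (auto simp: lam_def)
    qed
    show "w i 0 x = 0" for i x
    proof -
      have eq0: "u 0 y = v 0 y" "dt T u 0 y = dt T v 0 y" for y using u v by (simp_all add: cauchy_solution_def)
      then have "dx u 0 y = dx v 0 y" for y by (simp add: dx_def)
      with eq0 show ?thesis by (cases i) (simp_all add: w_def char_comb_def)
    qed
    show "(t, x) \<in> ?D" using t mult_nonneg_nonneg[OF \<Lambda>, of "T - t"] by (auto simp: dependence_cone_def N_def)
  next
    fix i s y e assume sy: "(s, y) \<in> ?D" and s0: "0 < s" and we: "\<And>j. \<bar>w j s y\<bar> \<le> e"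
    have w3: "\<bar>u s y - v s y\<bar> \<le> e" "\<bar>?P 1 s y - ?Q 1 s y\<bar> \<le> e" "\<bar>?P (-1) s y - ?Q (-1) s y\<bar> \<le> e"
      using we[of Disp] we[of Rinv] we[of Sinv] by (simp_all add: w_def)
    have e0: "0 \<le> e" using w3(1) by linarith
    have dtw: "\<bar>1 * dt T u s y + (-1) * dt T v s y + 0 * z\<bar> \<le> K * e" for z
    proof -
      have "dt T u s y - dt T v s y = ((?P 1 s y - ?Q 1 s y) + (?P (-1) s y - ?Q (-1) s y)) / 2"
        by (simp add: char_comb_def)
      then have "\<bar>dt T u s y - dt T v s y\<bar> \<le> e"
        using w3(2,3) abs_triangle_ineq[of "?P 1 s y - ?Q 1 s y" "?P (-1) s y - ?Q (-1) s y"] by simp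
      moreover have "1 * e \<le> K * e" using K1 e0 by (intro mult_right_mono)
      ultimately show ?thesis by simp
    qed
    show "\<bar>wt i s y + lam i s y * wx i s y\<bar> \<le> K * e"
      using dtw main[OF _ sy s0 w3, of 1] main[OF _ sy s0 w3, of "-1"]
      by (cases i) (simp_all only: wt_def wx_def lam_def wave_component.case insert_iff refl simp_thms)
  qed
  then show ?thesis by (simp add: w_def)
qed

end

theorem theorem1p1:
  fixes a \<alpha> \<beta> \<gamma> c1 c2 c3 c4 :: real and CK :: "real \<Rightarrow> real"
  assumes "a \<ge> 0" "\<alpha> \<ge> 0" "\<beta> \<ge> 0" "\<alpha> \<le> \<beta>" "a * \<alpha> \<le> \<beta>"
    and "\<gamma> = (if a \<ge> 1 then 0 else (1 - a) * \<alpha>)"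
    and "c1 > 0" "c2 > 0" "c3 > 0" "c4 > 0"
    and "\<forall>K>0. CK K > 0"
  shows "\<exists>T>0. \<forall>u0 u1 F.
    admissible_data a \<alpha> \<beta> \<gamma> c1 c2 c3 c4 u0 u1 \<longrightarrow>
    admissible_nonlinearity a CK F \<longrightarrow>
    (\<exists>u. cauchy_solution a F u0 u1 T u \<and>
         (\<exists>C1>0. \<exists>C2>0. \<exists>C3>0. \<exists>C4>0. solution_bounds a \<alpha> \<beta> \<gamma> C1 C2 C3 C4 T u) \<and>
         (\<forall>v. cauchy_solution a F u0 u1 T v \<and>
              (\<exists>C1>0. \<exists>C2>0. \<exists>C3>0. \<exists>C4>0. solution_bounds a \<alpha> \<beta> \<gamma> C1 C2 C3 C4 T v) \<longrightarrow>
              (\<forall>t\<in>{0..T}. \<forall>x. v t x = u t x)))"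
proof -
  interpret problem_constants a \<alpha> \<beta> \<gamma> c1 c2 c3 c4 CK
    by unfold_locales (fact assms)+
  obtain T where good: "good_time T" using ex_good_time by blast
  then have T0: "0 < T" by (simp add: good_time_def)
  show ?thesis
  proof (rule exI[of _ T], rule conjI[OF T0], intro allI impI)
    fix u0 u1 F
    assume "admissible_data a \<alpha> \<beta> \<gamma> c1 c2 c3 c4 u0 u1" "admissible_nonlinearity a CK F"
    then interpret problem a \<alpha> \<beta> \<gamma> c1 c2 c3 c4 CK u0 u1 F by unfold_locales
    have range: "\<exists>C. \<forall>t\<in>{0..T}. \<forall>x. 0 < v t x \<and> v t x \<le> C"
      if "\<exists>C1>0. \<exists>C2>0. \<exists>C3>0. \<exists>C4>0. solution_bounds a \<alpha> \<beta> \<gamma> C1 C2 C3 C4 T v" for v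
    proof -
      from that obtain C1 C2 C3 C4 where C: "C1 > 0" "solution_bounds a \<alpha> \<beta> \<gamma> C1 C2 C3 C4 T v" by blast
      have "0 < v t x \<and> v t x \<le> C2" if t: "t \<in> {0..T}" for t x
      proof -
        have "C1 * japanese_bracket x powr (- \<alpha>) \<le> v t x" "v t x \<le> C2"
          using C(2) t unfolding solution_bounds_def by blast+
        with mult_pos_pos[OF C(1) bracket_powr_pos[of x "- \<alpha>"]] show ?thesis by linarith
      qed
      then show ?thesis by blast
    qed
    from existence[OF good] obtain u where u: "cauchy_solution a F u0 u1 T u"
      "\<exists>C1>0. \<exists>C2>0. \<exists>C3>0. \<exists>C4>0. solution_bounds a \<alpha> \<beta> \<gamma> C1 C2 C3 C4 T u" by blast
    from range[OF u(2)] obtain C where C: "\<forall>t\<in>{0..T}. \<forall>x. 0 < u t x \<and> u t x \<le> C" by blast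
    have "v t x = u t x" if v: "cauchy_solution a F u0 u1 T v"
      "\<exists>C1>0. \<exists>C2>0. \<exists>C3>0. \<exists>C4>0. solution_bounds a \<alpha> \<beta> \<gamma> C1 C2 C3 C4 T v" and t: "t \<in> {0..T}" for v t x
    proof -
      \<comment> \<open>The competitor has constants of its own, so the two upper bounds are merged
        by their maximum.\<close>
      from range[OF v(2)] obtain C' where C': "\<forall>t\<in>{0..T}. \<forall>x. 0 < v t x \<and> v t x \<le> C'" by blast
      show ?thesis
        by (rule uniqueness[OF T0 u(1) v(1), of "max C C'"]) (use C C' t in \<open>auto simp: le_max_iff_disj\<close>)
    qed
    with u show "\<exists>u. cauchy_solution a F u0 u1 T u \<and>
         (\<exists>C1>0. \<exists>C2>0. \<exists>C3>0. \<exists>C4>0. solution_bounds a \<alpha> \<beta> \<gamma> C1 C2 C3 C4 T u) \<and>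
         (\<forall>v. cauchy_solution a F u0 u1 T v \<and>
              (\<exists>C1>0. \<exists>C2>0. \<exists>C3>0. \<exists>C4>0. solution_bounds a \<alpha> \<beta> \<gamma> C1 C2 C3 C4 T v) \<longrightarrow>
              (\<forall>t\<in>{0..T}. \<forall>x. v t x = u t x))"
      by blast
  qed
qed

end
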